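(* Let $0<\varepsilon_0\ll1$, $\varepsilon\in(0,\varepsilon_0)$, $\tau\le\frac12\varepsilon^3$, $\gamma\ge\frac52$, $h=\varepsilon^\eta$ with $0<\eta\le\frac{2}{3d}\gamma-\frac{3}{2d}$, and $\mathcal E(u_0^\varepsilon)\le C$. Let $X^j$ be the numerical solution and $\Omega_{\mathcal E}=\{\omega\in\Omega:\max_{0\le j\le J}\mathcal E(X^j)\le C\varepsilon^{-\theta}\}$ for some $\theta>0$. Then $$\mathbb E\Big[\max_{1\le j\le J}\mathbf 1_{\Omega_{\mathcal E}}\|X^j\|_{\mathbb L^\infty}^2\Big]\le C\varepsilon^{-2\theta-7}.$$
   Context: Let $d\in\{2,3\}$, $\mathcal D=[0,1]^d$, $T>0$, $\gamma>0$, $\varepsilon>0$. $\|\cdot\|,(\cdot,\cdot)$ are the norm and inner product of $\mathbb L^2=L^2(\mathcal D)$; $\mathbb L^p=L^p(\mathcal D)$, $\mathbb H^s=H^s(\mathcal D)$; $m(v)=|\mathcal D|^{-1}\int_{\mathcal D}v\,dx$. $F(u)=\frac14(u^2-1)^2$, $f(u)=u^3-u$, $\mathcal E(u)=\frac\varepsilon2\|\nabla u\|^2+\frac1\varepsilon\|F(u)\|_{\mathbb L^1}$. The initial datum $u_0^\varepsilon$ has zero mean and satisfies the standing assumption $\|u_0^\varepsilon\|_{\mathbb H^2}\le C\varepsilon^{-\mathfrak p_{\mathrm{CH}}}$ with $0<2\mathfrak p_{\mathrm{CH}}<5$. Discrete noise: $\mathcal T_h$ is a quasi-uniform triangulation of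 $\mathcal D$ with mesh size $h$, $\mathbb V_h$ the globally continuous piecewise linear functions with nodal basis $\{\phi_l\}_{l=1}^L$. For $J\in\mathbb N$, $\tau=T/J$, $t_j=j\tau$ and independent standard real Brownian motions $\{\beta_l\}_{l=1}^L$ on $(\Omega,\mathcal F,\mathbb P)$, $\Delta_j\beta_l=\beta_l(t_j)-\beta_l(t_{j-1})$, $\Delta_jW=\sum_{l=1}^L\frac{\phi_l}{\sqrt{(d+1)^{-1}|(\phi_l,1)|}}\Delta_j\beta_l$, $\Delta_j\overline W=\Delta_jW-m(\Delta_jW)$. Scheme: $X^0=u_0^\varepsilon$; for $j=1,\dots,J$, $(X^j,w^j)\in[\mathbb H^1]^2$ solves $(X^j-X^{j-1},\varphi)+\tau(\nabla w^j,\nabla\varphi)=\varepsilon^\gamma(\Delta_j\overline W,\varphi)$, $\varepsilon(\nabla X^j,\nabla\psi)+\frac1\varepsilon(f(X^j),\psi)=(w^j,\psi)$ for all $\varphi,\psi\in\mathbb H^1$. $C$ denotes generic positive constants that may depend on $T,\mathcal D$ but not on $\varepsilon,\tau,h$. *)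

theory Defs
  imports "HOL-Analysis.Analysis" "HOL-Probability.Probability"
    "HOL-Probability.Essential_Supremum"
begin

text \<open>Functions on the cube are total functions on the ambient space, read modulo null sets of
  the cube: every notion below that is applied to them only sees the restriction to
  \<open>unit_cube\<close>.\<close>

definition unit_cube :: "(real^'n) set" where
  "unit_cube = cbox 0 1"

abbreviation cube_measure :: "(real^'n) measure" where
  "cube_measure \<equiv> lebesgue_on unit_cube"

definition L2_inner :: "(real^'n \<Rightarrow> real) \<Rightarrow> (real^'n \<Rightarrow> real) \<Rightarrow> real" where
  "L2_inner u v = (LINT x|cube_measure. u x * v x)"

definition L2_inner_vec :: "(real^'n \<Rightarrow> real^'n) \<Rightarrow> (real^'n \<Rightarrow> real^'n) \<Rightarrow> real" where
  "L2_inner_vec U V = (LINT x|cube_measure. U x \<bullet> V x)"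

definition L2_space :: "(real^'n \<Rightarrow> real) set" where
  "L2_space = {u \<in> borel_measurable cube_measure. integrable cube_measure (\<lambda>x. (u x)\<^sup>2)}"

definition Linf_norm :: "(real^'n \<Rightarrow> real) \<Rightarrow> ennreal" where
  "Linf_norm u = esssup cube_measure (\<lambda>x. ennreal \<bar>u x\<bar>)"

definition cube_mean :: "(real^'n \<Rightarrow> real) \<Rightarrow> real" where
  "cube_mean v = (LINT x|cube_measure. v x) / measure lebesgue (unit_cube :: (real^'n) set)"

definition partial_deriv :: "'n \<Rightarrow> (real^'n \<Rightarrow> real) \<Rightarrow> real^'n \<Rightarrow> real" where
  "partial_deriv i f x = frechet_derivative f (at x) (axis i 1)"

primrec C_k :: "nat \<Rightarrow> (real^'n \<Rightarrow> real) \<Rightarrow> bool" where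
  "C_k 0 f \<longleftrightarrow> continuous_on UNIV f"
| "C_k (Suc k) f \<longleftrightarrow> (\<forall>x. f differentiable (at x)) \<and> (\<forall>i. C_k k (partial_deriv i f))"

definition test_functions :: "(real^'n \<Rightarrow> real) set" where
  "test_functions = {\<phi>. (\<forall>k. C_k k \<phi>) \<and> compact (closure {x. \<phi> x \<noteq> 0}) \<and>
     closure {x. \<phi> x \<noteq> 0} \<subseteq> interior unit_cube}"

definition has_weak_deriv :: "'n \<Rightarrow> (real^'n \<Rightarrow> real) \<Rightarrow> (real^'n \<Rightarrow> real) \<Rightarrow> bool" where
  "has_weak_deriv i u v \<longleftrightarrow>
     (\<forall>\<phi>\<in>test_functions. L2_inner u (partial_deriv i \<phi>) = - L2_inner v \<phi>)"

text \<open>Weak derivatives are unique up to null sets of the cube; \<open>weak_deriv\<close> picks a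
  square-integrable representative if there is one.\<close>

definition weak_deriv :: "'n \<Rightarrow> (real^'n \<Rightarrow> real) \<Rightarrow> real^'n \<Rightarrow> real" where
  "weak_deriv i u = (SOME v. v \<in> L2_space \<and> has_weak_deriv i u v)"

definition weak_grad :: "(real^'n \<Rightarrow> real) \<Rightarrow> real^'n \<Rightarrow> real^'n" where
  "weak_grad u x = (\<chi> i. weak_deriv i u x)"

definition H1_space :: "(real^'n \<Rightarrow> real) set" where
  "H1_space = {u \<in> L2_space. \<forall>i. \<exists>v\<in>L2_space. has_weak_deriv i u v}"

definition H2_space :: "(real^'n \<Rightarrow> real) set" where
  "H2_space = {u \<in> H1_space. \<forall>i. weak_deriv i u \<in> H1_space}"

definition H2_norm :: "(real^'n \<Rightarrow> real) \<Rightarrow> real" where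
  "H2_norm u = sqrt (L2_inner u u + (\<Sum>i\<in>UNIV. L2_inner (weak_deriv i u) (weak_deriv i u))
     + (\<Sum>i\<in>UNIV. \<Sum>k\<in>UNIV. L2_inner (weak_deriv k (weak_deriv i u)) (weak_deriv k (weak_deriv i u))))"

definition F_pot :: "real \<Rightarrow> real" where
  "F_pot u = (u\<^sup>2 - 1)\<^sup>2 / 4"

definition f_pot :: "real \<Rightarrow> real" where
  "f_pot u = u ^ 3 - u"

text \<open>The \<open>L\<^sup>1\<close> norm is a nonnegative Lebesgue integral, so that it is \<open>\<infinity>\<close> (and not the
  default value \<open>0\<close>) when the integrand is not integrable.\<close>

definition energy :: "real \<Rightarrow> (real^'n \<Rightarrow> real) \<Rightarrow> ennreal" where
  "energy \<epsilon> u = ennreal (\<epsilon> / 2 * L2_inner_vec (weak_grad u) (weak_grad u))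
     + ennreal (1 / \<epsilon>) * (\<integral>\<^sup>+ x. ennreal \<bar>F_pot (u x)\<bar> \<partial>cube_measure)"

definition cube_triangulation :: "(real^'n) set set \<Rightarrow> bool" where
  "cube_triangulation \<T> \<longleftrightarrow> triangulation \<T> \<and> (\<forall>K\<in>\<T>. int CARD('n) simplex K)
     \<and> \<Union>\<T> = unit_cube"

definition mesh_size :: "(real^'n) set set \<Rightarrow> real" where
  "mesh_size \<T> = (MAX K\<in>\<T>. diameter K)"

text \<open>Quasi-uniformity of a family of meshes means that one \<open>\<kappa>\<close> works for all its members.\<close>

definition quasi_uniform :: "real \<Rightarrow> (real^'n) set set \<Rightarrow> bool" where
  "quasi_uniform \<kappa> \<T> \<longleftrightarrow> (\<forall>K\<in>\<T>. \<exists>x. cball x (\<kappa> * mesh_size \<T>) \<subseteq> K)"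

definition mesh_nodes :: "(real^'n) set set \<Rightarrow> (real^'n) set" where
  "mesh_nodes \<T> = {z. \<exists>K\<in>\<T>. z extreme_point_of K}"

definition P1_space :: "(real^'n) set set \<Rightarrow> (real^'n \<Rightarrow> real) set" where
  "P1_space \<T> = {v. continuous_on unit_cube v \<and> (\<forall>K\<in>\<T>. \<exists>a b. \<forall>x\<in>K. v x = a + b \<bullet> x)}"

text \<open>The nodal basis is indexed by the nodes themselves; each basis function is unique on the
  cube, and only its values there are used.\<close>

definition nodal_basis :: "(real^'n) set set \<Rightarrow> real^'n \<Rightarrow> real^'n \<Rightarrow> real" where
  "nodal_basis \<T> z = (SOME \<phi>. \<phi> \<in> P1_space \<T> \<and>
     (\<forall>y\<in>mesh_nodes \<T>. \<phi> y = (if y = z then 1 else 0)))"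

definition brownian_motion :: "'w measure \<Rightarrow> (real \<Rightarrow> 'w \<Rightarrow> real) \<Rightarrow> bool" where
  "brownian_motion M B \<longleftrightarrow>
     (\<forall>t\<ge>0. B t \<in> borel_measurable M) \<and>
     (AE \<omega> in M. B 0 \<omega> = 0) \<and>
     (\<forall>s t. 0 \<le> s \<and> s < t \<longrightarrow>
        distributed M lborel (\<lambda>\<omega>. B t \<omega> - B s \<omega>) (normal_density 0 (sqrt (t - s)))) \<and>
     (\<forall>(n::nat) s. 0 \<le> s 0 \<and> (\<forall>i<n. s i < s (Suc i)) \<longrightarrow>
        prob_space.indep_vars M (\<lambda>_. borel) (\<lambda>i \<omega>. B (s (Suc i)) \<omega> - B (s i) \<omega>) {..<n}) \<and>
     (AE \<omega> in M. continuous_on {0..} (\<lambda>t. B t \<omega>))"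

definition indep_brownian_motions :: "'w measure \<Rightarrow> 'i set \<Rightarrow> ('i \<Rightarrow> real \<Rightarrow> 'w \<Rightarrow> real) \<Rightarrow> bool" where
  "indep_brownian_motions M I \<beta> \<longleftrightarrow> (\<forall>l\<in>I. brownian_motion M (\<beta> l)) \<and>
     prob_space.indep_vars M (\<lambda>_. Pi\<^sub>M {0..} (\<lambda>_. borel)) (\<lambda>l \<omega>. \<lambda>t\<in>{0..}. \<beta> l t \<omega>) I"

definition noise_incr ::
  "(real^'n) set set \<Rightarrow> real \<Rightarrow> (real^'n \<Rightarrow> real \<Rightarrow> 'w \<Rightarrow> real) \<Rightarrow> nat \<Rightarrow> 'w \<Rightarrow> real^'n \<Rightarrow> real" where
  "noise_incr \<T> \<tau> \<beta> j \<omega> x = (\<Sum>z\<in>mesh_nodes \<T>.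
     nodal_basis \<T> z x / sqrt (\<bar>L2_inner (nodal_basis \<T> z) (\<lambda>_. 1)\<bar> / (real CARD('n) + 1))
       * (\<beta> z (real j * \<tau>) \<omega> - \<beta> z (real (j - 1) * \<tau>) \<omega>))"

definition noise_incr_bar ::
  "(real^'n) set set \<Rightarrow> real \<Rightarrow> (real^'n \<Rightarrow> real \<Rightarrow> 'w \<Rightarrow> real) \<Rightarrow> nat \<Rightarrow> 'w \<Rightarrow> real^'n \<Rightarrow> real" where
  "noise_incr_bar \<T> \<tau> \<beta> j \<omega> x = noise_incr \<T> \<tau> \<beta> j \<omega> x - cube_mean (noise_incr \<T> \<tau> \<beta> j \<omega>)"

text \<open>One realisation: \<open>dW j\<close> stands for the mean-free noise increment on the \<open>j\<close>-th
  interval, without the factor \<open>\<epsilon> powr \<gamma>\<close>.\<close>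

definition CH_scheme ::
  "real \<Rightarrow> real \<Rightarrow> real \<Rightarrow> nat \<Rightarrow> (nat \<Rightarrow> real^'n \<Rightarrow> real) \<Rightarrow> (real^'n \<Rightarrow> real)
    \<Rightarrow> (nat \<Rightarrow> real^'n \<Rightarrow> real) \<Rightarrow> (nat \<Rightarrow> real^'n \<Rightarrow> real) \<Rightarrow> bool" where
  "CH_scheme \<epsilon> \<gamma> \<tau> J dW u0 X w \<longleftrightarrow> X 0 = u0 \<and>
     (\<forall>j\<in>{1..J}. X j \<in> H1_space \<and> w j \<in> H1_space \<and>
        (\<forall>\<phi>\<in>H1_space. L2_inner (\<lambda>x. X j x - X (j - 1) x) \<phi>
             + \<tau> * L2_inner_vec (weak_grad (w j)) (weak_grad \<phi>)
           = \<epsilon> powr \<gamma> * L2_inner (dW j) \<phi>) \<and>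
        (\<forall>\<psi>\<in>H1_space. \<epsilon> * L2_inner_vec (weak_grad (X j)) (weak_grad \<psi>)
             + 1 / \<epsilon> * L2_inner (\<lambda>x. f_pot (X j x)) \<psi>
           = L2_inner (w j) \<psi>))"

definition Omega_E :: "'w measure \<Rightarrow> real \<Rightarrow> nat \<Rightarrow> real \<Rightarrow> (nat \<Rightarrow> 'w \<Rightarrow> real^'n \<Rightarrow> real) \<Rightarrow> 'w set" where
  "Omega_E M \<epsilon> J b X = {\<omega> \<in> space M. (MAX j\<in>{0..J}. energy \<epsilon> (X j \<omega>)) \<le> ennreal b}"

end

theory Submission
  imports Defs "HOL-Real_Asymp.Real_Asymp"
begin

text \<open>Everything is read off the cosine coefficients: the supremum norm is at most \<open>2^d\<close> times
  the absolute sum of the coefficients, and in each mode of eigenvalue \<open>\<lambda>\<close> the scheme is a scalar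
  recursion damped by \<open>1 / (1 + \<tau> * \<epsilon> * \<lambda>\<^sup>2)\<close>, since the cosine modes satisfy the Neumann condition.
  The initial datum contributes at most its \<open>H\<^sup>2\<close> norm. For the nonlinearity, the energy bound
  controls \<open>X\<close> in \<open>L\<^sup>4\<close> and, through the critical Sobolev embedding, in \<open>L\<^sup>6\<close>; interpolating
  between the two on dyadic shells of modes makes the damped sum of the coefficients of \<open>f(X)\<close>
  converge, with a value of order \<open>\<epsilon> powr (- 7 / 2 - \<theta>)\<close>. For the noise,
  summation by parts against the \<open>2 / 5\<close>-Hoelder modulus of each Brownian motion gives a factor
  \<open>(\<epsilon> * \<lambda>\<^sup>2) powr (- 2 / 5)\<close>, which is square summable over the modes as \<open>8 / 5 > 3 / 2\<close>; the upper bound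
  on \<open>\<eta>\<close> keeps the number of nodes small enough for the noise to be of lower order.\<close>

section \<open>Smooth functions of one variable\<close>

text \<open>The forcing decides the exponent. The L^6 bound puts f(X) in L^2: N of its coefficients
  sum to order N powr (1/2), which the damping beats, but the price is \<epsilon> powr (- 3/2 -
  3\<theta>/2), too much \<theta>. The L^4 bound costs only \<epsilon> powr (- 3\<theta>/4) but
  gives N powr (3/4), where N is of order weight powr (3/2), and the sum over the modes diverges.
  Interpolation with exponents 2/3 and 1/3 yields exactly one power of \<theta>, in total \<epsilon>
  powr (- 5/2 - \<theta>) with the damping, but there the series over the shells has ratio 1.
  Exponents 2/3 - \<delta> and 1/3 + \<delta> restore convergence; the spare factor 1/\<epsilon> up
  to 7/2 pays for \<delta>, which has to shrink like 1/\<theta>.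

  No boundary condition is known for the functions that are expanded, so each passage from weak
  derivatives to coefficients puts it on the mode: differentiated directions carry sines. The noise
  is bounded path by path and uniformly in time, so the maximum over j costs nothing beyond the
  moment of one Hoelder modulus per node.\<close>

primrec smooth_k :: "nat \<Rightarrow> (real \<Rightarrow> real) \<Rightarrow> bool" where
  "smooth_k 0 g \<longleftrightarrow> continuous_on UNIV g"
| "smooth_k (Suc k) g \<longleftrightarrow> (\<forall>x. g differentiable (at x)) \<and> smooth_k k (deriv g)"

definition smooth :: "(real \<Rightarrow> real) \<Rightarrow> bool" where
  "smooth g \<longleftrightarrow> (\<forall>k. smooth_k k g)"

lemma smooth_DERIV: "smooth g \<Longrightarrow> (g has_real_derivative deriv g x) (at x)"
proof -
  assume "smooth g"
  then have "smooth_k (Suc 0) g" unfolding smooth_def by blast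
  then show ?thesis by (simp add: DERIV_deriv_iff_real_differentiable)
qed

lemma smooth_deriv: "smooth g \<Longrightarrow> smooth (deriv g)"
  unfolding smooth_def using smooth_k.simps(2) by blast

lemma smooth_continuous: "smooth g \<Longrightarrow> continuous_on UNIV g"
  unfolding smooth_def using smooth_k.simps(1) by blast

lemma smooth_kI:
  assumes "(\<And>x. (g has_real_derivative g' x) (at x))" "smooth_k k g'"
  shows "smooth_k (Suc k) g"
proof -
  have "deriv g = g'" using assms(1) by (auto intro!: DERIV_imp_deriv)
  then show ?thesis using assms by (auto simp: real_differentiable_def)
qed

text \<open>A class of functions that is closed under differentiation consists of smooth functions.
  This replaces inductions on the order for explicit families such as p(1/u) exp(- 1/u), whose
  higher derivatives have no closed form.\<close>

lemma smooth_coinduct: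
  assumes "g \<in> S" and "\<And>g. g \<in> S \<Longrightarrow> \<exists>g'\<in>S. \<forall>x. (g has_real_derivative g' x) (at x)"
  shows "smooth g"
proof -
  have "smooth_k k g" if "g \<in> S" for k g using that
  proof (induction k arbitrary: g)
    case 0
    then show ?case using assms(2)[OF 0]
      by (auto intro!: continuous_at_imp_continuous_on DERIV_isCont)
  next
    case (Suc k)
    then obtain g' where "g' \<in> S" "\<And>x. (g has_real_derivative g' x) (at x)"
      using assms(2) by blast
    then show ?case using Suc.IH smooth_kI by blast
  qed
  then show ?thesis using assms(1) by (auto simp: smooth_def)
qed

lemma smooth_k_Suc_imp: "smooth_k (Suc k) g \<Longrightarrow> smooth_k k g"
proof (induction k arbitrary: g)
  case 0
  then show ?case by (auto intro!: continuous_at_imp_continuous_on differentiable_imp_continuous_within)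
next
  case (Suc k)
  then show ?case by (metis smooth_k.simps(2))
qed

lemma smooth_k_add:
  "smooth_k k f \<Longrightarrow> smooth_k k g \<Longrightarrow> smooth_k k (\<lambda>x. f x + g x)"
proof (induction k arbitrary: f g)
  case 0
  then show ?case by (auto intro: continuous_on_add)
next
  case (Suc k)
  have "smooth_k k (\<lambda>x. deriv f x + deriv g x)" using Suc by simp
  moreover have "((\<lambda>x. f x + g x) has_real_derivative deriv f x + deriv g x) (at x)" for x
    using Suc.prems by (auto intro!: DERIV_add simp: DERIV_deriv_iff_real_differentiable)
  ultimately show ?case by (rule smooth_kI[rotated])
qed

lemma smooth_k_mult:
  "smooth_k k f \<Longrightarrow> smooth_k k g \<Longrightarrow> smooth_k k (\<lambda>x. f x * g x)"
proof (induction k arbitrary: f g)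
  case 0
  then show ?case by (auto intro: continuous_on_mult)
next
  case (Suc k)
  have "smooth_k k f" "smooth_k k g" using Suc.prems smooth_k_Suc_imp by blast+
  then have "smooth_k k (\<lambda>x. deriv f x * g x + deriv g x * f x)" using Suc
    by (intro smooth_k_add) auto
  moreover have "((\<lambda>x. f x * g x) has_real_derivative deriv f x * g x + deriv g x * f x) (at x)" for x
    using Suc.prems by (auto intro!: DERIV_mult simp: DERIV_deriv_iff_real_differentiable)
  ultimately show ?case by (rule smooth_kI[rotated])
qed

lemma smooth_mult: "smooth f \<Longrightarrow> smooth g \<Longrightarrow> smooth (\<lambda>x. f x * g x)"
  by (simp add: smooth_def smooth_k_mult)

lemma smooth_affine:
  assumes "smooth g" shows "smooth (\<lambda>t. g (a * t + b))"
proof (rule smooth_coinduct[where S="{\<lambda>t. c * f (a * t + b) | c f. smooth f}"])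
  show "(\<lambda>t. g (a * t + b)) \<in> {\<lambda>t. c * f (a * t + b) | c f. smooth f}"
    using assms by (auto intro!: exI[of _ 1] exI[of _ g])
next
  fix h assume "h \<in> {\<lambda>t. c * f (a * t + b) | c f. smooth f}"
  then obtain c f where h: "h = (\<lambda>t. c * f (a * t + b))" "smooth f" by auto
  have "(h has_real_derivative (c * a) * deriv f (a * x + b)) (at x)" for x
  proof -
    have "((\<lambda>t. f (a * t + b)) has_real_derivative deriv f (a * x + b) * a) (at x)"
      by (rule DERIV_chain2[OF smooth_DERIV[OF h(2)]]) (auto intro!: derivative_eq_intros)
    then show ?thesis unfolding h by (auto intro!: derivative_eq_intros)
  qed
  then show "\<exists>g'\<in>{\<lambda>t. c * f (a * t + b) | c f. smooth f}. \<forall>x. (h has_real_derivative g' x) (at x)"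
    using smooth_deriv[OF h(2)]
    by (intro bexI[of _ "\<lambda>t. (c * a) * deriv f (a * t + b)"] CollectI exI conjI refl) auto
qed

lemma smooth_trig: "smooth (\<lambda>t. A * sin (c * t) + B * cos (c * t))"
proof (rule smooth_coinduct[where S="{\<lambda>t. A * sin (c * t) + B * cos (c * t) | A B. True}"])
  fix h assume "h \<in> {\<lambda>t. A * sin (c * t) + B * cos (c * t) | A B. True}"
  then obtain A B where h: "h = (\<lambda>t. A * sin (c * t) + B * cos (c * t))" by auto
  have "(h has_real_derivative (- B * c) * sin (c * x) + (A * c) * cos (c * x)) (at x)" for x
    unfolding h by (auto intro!: derivative_eq_intros simp: algebra_simps)
  then show "\<exists>g'\<in>{\<lambda>t. A * sin (c * t) + B * cos (c * t) | A B. True}. \<forall>x. (h has_real_derivative g' x) (at x)"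
    by (intro bexI[of _ "\<lambda>t. (- B * c) * sin (c * t) + (A * c) * cos (c * t)"] CollectI
        exI[of _ "- B * c"] exI[of _ "A * c"] conjI refl) auto
qed auto

lemma smooth_sin: "smooth (\<lambda>t. sin (c * t))" and smooth_cos: "smooth (\<lambda>t. cos (c * t))"
  using smooth_trig[of 1 c 0] smooth_trig[of 0 c 1] by simp_all

section \<open>A smooth function that is flat at the origin\<close>

definition flat_exp :: "real \<Rightarrow> real" where
  "flat_exp u = (if u > 0 then exp (- (1 / u)) else 0)"

text \<open>With y = 1/u this is a polynomial over an exponential at infinity. The extra division by
  u comes from the difference quotient at 0 and is the factor y in \<open>pCons 0 p\<close>.\<close>

lemma flat_exp_limit:
  "((\<lambda>u. poly p (1 / u) * exp (- (1 / u)) / u) \<longlongrightarrow> 0) (at_right (0::real))"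
proof -
  have "((\<lambda>y. poly (pCons 0 p) y / exp y) \<longlongrightarrow> 0) at_top"
  proof -
    have *: "((\<lambda>y. poly q y / exp y) \<longlongrightarrow> (0::real)) at_top" for q
    proof -
      have "((\<lambda>y. \<Sum>i\<le>degree q. coeff q i * (y ^ i / exp y)) \<longlongrightarrow> (\<Sum>i\<le>degree q. coeff q i * 0)) at_top"
        by (intro tendsto_sum tendsto_mult tendsto_const tendsto_power_div_exp_0)
      then show ?thesis by (simp add: poly_altdef sum_divide_distrib)
    qed
    show ?thesis by (rule *)
  qed
  then have "((\<lambda>u. poly (pCons 0 p) (inverse u) / exp (inverse u)) \<longlongrightarrow> 0) (at_right (0::real))"
    by (rule filterlim_compose[OF _ filterlim_inverse_at_top_right])
  then show ?thesis
    by (rule Lim_transform_eventually)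
       (intro always_eventually allI, simp add: exp_minus divide_inverse mult_ac)
qed

lemma smooth_flat_exp: "smooth flat_exp"
proof (rule smooth_coinduct[where S="{\<lambda>u. if u > 0 then poly p (1 / u) * exp (- (1 / u)) else 0 | p. True}"])
  show "flat_exp \<in> {\<lambda>u. if u > 0 then poly p (1 / u) * exp (- (1 / u)) else 0 | p. True}"
    by (auto intro!: exI[of _ "1"] simp: flat_exp_def fun_eq_iff)
next
  fix h :: "real \<Rightarrow> real"
  assume "h \<in> {\<lambda>u. if u > 0 then poly p (1 / u) * exp (- (1 / u)) else 0 | p. True}"
  then obtain p where h: "h = (\<lambda>u. if u > 0 then poly p (1 / u) * exp (- (1 / u)) else 0)" by auto
  \<comment> \<open>For y = 1/u one has dy/du = - y^2, so differentiation sends p(y) exp(- y) to y^2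
    (p - p')(y) exp(- y).\<close>
  define q where "q = monom 1 2 * (p - pderiv p)"
  have "(h has_real_derivative (if x > 0 then poly q (1 / x) * exp (- (1 / x)) else 0)) (at x)" for x
  proof -
    consider "x > 0" | "x < 0" | "x = 0" by linarith
    then show ?thesis
    proof cases
      case 1
      have 0: "((\<lambda>u. 1 / u) has_real_derivative - (1 / x\<^sup>2)) (at x)"
        using 1 by (auto intro!: derivative_eq_intros simp: power2_eq_square)
      have "((\<lambda>u. poly p (1 / u)) has_real_derivative poly (pderiv p) (1 / x) * (- (1 / x\<^sup>2))) (at x)"
        by (rule DERIV_chain2[OF poly_DERIV 0])
      moreover have "((\<lambda>u. exp (- (1 / u))) has_real_derivative exp (- (1 / x)) * (1 / x\<^sup>2)) (at x)"
        using DERIV_chain2[OF DERIV_exp DERIV_minus[OF 0]] by simp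
      ultimately have "((\<lambda>u. poly p (1 / u) * exp (- (1 / u))) has_real_derivative
          poly (pderiv p) (1 / x) * (- (1 / x\<^sup>2)) * exp (- (1 / x)) + exp (- (1 / x)) * (1 / x\<^sup>2) * poly p (1 / x)) (at x)"
        by (rule DERIV_mult)
      moreover have "poly (pderiv p) (1 / x) * (- (1 / x\<^sup>2)) * exp (- (1 / x)) + exp (- (1 / x)) * (1 / x\<^sup>2) * poly p (1 / x)
          = poly q (1 / x) * exp (- (1 / x))"
        by (simp add: q_def poly_monom algebra_simps power_one_over)
      ultimately have "((\<lambda>u. poly p (1 / u) * exp (- (1 / u))) has_real_derivative poly q (1 / x) * exp (- (1 / x))) (at x)"
        by simp
      then have "(h has_real_derivative poly q (1 / x) * exp (- (1 / x))) (at x)"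
        by (rule has_field_derivative_transform_within_open[where S="{0<..}"]) (use 1 in \<open>auto simp: h\<close>)
      then show ?thesis using 1 by simp
    next
      case 2
      have "((\<lambda>u. 0) has_real_derivative 0) (at x)" by simp
      then have "(h has_real_derivative 0) (at x)"
        by (rule has_field_derivative_transform_within_open[where S="{..<0}"]) (use 2 in \<open>auto simp: h\<close>)
      then show ?thesis using 2 by simp
    next
      case 3
      have "((\<lambda>y. h y / y) \<longlongrightarrow> 0) (at_right 0)"
        by (rule Lim_transform_eventually[OF flat_exp_limit[of p]])
           (auto simp: h eventually_at_filter)
      moreover have "((\<lambda>y. h y / y) \<longlongrightarrow> 0) (at_left 0)"
        by (rule Lim_transform_eventually[OF tendsto_const]) (auto simp: h eventually_at_filter)
      ultimately have "((\<lambda>y. h y / y) \<longlongrightarrow> 0) (at 0)"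
        by (rule filterlim_split_at[rotated])
      then show ?thesis using 3 by (simp add: has_field_derivative_iff h)
    qed
  qed
  then show "\<exists>g'\<in>{\<lambda>u. if u > 0 then poly p (1 / u) * exp (- (1 / u)) else 0 | p. True}.
      \<forall>x. (h has_real_derivative g' x) (at x)"
    by (intro bexI[of _ "\<lambda>x. if x > 0 then poly q (1 / x) * exp (- (1 / x)) else 0"]) auto
qed

lemma deriv_flat_exp:
  "deriv flat_exp u = (if u > 0 then exp (- (1 / u)) / u\<^sup>2 else 0)"
proof (cases "u > 0")
  case True
  have "((\<lambda>u. exp (- (1 / u))) has_real_derivative exp (- (1 / u)) / u\<^sup>2) (at u)"
    using True by (auto intro!: derivative_eq_intros simp: power2_eq_square)
  then have "(flat_exp has_real_derivative exp (- (1 / u)) / u\<^sup>2) (at u)"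
    by (rule has_field_derivative_transform_within_open[where S="{0<..}"]) (use True in \<open>auto simp: flat_exp_def\<close>)
  then show ?thesis using True by (simp add: DERIV_imp_deriv)
next
  case False
  \<comment> \<open>Every u <= 0 is a minimum of \<open>flat_exp\<close>, so the junction point 0
    needs no separate limit.\<close>
  have "deriv flat_exp u = 0"
    using smooth_DERIV[OF smooth_flat_exp, of u]
    by (rule DERIV_local_min[where d=1]) (use False in \<open>auto simp: flat_exp_def\<close>)
  then show ?thesis using False by simp
qed

lemma flat_exp_bounds: "0 \<le> flat_exp u" "flat_exp u \<le> 1"
  by (auto simp: flat_exp_def)

text \<open>The third bound is invariant under scaling. It keeps the product of a function vanishing
  at an endpoint with the derivative of a cut-off of width 1/n bounded uniformly in n.\<close>

lemma flat_exp_deriv_bounds: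
  "0 \<le> deriv flat_exp u" "deriv flat_exp u \<le> 2" "\<bar>u * deriv flat_exp u\<bar> \<le> 1"
proof -
  have *: "exp (- (1/u)) / u\<^sup>2 \<le> 2 \<and> u * (exp (- (1/u)) / u\<^sup>2) \<le> 1" if u: "u > 0" for u::real
  proof -
    define v where "v = 1 / u"
    have v: "v > 0" "u = 1 / v" using u by (auto simp: v_def)
    have t: "1 + v + v\<^sup>2 / 2 \<le> exp v"
      using exp_lower_Taylor_quadratic[of v] v by simp
    have "0 \<le> v\<^sup>2" by simp
    with t v have e: "v\<^sup>2 \<le> 2 * exp v" "v \<le> exp v" by linarith+
    have "exp (- (1/u)) / u\<^sup>2 = v\<^sup>2 / exp v" "u * (exp (- (1/u)) / u\<^sup>2) = v / exp v" 
      using v(1) by (simp_all add: v(2) exp_minus field_simps power2_eq_square)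
    then show ?thesis using e by (simp add: divide_le_eq)
  qed
  show "0 \<le> deriv flat_exp u" "deriv flat_exp u \<le> 2" "\<bar>u * deriv flat_exp u\<bar> \<le> 1"
    using *[of u] by (auto simp: deriv_flat_exp abs_mult)
qed

section \<open>The space of square-integrable functions on the cube\<close>

lemma vec_Basis_prod:
  fixes f :: "'n::finite \<Rightarrow> 'a::comm_monoid_mult"
  shows "(\<Prod>b\<in>(Basis::(real^'n) set). f (axis_index b)) = (\<Prod>i\<in>UNIV. f i)"
proof (rule prod.reindex_bij_witness[where i="\<lambda>i. axis i 1" and j=axis_index])
  fix b :: "real^'n" assume b: "b \<in> Basis"
  show "axis (axis_index b) 1 = b" by (rule axis_index[OF b, symmetric])
next
  fix i :: 'n
  show "axis_index (axis i 1 :: real^'n) = i" by (rule axis_index_axis)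
  show "(axis i 1 :: real^'n) \<in> Basis" by (simp add: axis_in_Basis_iff)
qed (rule UNIV_I refl)+

lemma vec_inner_Basis: "b \<in> Basis \<Longrightarrow> (x::real^'n) \<bullet> b = x $ axis_index b"
  by (metis axis_index inner_axis inner_real_def mult.right_neutral)

text \<open>\<open>lborel\<close> on vectors is the image of the product measure indexed by
  \<open>Basis\<close>; transporting along that map makes Fubini for products available.\<close>

lemma
  fixes f :: "'n::finite \<Rightarrow> real \<Rightarrow> real"
  assumes "\<And>i. integrable lborel (f i)"
  shows integrable_lborel_vec_prod: "integrable lborel (\<lambda>x::real^'n. \<Prod>i\<in>UNIV. f i (x $ i))"
    and integral_lborel_vec_prod:
      "(LINT x|lborel. (\<Prod>i\<in>UNIV. f i ((x::real^'n) $ i))) = (\<Prod>i\<in>UNIV. LINT t|lborel. f i t)"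
proof -
  have [measurable]: "f i \<in> borel_measurable borel" for i
    using assms[of i] by (auto dest: borel_measurable_integrable)
  let ?g = "\<lambda>b::real^'n. f (axis_index b)"
  have eq: "(\<Prod>i\<in>UNIV. f i (x $ i)) = (\<Prod>b\<in>Basis. ?g b (x \<bullet> b))" for x :: "real^'n"
    by (subst vec_Basis_prod[symmetric]) (auto intro!: prod.cong simp: vec_inner_Basis)
  interpret product_sigma_finite "\<lambda>_. lborel :: real measure" ..
  have e2: "(\<Sum>c\<in>Basis. x c *\<^sub>R c) \<bullet> b = x b" if "b \<in> Basis" for x :: "(real^'n) \<Rightarrow> real" and b :: "real^'n"
    using that by simp
  have e3: "(\<Prod>b\<in>Basis. ?g b ((\<Sum>c\<in>Basis. x c *\<^sub>R c) \<bullet> b)) = (\<Prod>b\<in>Basis. ?g b (x b))" for x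
    by (auto intro!: prod.cong simp: e2)
  have m: "(\<lambda>f. \<Sum>b\<in>Basis. f b *\<^sub>R b) \<in> (\<Pi>\<^sub>M b\<in>(Basis::(real^'n) set). lborel) \<rightarrow>\<^sub>M borel"
    by measurable
  have m2: "(\<lambda>x::real^'n. \<Prod>b\<in>Basis. ?g b (x \<bullet> b)) \<in> borel_measurable borel"
    by measurable
  show "integrable lborel (\<lambda>x::real^'n. \<Prod>i\<in>UNIV. f i (x $ i))"
    unfolding eq
    by (subst lborel_eq, subst integrable_distr_eq[OF m m2], unfold e3)
       (intro product_integrable_prod assms finite_Basis)
  have "(LINT x|lborel. (\<Prod>i\<in>UNIV. f i ((x::real^'n) $ i))) =
     (LINT x|(\<Pi>\<^sub>M b\<in>(Basis::(real^'n) set). lborel). (\<Prod>b\<in>Basis. ?g b (x b)))"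
    unfolding eq by (subst lborel_eq, subst integral_distr[OF m m2], unfold e3) simp
  also have "\<dots> = (\<Prod>b\<in>(Basis::(real^'n) set). LINT t|lborel. ?g b t)"
    by (intro product_integral_prod assms finite_Basis)
  also have "\<dots> = (\<Prod>i\<in>UNIV. LINT t|lborel. f i t)" by (rule vec_Basis_prod)
  finally show "(LINT x|lborel. (\<Prod>i\<in>UNIV. f i ((x::real^'n) $ i))) = (\<Prod>i\<in>UNIV. LINT t|lborel. f i t)" .
qed

section \<open>The unit cube as a probability space, and its square-integrable functions\<close>

lemma unit_cube_iff: "x \<in> unit_cube \<longleftrightarrow> (\<forall>i. 0 \<le> x $ i \<and> x $ i \<le> 1)"
  by (auto simp: unit_cube_def mem_box_cart)

lemma interior_unit_cube_iff: "x \<in> interior unit_cube \<longleftrightarrow> (\<forall>i. 0 < x $ i \<and> x $ i < 1)"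
  by (auto simp: unit_cube_def interior_cbox mem_box_cart)

lemma indicator_unit_cube:
  "indicator unit_cube (x::real^'n::finite) = (\<Prod>i\<in>UNIV. indicator {0..1} (x $ i) :: real)"
  by (auto simp: indicator_def unit_cube_iff intro!: prod_zero)

lemma unit_cube_sets [simp, measurable]: "unit_cube \<in> sets lborel" "unit_cube \<in> sets lebesgue"
  by (auto simp: unit_cube_def)

lemma unit_cube_lmeasurable: "(unit_cube :: (real^'n) set) \<in> lmeasurable"
  by (simp add: unit_cube_def)

lemma measure_unit_cube: "measure lebesgue (unit_cube :: (real^'n) set) = 1"
  by (simp add: unit_cube_def content_cbox_if_cart interval_eq_empty_cart)

lemma compact_unit_cube: "compact (unit_cube :: (real^'n) set)"
  by (simp add: unit_cube_def compact_cbox)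

lemma prob_space_cube: "prob_space (cube_measure :: (real^'n) measure)"
proof
  have "emeasure lebesgue (unit_cube :: (real^'n) set) = ennreal (measure lebesgue (unit_cube :: (real^'n) set))"
    by (rule emeasure_eq_ennreal_measure) (use fmeasurableD2[OF unit_cube_lmeasurable] in auto)
  also have "\<dots> = 1" by (simp add: measure_unit_cube)
  finally have "emeasure lebesgue (unit_cube :: (real^'n) set) = 1" .
  moreover have "emeasure cube_measure (unit_cube :: (real^'n) set) = emeasure lebesgue (unit_cube :: (real^'n) set)"
    by (rule emeasure_restrict_space) auto
  ultimately show "emeasure cube_measure (space (cube_measure :: (real^'n) measure)) = 1"
    by (simp only: space_lebesgue_on)
qed

lemma integral_cube_measure: "(LINT x|cube_measure. f x) = (LINT x|lebesgue. indicator unit_cube x * (f x::real))"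
  by (subst integral_restrict_space) auto

lemma AE_cube_measure: "(AE x in cube_measure. P x) \<longleftrightarrow> (AE x in lebesgue. x \<in> unit_cube \<longrightarrow> P x)"
  by (subst AE_restrict_space_iff) auto

lemma continuous_cube_integrable: "continuous_on unit_cube (f :: real^'n \<Rightarrow> real) \<Longrightarrow> integrable cube_measure f"
  unfolding unit_cube_def by (rule continuous_imp_integrable)

lemma continuous_cube_measurable: "continuous_on unit_cube (f :: real^'n \<Rightarrow> real) \<Longrightarrow> f \<in> borel_measurable cube_measure"
  by (rule borel_measurable_integrable[OF continuous_cube_integrable])

lemma continuous_cube_L2: "continuous_on unit_cube f \<Longrightarrow> f \<in> L2_space"
  by (auto simp: L2_space_def intro!: continuous_cube_measurable continuous_cube_integrable continuous_intros)

lemma L2_measurable: "u \<in> L2_space \<Longrightarrow> u \<in> borel_measurable cube_measure"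
  by (simp add: L2_space_def)

lemma L2_square_integrable: "u \<in> L2_space \<Longrightarrow> integrable cube_measure (\<lambda>x. (u x)\<^sup>2)"
  by (simp add: L2_space_def)

lemma L2_mult_integrable:
  assumes "u \<in> L2_space" "v \<in> L2_space"
  shows "integrable cube_measure (\<lambda>x. u x * v x)"
proof (rule Bochner_Integration.integrable_bound)
  show "integrable cube_measure (\<lambda>x. (u x)\<^sup>2 + (v x)\<^sup>2)"
    using assms by (intro Bochner_Integration.integrable_add L2_square_integrable)
  show "(\<lambda>x. u x * v x) \<in> borel_measurable cube_measure"
    using assms by (intro borel_measurable_times L2_measurable)
  have "\<bar>a * b\<bar> \<le> a\<^sup>2 + b\<^sup>2" for a b :: real
  proof -
    have "2 * \<bar>a * b\<bar> \<le> a\<^sup>2 + b\<^sup>2" using sum_squares_bound[of "\<bar>a\<bar>" "\<bar>b\<bar>"] by (simp add: abs_mult)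
    then show ?thesis by (smt (verit))
  qed
  then show "AE x in cube_measure. norm (u x * v x) \<le> norm ((u x)\<^sup>2 + (v x)\<^sup>2)" by auto
qed

lemma L2_add: assumes "u \<in> L2_space" "v \<in> L2_space" shows "(\<lambda>x. u x + v x) \<in> L2_space"
proof -
  have "integrable cube_measure (\<lambda>x. (u x)\<^sup>2 + 2 * (u x * v x) + (v x)\<^sup>2)"
    using assms by (intro Bochner_Integration.integrable_add L2_square_integrable integrable_mult_right L2_mult_integrable)
  then show ?thesis using assms by (auto simp: L2_space_def power2_sum algebra_simps)
qed

lemma L2_cmult: "u \<in> L2_space \<Longrightarrow> (\<lambda>x. c * u x) \<in> L2_space"
  by (auto simp: L2_space_def power_mult_distrib)

lemma L2_diff: assumes "u \<in> L2_space" "v \<in> L2_space" shows "(\<lambda>x. u x - v x) \<in> L2_space"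
  using L2_add[OF assms(1) L2_cmult[OF assms(2), of "-1"]] by simp

lemma L2_sum: "(\<And>k. k \<in> K \<Longrightarrow> u k \<in> L2_space) \<Longrightarrow> (\<lambda>x. \<Sum>k\<in>K. u k x) \<in> L2_space"
proof (induction K rule: infinite_finite_induct)
  case (insert k K)
  then show ?case by (simp add: L2_add)
qed (auto simp: L2_space_def)

lemma L2_integrable: assumes "u \<in> L2_space" shows "integrable cube_measure u"
proof -
  have "(\<lambda>_. 1) \<in> L2_space" by (rule continuous_cube_L2) simp
  from L2_mult_integrable[OF assms this] show ?thesis by simp
qed

lemma L2_inner_commute: "L2_inner u v = L2_inner v u"
  by (simp add: L2_inner_def mult.commute)

lemma L2_inner_add_left:
  "u \<in> L2_space \<Longrightarrow> v \<in> L2_space \<Longrightarrow> z \<in> L2_space \<Longrightarrow> L2_inner (\<lambda>x. u x + v x) z = L2_inner u z + L2_inner v z"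
  by (simp add: L2_inner_def distrib_right L2_mult_integrable)

lemma L2_inner_diff_left:
  "u \<in> L2_space \<Longrightarrow> v \<in> L2_space \<Longrightarrow> z \<in> L2_space \<Longrightarrow> L2_inner (\<lambda>x. u x - v x) z = L2_inner u z - L2_inner v z"
  by (simp add: L2_inner_def left_diff_distrib L2_mult_integrable)

lemma L2_inner_diff_right:
  "u \<in> L2_space \<Longrightarrow> v \<in> L2_space \<Longrightarrow> z \<in> L2_space \<Longrightarrow> L2_inner z (\<lambda>x. u x - v x) = L2_inner z u - L2_inner z v"
  by (simp add: L2_inner_def right_diff_distrib L2_mult_integrable)

lemma L2_inner_cmult_left: "L2_inner (\<lambda>x. c * u x) v = c * L2_inner u v"
  by (simp add: L2_inner_def mult.assoc)

lemma L2_inner_cmult_right: "L2_inner u (\<lambda>x. c * v x) = c * L2_inner u v"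
  by (simp add: L2_inner_def mult.left_commute)

lemma L2_inner_sum_left:
  assumes "\<And>k. k \<in> K \<Longrightarrow> u k \<in> L2_space" "z \<in> L2_space"
  shows "L2_inner (\<lambda>x. \<Sum>k\<in>K. u k x) z = (\<Sum>k\<in>K. L2_inner (u k) z)"
  unfolding L2_inner_def sum_distrib_right
  by (rule Bochner_Integration.integral_sum) (use assms in \<open>auto intro: L2_mult_integrable\<close>)

lemma L2_inner_self_nonneg: "0 \<le> L2_inner u u"
  by (auto simp: L2_inner_def intro!: integral_nonneg_AE)

lemma L2_inner_AE_cong:
  "AE x in cube_measure. u x = u' x \<Longrightarrow> u \<in> borel_measurable cube_measure \<Longrightarrow> u' \<in> borel_measurable cube_measure \<Longrightarrow>
   v \<in> borel_measurable cube_measure \<Longrightarrow> L2_inner u v = L2_inner u' v"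
  unfolding L2_inner_def by (intro integral_cong_AE borel_measurable_times) auto

text \<open>The modes and the test functions used below all have this form, so that integrals and
  derivatives on the cube reduce to one variable.\<close>

definition tensor :: "('n::finite \<Rightarrow> real \<Rightarrow> real) \<Rightarrow> real^'n \<Rightarrow> real" where
  "tensor g x = (\<Prod>i\<in>UNIV. g i (x $ i))"

lemma tensor_upd: "tensor (g(i := h)) x = h (x $ i) * (\<Prod>j\<in>UNIV - {i}. g j (x $ j))"
  unfolding tensor_def by (subst prod.remove[of _ i]) (auto intro!: prod.cong)

lemma tensor_remove: "tensor g x = g i (x $ i) * (\<Prod>j\<in>UNIV - {i}. g j (x $ j))"
  unfolding tensor_def by (subst prod.remove[of _ i]) auto

lemma continuous_tensor:
  assumes "\<And>i. continuous_on UNIV (g i)" shows "continuous_on S (tensor g)"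
proof -
  have "continuous_on S (\<lambda>x. g i (x $ i))" for i
    by (rule continuous_on_compose2[OF assms]) (auto intro: continuous_intros)
  then have "continuous_on S (\<lambda>x. \<Prod>i\<in>UNIV. g i (x $ i))" by (intro continuous_on_prod) auto
  then show ?thesis by (simp add: tensor_def[abs_def])
qed

lemma tensor_L2: "(\<And>i. continuous_on UNIV (g i)) \<Longrightarrow> tensor g \<in> L2_space"
  by (intro continuous_cube_L2 continuous_tensor)

lemma has_derivative_tensor:
  assumes "\<And>i. smooth (g i)"
  shows "(tensor g has_derivative (\<lambda>h. \<Sum>i\<in>UNIV. h $ i * tensor (g(i := deriv (g i))) x)) (at (x::real^'n::finite))"
proof -
  have "((\<lambda>x::real^'n. g i (x $ i)) has_derivative (\<lambda>h. h $ i * deriv (g i) (x $ i))) (at x)" for i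
  proof -
    have "(g i has_derivative (\<lambda>t. t * deriv (g i) (x $ i))) (at (x $ i))"
      using smooth_DERIV[OF assms] by (simp add: has_field_derivative_def mult.commute[of _ "deriv _ _"])
    moreover have "((\<lambda>x::real^'n. x $ i) has_derivative (\<lambda>h. h $ i)) (at x)"
      by (rule bounded_linear_imp_has_derivative) (rule bounded_linear_vec_nth)
    ultimately show ?thesis by (rule has_derivative_compose[rotated])
  qed
  then have "((\<lambda>x. \<Prod>i\<in>UNIV. g i (x $ i)) has_derivative
     (\<lambda>h. \<Sum>i\<in>UNIV. (h $ i * deriv (g i) (x $ i)) * (\<Prod>j\<in>UNIV - {i}. g j (x $ j)))) (at x)"
    by (intro has_derivative_prod) auto
  moreover have "tensor g = (\<lambda>x. \<Prod>i\<in>UNIV. g i (x $ i))" by (simp add: tensor_def fun_eq_iff)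
  ultimately show ?thesis by (simp add: tensor_upd mult.assoc)
qed

lemma partial_deriv_tensor:
  fixes g :: "'n::finite \<Rightarrow> real \<Rightarrow> real"
  assumes "\<And>i. smooth (g i)"
  shows "partial_deriv i (tensor g) = tensor (g(i := deriv (g i)))"
proof
  fix x :: "real^'n"
  have "frechet_derivative (tensor g) (at x) = (\<lambda>h. \<Sum>i\<in>UNIV. h $ i * tensor (g(i := deriv (g i))) x)"
    by (rule frechet_derivative_at[symmetric, OF has_derivative_tensor[OF assms]])
  then show "partial_deriv i (tensor g) x = tensor (g(i := deriv (g i))) x"
    by (simp add: partial_deriv_def axis_def if_distrib if_distribR cong: if_cong)
qed

text \<open>A partial derivative of a tensor is again a tensor, and the recursion of
  \<open>smooth_k\<close> copies that of \<open>C_k\<close>, so a single induction serves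
  both.\<close>

lemma C_k_tensor: "(\<And>i. smooth (g i)) \<Longrightarrow> C_k k (tensor g)"
proof (induction k arbitrary: g)
  case 0
  then show ?case by (auto intro!: continuous_tensor smooth_continuous)
next
  case (Suc k)
  have "tensor g differentiable (at x)" for x
    using has_derivative_tensor[of g x] Suc.prems unfolding differentiable_def by blast
  moreover have "C_k k (partial_deriv i (tensor g))" for i
    unfolding partial_deriv_tensor[OF Suc.prems]
    by (rule Suc.IH) (use Suc.prems in \<open>auto intro: smooth_deriv\<close>)
  ultimately show ?case by simp
qed

lemma integral_cube_tensor:
  fixes g :: "'n::finite \<Rightarrow> real \<Rightarrow> real"
  assumes "\<And>i. continuous_on UNIV (g i)"
  shows "(LINT x|cube_measure. tensor g x) = (\<Prod>i\<in>UNIV. integral {0..1} (g i))"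
proof -
  have si: "set_integrable lborel {0..1} (g i)" for i
    using assms[of i] by (intro borel_integrable_atLeastAtMost') (auto intro: continuous_on_subset)
  have i: "integrable lborel (\<lambda>t. indicator {0..1} t * g i t)" for i
    using si[of i] by (simp add: set_integrable_def)
  have v: "(LINT t|lborel. indicator {0..1} t * g i t) = integral {0..1} (g i)" for i
    using set_borel_integral_eq_integral(2)[OF si[of i]] by (simp add: set_lebesgue_integral_def)
  have e: "indicator unit_cube x * tensor g x = (\<Prod>i\<in>UNIV. indicator {0..1} (x $ i) * g i (x $ i))" for x :: "real^'n"
    by (simp add: indicator_unit_cube tensor_def prod.distrib)
  have "(LINT x|cube_measure. tensor g x) = (LINT x|lebesgue. (\<Prod>i\<in>UNIV. indicator {0..1} (x $ i) * g i (x $ i)))"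
    by (simp add: integral_cube_measure e)
  also have "\<dots> = (LINT x|lborel. (\<Prod>i\<in>UNIV. indicator {0..1} (x $ i) * g i (x $ i)))"
    by (rule integral_completion) (rule borel_measurable_integrable[OF integrable_lborel_vec_prod[OF i]])
  also have "\<dots> = (\<Prod>i\<in>UNIV. integral {0..1} (g i))"
    by (subst integral_lborel_vec_prod[OF i]) (simp add: v)
  finally show ?thesis .
qed

lemma tensor_mult: "tensor g x * tensor h x = tensor (\<lambda>i t. g i t * h i t) x"
  by (simp add: tensor_def prod.distrib)

lemma L2_inner_tensor:
  assumes "\<And>i. continuous_on UNIV (g i)" "\<And>i. continuous_on UNIV (h i)"
  shows "L2_inner (tensor g) (tensor h) = (\<Prod>i\<in>UNIV. integral {0..1} (\<lambda>t. g i t * h i t))"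
  unfolding L2_inner_def tensor_mult
  by (intro integral_cube_tensor continuous_on_mult assms)

section \<open>Density of subspaces\<close>

definition L2_dist2 :: "(real^'n \<Rightarrow> real) \<Rightarrow> (real^'n \<Rightarrow> real) \<Rightarrow> real" where
  "L2_dist2 u v = (LINT x|cube_measure. (u x - v x)\<^sup>2)"

definition L2_closure :: "(real^'n \<Rightarrow> real) set \<Rightarrow> (real^'n \<Rightarrow> real) set" where
  "L2_closure V = {u \<in> L2_space. \<forall>\<delta>>0. \<exists>v\<in>V. v \<in> L2_space \<and> L2_dist2 u v < \<delta>}"

lemma L2_dist2_inner: "L2_dist2 u v = L2_inner (\<lambda>x. u x - v x) (\<lambda>x. u x - v x)"
  by (simp add: L2_dist2_def L2_inner_def power2_eq_square)

lemma L2_dist2_triangle: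
  assumes "u \<in> L2_space" "v \<in> L2_space" "w \<in> L2_space" 
  shows "L2_dist2 u w \<le> 2 * L2_dist2 u v + 2 * L2_dist2 v w"
proof -
  have i: "integrable cube_measure (\<lambda>x. (f x - g x)\<^sup>2)" if "f \<in> L2_space" "g \<in> L2_space" for f g :: "real^'a \<Rightarrow> real"
    using L2_square_integrable[OF L2_diff[OF that]] .
  have "(a - c)\<^sup>2 \<le> 2 * (a - b)\<^sup>2 + 2 * (b - c)\<^sup>2" for a b c :: real
    using zero_le_power2[of "(a - b) - (b - c)"] by (simp add: power2_eq_square algebra_simps)
  then have "L2_dist2 u w \<le> (LINT x|cube_measure. 2 * (u x - v x)\<^sup>2 + 2 * (v x - w x)\<^sup>2)"
    unfolding L2_dist2_def using assms
    by (intro integral_mono Bochner_Integration.integrable_add integrable_mult_right i)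
  also have "\<dots> = 2 * L2_dist2 u v + 2 * L2_dist2 v w"
    unfolding L2_dist2_def using i[OF assms(1,2)] i[OF assms(2,3)] by simp
  finally show ?thesis .
qed

lemma L2_closure_closed:
  assumes u: "u \<in> L2_space" and "\<And>\<delta>. \<delta> > 0 \<Longrightarrow> \<exists>v\<in>L2_closure V. L2_dist2 u v < \<delta>"
  shows "u \<in> L2_closure V"
proof -
  have "\<exists>v\<in>V. v \<in> L2_space \<and> L2_dist2 u v < \<delta>" if "\<delta> > 0" for \<delta>
  proof -
    have p: "\<delta> / 4 > 0" using that by simp
    obtain v where v: "v \<in> L2_closure V" "L2_dist2 u v < \<delta> / 4" using assms(2)[OF p] by blast
    then obtain w where w: "w \<in> V" "w \<in> L2_space" "L2_dist2 v w < \<delta> / 4"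
      using p unfolding L2_closure_def by blast
    have "v \<in> L2_space" using v by (simp add: L2_closure_def)
    from L2_dist2_triangle[OF u this w(2)] v w show ?thesis by (intro bexI[of _ w]) auto
  qed
  then show ?thesis using u by (simp add: L2_closure_def)
qed

text \<open>The only limit passage into a closure: it is applied to bumps approaching boxes, to
  disjoint unions, to monotone limits, and, with a constant sequence, to changes on null
  sets.\<close>

lemma L2_closure_dominated:
  fixes u :: "real^'n \<Rightarrow> real"
  assumes U: "\<And>n. U n \<in> L2_closure V" and u: "u \<in> borel_measurable cube_measure" and g: "g \<in> L2_space"
    and bd: "\<And>n x. \<bar>U n x\<bar> \<le> g x" and lim: "AE x in cube_measure. (\<lambda>n. U n x) \<longlonglongrightarrow> u x"
  shows "u \<in> L2_closure V"
proof (rule L2_closure_closed)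
  have UL: "U n \<in> L2_space" for n using U by (simp add: L2_closure_def)
  have ub: "AE x in cube_measure. \<bar>u x\<bar> \<le> g x"
    using lim
  proof eventually_elim
    case (elim x)
    show ?case by (rule LIMSEQ_le_const2[OF tendsto_rabs[OF elim]]) (use bd in auto)
  qed
  show uL: "u \<in> L2_space"
  proof -
    have "integrable cube_measure (\<lambda>x. (u x)\<^sup>2)"
    proof (rule Bochner_Integration.integrable_bound[OF L2_square_integrable[OF g]])
      show "AE x in cube_measure. norm ((u x)\<^sup>2) \<le> norm ((g x)\<^sup>2)"
        using ub by eventually_elim (simp add: abs_le_square_iff[symmetric])
    qed (use u in measurable)
    then show ?thesis using u by (simp add: L2_space_def)
  qed
  have "(\<lambda>n. LINT x|cube_measure. (u x - U n x)\<^sup>2) \<longlonglongrightarrow> (LINT x|(cube_measure :: (real^'n) measure). 0)"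
  proof (rule integral_dominated_convergence)
    show "integrable cube_measure (\<lambda>x. 4 * (g x)\<^sup>2)"
      using L2_square_integrable[OF g] by simp
    show "(\<lambda>x. (u x - U n x)\<^sup>2) \<in> borel_measurable cube_measure" for n
      using u L2_measurable[OF UL[of n]] by measurable
    show "AE x in cube_measure. (\<lambda>n. (u x - U n x)\<^sup>2) \<longlonglongrightarrow> 0"
      using lim
    proof eventually_elim
      case (elim x)
      have "(\<lambda>n. (u x - U n x)\<^sup>2) \<longlonglongrightarrow> (u x - u x)\<^sup>2" by (intro tendsto_intros elim)
      then show ?case by simp
    qed
    show "AE x in cube_measure. norm ((u x - U n x)\<^sup>2) \<le> 4 * (g x)\<^sup>2" for n
      using ub
    proof eventually_elim
      case (elim x)
      have "\<bar>u x - U n x\<bar> \<le> \<bar>2 * g x\<bar>" using elim bd[of n x] by linarith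
      then show ?case by (simp add: abs_le_square_iff power_mult_distrib)
    qed
  qed simp
  then have "(\<lambda>n. L2_dist2 u (U n)) \<longlonglongrightarrow> 0" by (simp add: L2_dist2_def)
  then show "\<exists>v\<in>L2_closure V. L2_dist2 u v < \<delta>" if "\<delta> > 0" for \<delta>
    using order_tendstoD(2)[of _ 0 sequentially \<delta>] that U eventually_happens'[OF sequentially_bot] by blast
qed

text \<open>Density is reduced to indicators of boxes. There are two instances: the functions
  orthogonal to a given one, for uniqueness of weak derivatives, and the span of the cosine
  modes.\<close>

locale L2_subspace =
  fixes V :: "(real^'n::finite \<Rightarrow> real) set"
  assumes V_add: "\<And>u v. u \<in> V \<Longrightarrow> v \<in> V \<Longrightarrow> (\<lambda>x. u x + v x) \<in> V"
    and V_cmult: "\<And>u c. u \<in> V \<Longrightarrow> (\<lambda>x. c * u x) \<in> V"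
    and V_box: "\<And>a b. indicator (box a b) \<in> L2_closure V"
begin

lemma closure_add:
  assumes "u \<in> L2_closure V" "v \<in> L2_closure V" shows "(\<lambda>x. u x + v x) \<in> L2_closure V"
proof -
  have L: "u \<in> L2_space" "v \<in> L2_space" using assms by (auto simp: L2_closure_def)
  have "\<exists>w\<in>V. w \<in> L2_space \<and> L2_dist2 (\<lambda>x. u x + v x) w < \<delta>" if "\<delta> > 0" for \<delta>
  proof -
    have p: "\<delta> / 4 > 0" using that by simp
    obtain u' v' where w: "u' \<in> V" "u' \<in> L2_space" "L2_dist2 u u' < \<delta>/4" "v' \<in> V" "v' \<in> L2_space" "L2_dist2 v v' < \<delta>/4"
      using assms p unfolding L2_closure_def by blast
    have "L2_dist2 (\<lambda>x. u x + v x) (\<lambda>x. u' x + v x) = L2_dist2 u u'"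
      "L2_dist2 (\<lambda>x. u' x + v x) (\<lambda>x. u' x + v' x) = L2_dist2 v v'"
      by (simp_all add: L2_dist2_def)
    with L2_dist2_triangle[OF L2_add[OF L] L2_add[OF w(2) L(2)] L2_add[OF w(2,5)]] w
    show ?thesis by (intro bexI[of _ "\<lambda>x. u' x + v' x"] conjI L2_add V_add) auto
  qed
  then show ?thesis using L by (simp add: L2_closure_def L2_add)
qed

lemma closure_cmult:
  assumes "u \<in> L2_closure V" shows "(\<lambda>x. c * u x) \<in> L2_closure V"
proof -
  have L: "u \<in> L2_space" using assms by (auto simp: L2_closure_def)
  have "\<exists>w\<in>V. w \<in> L2_space \<and> L2_dist2 (\<lambda>x. c * u x) w < \<delta>" if "\<delta> > 0" for \<delta>
  proof -
    have p: "\<delta> / (c\<^sup>2 + 1) > 0" using that by (simp add: add_nonneg_pos)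
    then obtain u' where w: "u' \<in> V" "u' \<in> L2_space" "L2_dist2 u u' < \<delta> / (c\<^sup>2 + 1)"
      using assms unfolding L2_closure_def by blast
    have "(c * a - c * b)\<^sup>2 = c\<^sup>2 * (a - b)\<^sup>2" for a b :: real
      by (simp add: power_mult_distrib right_diff_distrib[symmetric])
    then have "L2_dist2 (\<lambda>x. c * u x) (\<lambda>x. c * u' x) = c\<^sup>2 * L2_dist2 u u'"
      by (simp add: L2_dist2_def)
    also have "\<dots> \<le> (c\<^sup>2 + 1) * L2_dist2 u u'"
      by (intro mult_right_mono) (auto simp: L2_dist2_def)
    also have "\<dots> < \<delta>"
    proof -
      have "c\<^sup>2 + 1 > 0" by (simp add: add_nonneg_pos)
      then show ?thesis using w(3) by (simp add: pos_less_divide_eq mult.commute)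
    qed
    finally show ?thesis using w by (intro bexI[of _ "\<lambda>x. c * u' x"] conjI L2_cmult V_cmult) auto
  qed
  then show ?thesis using L by (simp add: L2_closure_def L2_cmult)
qed

lemma closure_zero: "(\<lambda>_. 0) \<in> L2_closure V"
proof -
  have "indicator (box 0 0 :: (real^'n) set) = (\<lambda>_. 0 :: real)" by (simp add: fun_eq_iff)
  then show ?thesis using V_box[of 0 0] by simp
qed

text \<open>Dynkin's argument: boxes are stable under intersection and generate the Borel sets, and
  the sets whose indicator lies in the closure are stable under complements and countable disjoint
  unions.\<close>

lemma closure_borel_set: 
  assumes "A \<in> sets borel" shows "indicator A \<in> L2_closure V"
proof -
  let ?E = "range (\<lambda>(a, b). box a b::(real^'n) set)"
  have G: "Int_stable ?E" by (auto simp: Int_stable_def box_Int_box)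
  have one: "(\<lambda>_. 1) \<in> L2_space" by (intro continuous_cube_L2 continuous_intros)
  have borelE: "B \<in> sigma_sets UNIV ?E \<Longrightarrow> B \<in> sets borel" for B
    by (simp add: borel_eq_box)
  have meas: "(indicator B :: _ \<Rightarrow> real) \<in> borel_measurable cube_measure" if "B \<in> sets borel" for B :: "(real^'n) set"
    using that by (intro measurable_restrict_space1 measurable_completion) simp
  have "A \<in> sigma_sets UNIV ?E" using assms by (simp add: borel_eq_box)
  have sub: "?E \<subseteq> Pow UNIV" by simp
  from G sub \<open>A \<in> sigma_sets UNIV ?E\<close> show ?thesis
  proof (induction rule: sigma_sets_induct_disjoint)
    case (basic A)
    then show ?case using V_box by auto
  next
    case empty
    have "indicator {} = (\<lambda>_::real^'n. 0 :: real)" by (simp add: fun_eq_iff)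
    then show ?case using closure_zero by simp
  next
    case (compl A)
    \<comment> \<open>The closure sees only the cube, and the box from -1 to 2 contains it.\<close>
    have u: "(indicator UNIV :: real^'n \<Rightarrow> real) \<in> L2_closure V"
    proof (rule L2_closure_dominated[where U="\<lambda>_. indicator (box (-1) 2)" and g="\<lambda>_. 1"])
      show "indicator (box (- 1) 2) \<in> L2_closure V" for n by (rule V_box)
      have "(x::real^'n) \<in> box (-1) 2" if "x \<in> unit_cube" for x
        using that unfolding unit_cube_iff mem_box_cart
        by (auto intro: less_le_trans[of "-1" 0] le_less_trans[of _ 1 2])
      then show "AE x in cube_measure. (\<lambda>n::nat. indicator (box (- 1) 2) x) \<longlonglongrightarrow> (indicator UNIV (x::real^'n) :: real)"
        by (intro AE_I2) auto
    qed (auto simp: indicator_def one)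
    have "(\<lambda>x. indicator UNIV x + (-1) * indicator A x :: real) \<in> L2_closure V"
      by (intro closure_add closure_cmult u compl)
    moreover have "(\<lambda>x. indicator UNIV x + (-1) * indicator A x :: real) = indicator (UNIV - A)"
      by (auto simp: indicator_def fun_eq_iff)
    ultimately show ?case by simp
  next
    case (union A)
    have fin: "(\<lambda>x. \<Sum>i<n. indicator (A i) x :: real) \<in> L2_closure V" for n
    proof (induction n)
      case 0
      show ?case using closure_zero by simp
    next
      case (Suc n)
      then show ?case using closure_add[OF Suc union(3)[of n]] by (simp add: add.commute)
    qed
    have e: "(\<Sum>i<n. indicator (A i) x :: real) = indicator (\<Union>i<n. A i) x" for n x
      using union(1) by (subst indicator_UN_disjoint) (auto simp: disjoint_family_on_def)
    show ?case
    proof (rule L2_closure_dominated[OF fin _ one])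
      show "\<bar>\<Sum>i<n. indicator (A i) x :: real\<bar> \<le> 1" for n x
        unfolding e by (simp add: indicator_def)
      show "(indicator (\<Union>i. A i) :: _ \<Rightarrow> real) \<in> borel_measurable cube_measure"
        using union(2) by (intro meas sets.countable_UN) (auto intro: borelE)
      show "AE x in cube_measure. (\<lambda>n. \<Sum>i<n. indicator (A i) x) \<longlonglongrightarrow> (indicator (\<Union>i. A i) x :: real)"
        unfolding e by (intro AE_I2 LIMSEQ_indicator_UN)
    qed
  qed
qed

text \<open>Nonnegative Borel functions come from indicators by the standard induction. A general
  element is replaced by a Borel representative, which is then split into positive and negative
  part.\<close>

lemma dense: "L2_space \<subseteq> L2_closure V"
proof
  have nonneg: "u \<in> L2_closure V" if "u \<in> L2_space" "\<And>x. 0 \<le> u x" "u \<in> borel_measurable borel" for u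
    using that(3,2,1)
  proof (induction rule: borel_measurable_induct_real)
    case (set A)
    then show ?case by (intro closure_borel_set)
  next
    case (mult u c)
    show ?case
    proof (cases "c = 0")
      case True
      then show ?thesis using closure_zero by simp
    next
      case False
      have "(\<lambda>x. (1 / c) * (c * u x)) \<in> L2_space" by (rule L2_cmult[OF mult(5)])
      then have "u \<in> L2_space" using False by simp
      then show ?thesis using mult by (intro closure_cmult) auto
    qed
  next
    case (add u v)
    have b: "w \<in> L2_space" if "w \<in> borel_measurable borel" "\<And>x. 0 \<le> w x" "\<And>x. w x \<le> v x + u x" for w :: "real^'n \<Rightarrow> real"
    proof -
      have [measurable]: "w \<in> borel_measurable cube_measure" using that(1) by (intro measurable_restrict_space1 measurable_completion) simp
      have "integrable cube_measure (\<lambda>x. (w x)\<^sup>2)"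
        by (rule Bochner_Integration.integrable_bound[OF L2_square_integrable[OF add(8)]])
          (use that in \<open>auto intro!: AE_I2 power_mono order_trans[OF _ abs_ge_self]\<close>)
      then show ?thesis by (simp add: L2_space_def)
    qed
    have "u \<in> L2_space" "v \<in> L2_space" by (rule b; use add in \<open>simp add: add_increasing add_increasing2\<close>)+
    then show ?case using add by (intro closure_add) auto
  next
    case (seq U)
    have Ule: "U n x \<le> u x" for n x
    proof (rule LIMSEQ_le_const)
      show "(\<lambda>m. U m x) \<longlonglongrightarrow> u x" using seq(4) by simp
      show "\<exists>N. \<forall>m\<ge>N. U n x \<le> U m x" using seq(3) by (auto simp: incseq_def le_fun_def)
    qed
    have UL: "U n \<in> L2_space" for n
    proof -
      have [measurable]: "U n \<in> borel_measurable cube_measure" using seq(1) by (intro measurable_restrict_space1 measurable_completion) simp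
      have "integrable cube_measure (\<lambda>x. (U n x)\<^sup>2)"
        by (rule Bochner_Integration.integrable_bound[OF L2_square_integrable[OF seq(6)]])
          (use Ule seq(2) in \<open>auto intro!: AE_I2 power_mono\<close>)
      then show ?thesis by (simp add: L2_space_def)
    qed
    show ?case
      by (rule L2_closure_dominated[where U=U and g=u]) (use seq UL Ule L2_measurable in auto)
  qed
  fix u :: "real^'n \<Rightarrow> real" assume u: "u \<in> L2_space"
  \<comment> \<open>Measurability of u is known on the cube only; cutting off there gives a function
    on the whole space that has a Borel version.\<close>
  define u1 where "u1 x = indicator unit_cube x * u x" for x
  have "(\<lambda>x. indicator unit_cube x *\<^sub>R u x) \<in> borel_measurable lebesgue"
    using L2_measurable[OF u] by (subst (asm) borel_measurable_restrict_space_iff) auto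
  then have "u1 \<in> borel_measurable lebesgue" by (simp add: u1_def[abs_def])
  then obtain v where v: "v \<in> borel_measurable lborel" and uv: "AE x in lborel. u1 x = v x"
    using completion_ex_borel_measurable_real by blast
  have [measurable]: "v \<in> borel_measurable borel" using v by simp
  have [measurable]: "v \<in> borel_measurable cube_measure" using v by (intro measurable_restrict_space1 measurable_completion)
  have ae: "AE x in cube_measure. v x = u x"
    using AE_completion[OF uv] by (auto simp: AE_cube_measure u1_def elim!: eventually_mono)
  have "integrable cube_measure (\<lambda>x. (v x)\<^sup>2)"
    using L2_square_integrable[OF u] ae L2_measurable[OF u]
    by (subst integrable_cong_AE[where g="\<lambda>x. (u x)\<^sup>2"]) auto
  then have vL: "v \<in> L2_space" by (simp add: L2_space_def)
  have parts: "(\<lambda>x. max 0 (s * v x)) \<in> L2_closure V" for s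
  proof (rule nonneg)
    have "integrable cube_measure (\<lambda>x. (max 0 (s * v x))\<^sup>2)"
    proof (rule Bochner_Integration.integrable_bound)
      show "integrable cube_measure (\<lambda>x. s\<^sup>2 * (v x)\<^sup>2)" using L2_square_integrable[OF vL] by simp
      show "AE x in cube_measure. norm ((max 0 (s * v x))\<^sup>2) \<le> norm (s\<^sup>2 * (v x)\<^sup>2)"
        by (auto simp: max_def power_mult_distrib)
    qed measurable
    then show "(\<lambda>x. max 0 (s * v x)) \<in> L2_space" by (simp add: L2_space_def)
  qed auto
  have "(\<lambda>x. max 0 (1 * v x) + (-1) * max 0 ((-1) * v x)) \<in> L2_closure V"
    by (intro closure_add closure_cmult parts)
  moreover have "(\<lambda>x. max 0 (1 * v x) + (-1) * max 0 ((-1) * v x)) = v" by (auto simp: max_def fun_eq_iff)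
  ultimately have vV: "v \<in> L2_closure V" by simp
  show "u \<in> L2_closure V"
  proof (rule L2_closure_dominated[where U="\<lambda>_. v" and g="\<lambda>x. \<bar>v x\<bar>"])
    show "u \<in> borel_measurable cube_measure" by (rule L2_measurable[OF u])
    show "(\<lambda>x. \<bar>v x\<bar>) \<in> L2_space" using vL by (simp add: L2_space_def)
    show "AE x in cube_measure. (\<lambda>n::nat. v x) \<longlonglongrightarrow> u x" using ae by eventually_elim simp
  qed (use vV in auto)
qed

end

section \<open>Test functions and weak derivatives\<close>

lemma test_functions_tensor:
  fixes g :: "'n::finite \<Rightarrow> real \<Rightarrow> real"
  assumes "\<And>i. smooth (g i)" "\<delta> > 0" "\<And>i t. t < \<delta> \<or> 1 - \<delta> < t \<Longrightarrow> g i t = 0"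
  shows "tensor g \<in> test_functions"
proof -
  let ?B = "cbox (\<chi> i. \<delta>) (\<chi> i. 1 - \<delta>) :: (real^'n) set"
  have "x \<in> ?B" if "tensor g x \<noteq> 0" for x
  proof -
    have "g i (x $ i) \<noteq> 0" for i using that by (auto simp: tensor_def)
    then show ?thesis using assms(3) by (force simp: mem_box_cart not_less[symmetric])
  qed
  then have sub: "closure {x. tensor g x \<noteq> 0} \<subseteq> ?B" by (intro closure_minimal) auto
  moreover have "?B \<subseteq> interior unit_cube"
    using \<open>\<delta> > 0\<close> unfolding interior_unit_cube_iff subset_eq
    by (auto simp: mem_box_cart intro: less_le_trans[OF \<open>\<delta> > 0\<close>] le_less_trans[of _ "1 - \<delta>"])
  moreover have "compact (closure {x. tensor g x \<noteq> 0})"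
    using sub by (meson bounded_cbox bounded_subset closed_closure compact_eq_bounded_closed)
  ultimately show ?thesis using C_k_tensor[OF assms(1)] by (auto simp: test_functions_def)
qed

text \<open>The difference quotients of P integrate to 0 by translation invariance, and by the mean
  value theorem their values are values of p, hence uniformly bounded; dominated convergence gives p
  itself. No iterated integral is involved.\<close>

lemma integral_directional_deriv_eq_0:
  fixes P p :: "real^'n::finite \<Rightarrow> real"
  assumes der: "\<And>x t. ((\<lambda>s. P (x + s *\<^sub>R axis i 1)) has_real_derivative p (x + t *\<^sub>R axis i 1)) (at t)"
    and cP: "continuous_on UNIV P" and cp: "continuous_on UNIV p"
    and P0: "\<And>x. x \<notin> unit_cube \<Longrightarrow> P x = 0" and p0: "\<And>x. x \<notin> unit_cube \<Longrightarrow> p x = 0"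
  shows "(LINT x|cube_measure. p x) = 0"
proof -
  define h where "h n = 1 / real (Suc n)" for n
  have h: "0 < h n" "h n \<le> 1" for n by (auto simp: h_def)
  define e :: "real^'n" where "e = axis i 1"
  have [measurable]: "P \<in> borel_measurable borel" "p \<in> borel_measurable borel"
    using cP cp by (auto intro: borel_measurable_continuous_onI)
  obtain B where B: "\<And>x. \<bar>p x\<bar> \<le> B" "B \<ge> 0"
  proof -
    have "bounded (p ` unit_cube)"
      by (intro compact_imp_bounded compact_continuous_image compact_unit_cube continuous_on_subset[OF cp]) auto
    then obtain B where "\<And>x. x \<in> unit_cube \<Longrightarrow> \<bar>p x\<bar> \<le> B" by (auto simp: bounded_iff)
    then have "\<bar>p x\<bar> \<le> max B 0" for x using p0[of x] by (cases "x \<in> unit_cube") force+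
    then show ?thesis by (intro that[of "max B 0"]) auto
  qed
  have intP: "integrable lborel P"
  proof -
    have "integrable lborel (\<lambda>x. indicator unit_cube x *\<^sub>R P x)"
      by (intro borel_integrable_compact compact_unit_cube continuous_on_subset[OF cP]) auto
    moreover have "(\<lambda>x. indicator unit_cube x *\<^sub>R P x) = P" using P0 by (auto simp: indicator_def fun_eq_iff)
    ultimately show ?thesis by simp
  qed
  define D where "D n x = (P (x + h n *\<^sub>R e) - P x) / h n" for n x
  have tr: "integrable lborel (\<lambda>x. P (x + c))" "(LINT x|lborel. P (x + c)) = (LINT x|lborel. P x)" for c
  proof -
    have "integrable (distr lborel borel ((+) c)) P" by (subst lborel_distr_plus) (rule intP)
    then show "integrable lborel (\<lambda>x. P (x + c))" by (subst (asm) integrable_distr_eq) (auto simp: add.commute)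
    have "(LINT x|lborel. P x) = (LINT x|distr lborel borel ((+) c). P x)" by (subst lborel_distr_plus) simp
    also have "\<dots> = (LINT x|lborel. P (c + x))" by (subst integral_distr) auto
    finally show "(LINT x|lborel. P (x + c)) = (LINT x|lborel. P x)" by (simp add: add.commute)
  qed
  have D0: "(LINT x|lborel. D n x) = 0" for n
    unfolding D_def using tr intP by simp
  have Dm: "\<exists>z. D n x = p z" for n x
  proof -
    have "\<exists>z. 0 < z \<and> z < h n \<and> P (x + h n *\<^sub>R e) - P (x + 0 *\<^sub>R e) = (h n - 0) * p (x + z *\<^sub>R e)"
      by (rule MVT2) (use h der in \<open>auto simp: e_def\<close>)
    then show ?thesis using h[of n] by (force simp: D_def)
  qed
  have lim: "(\<lambda>n. D n x) \<longlonglongrightarrow> p x" for x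
  proof -
    have "(\<lambda>k. (P (x + k *\<^sub>R e) - P x) / k) \<midarrow>0\<rightarrow> p x"
      using der[of x 0] unfolding DERIV_def by (simp add: e_def)
    moreover have "filterlim h (at 0) sequentially"
      unfolding h_def by (intro filterlim_atI) (use LIMSEQ_Suc[OF lim_1_over_n[where 'a=real]] in auto)
    ultimately show ?thesis unfolding D_def by (rule filterlim_compose)
  qed
  have "(\<lambda>n. LINT x|lborel. D n x) \<longlonglongrightarrow> (LINT x|lborel. p x)"
  proof (rule integral_dominated_convergence)
    \<comment> \<open>Since \<open>h n\<close> is at most 1, all difference quotients vanish outside
      this enlarged cube.\<close>
    have "integrable lborel (\<lambda>x. indicator (cbox (-1) 1 :: (real^'n) set) x *\<^sub>R B)"
      by (intro borel_integrable_compact) auto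
    then show "integrable lborel (\<lambda>x. B * indicator (cbox (-1) 1 :: (real^'n) set) x)"
      by (simp add: mult.commute)
    show "AE x in lborel. norm (D n x) \<le> B * indicator (cbox (-1) 1) x" for n
    proof (intro AE_I2)
      fix x :: "real^'n"
      show "norm (D n x) \<le> B * indicator (cbox (-1) 1) x"
      proof (cases "x \<in> cbox (-1) 1")
        case True
        then show ?thesis using Dm[of n x] B by auto
      next
        case False
        have "x \<notin> unit_cube" using False by (auto simp: unit_cube_iff mem_box_cart intro: order_trans[of "-1" 0])
        moreover have "x + h n *\<^sub>R e \<notin> unit_cube"
        proof
          assume a: "x + h n *\<^sub>R e \<in> unit_cube"
          have "- 1 \<le> x $ j \<and> x $ j \<le> 1" for j
          proof -
            have "0 \<le> x $ j + h n * e $ j" "x $ j + h n * e $ j \<le> 1" using a by (auto simp: unit_cube_iff)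
            moreover have "0 \<le> h n * e $ j" "h n * e $ j \<le> 1" using h[of n] by (auto simp: e_def axis_def)
            ultimately show ?thesis by linarith
          qed
          then show False using False by (simp add: mem_box_cart)
        qed
        ultimately show ?thesis using P0 False by (simp add: D_def)
      qed
    qed
    show "D n \<in> borel_measurable lborel" for n unfolding D_def[abs_def] by measurable
  qed (use lim in auto)
  then have "(LINT x|lborel. p x) = 0" using D0 by (simp add: LIMSEQ_const_iff)
  moreover have "(LINT x|cube_measure. p x) = (LINT x|lebesgue. p x)"
    unfolding integral_cube_measure using p0 by (intro Bochner_Integration.integral_cong) (auto simp: indicator_def)
  moreover have "(LINT x|lebesgue. p x) = (LINT x|lborel. p x)" by (rule integral_completion) measurable
  ultimately show ?thesis by simp
qed

lemma test_function_props:
  fixes \<phi> :: "real^'n::finite \<Rightarrow> real"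
  assumes "\<phi> \<in> test_functions"
  shows "\<phi> differentiable (at x)" "continuous_on S \<phi>" "continuous_on S (partial_deriv i \<phi>)"
    "x \<notin> unit_cube \<Longrightarrow> \<phi> x = 0" "x \<notin> unit_cube \<Longrightarrow> partial_deriv i \<phi> x = 0"
proof -
  have C: "C_k 0 \<phi>" "C_k (Suc 0) \<phi>" using assms by (auto simp: test_functions_def)
  then show "\<phi> differentiable (at x)" "continuous_on S \<phi>" "continuous_on S (partial_deriv i \<phi>)"
    by (auto intro: continuous_on_subset)
  have sub: "closure {x. \<phi> x \<noteq> 0} \<subseteq> unit_cube" using assms interior_subset by (auto simp: test_functions_def)
  show "\<phi> x = 0" if "x \<notin> unit_cube" using sub that closure_subset[of "{x. \<phi> x \<noteq> 0}"] by blast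
  show "partial_deriv i \<phi> x = 0" if x: "x \<notin> unit_cube"
  proof -
    have "((\<lambda>_. 0) has_derivative (\<lambda>_. 0)) (at x)" by simp
    then have "(\<phi> has_derivative (\<lambda>_. 0)) (at x)"
    proof (rule has_derivative_transform_within_open)
      show "open (- closure {x. \<phi> x \<noteq> 0})" by auto
      show "x \<in> - closure {x. \<phi> x \<noteq> 0}" using sub x by auto
      show "0 = \<phi> y" if "y \<in> - closure {x. \<phi> x \<noteq> 0}" for y
        using that closure_subset[of "{x. \<phi> x \<noteq> 0}"] by auto
    qed
    then show ?thesis by (simp add: partial_deriv_def frechet_derivative_at[symmetric])
  qed
qed

text \<open>The product of the test function with the tensor vanishes outside the cube, so its
  directional derivative integrates to 0; the product rule splits that integral into the two
  sides.\<close>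

lemma has_weak_deriv_tensor:
  fixes g :: "'n::finite \<Rightarrow> real \<Rightarrow> real"
  assumes g: "\<And>i. smooth (g i)"
  shows "has_weak_deriv i (tensor g) (tensor (g(i := deriv (g i))))"
  unfolding has_weak_deriv_def
proof
  fix \<phi> :: "real^'n \<Rightarrow> real" assume \<phi>: "\<phi> \<in> test_functions"
  note tp = test_function_props[OF \<phi>]
  let ?g' = "tensor (g(i := deriv (g i)))"
  have cg: "continuous_on S (tensor g)" "continuous_on S ?g'" for S
    using g by (auto intro!: continuous_tensor smooth_continuous smooth_deriv)
  have der: "((\<lambda>s. \<phi> (x + s *\<^sub>R axis i 1) * tensor g (x + s *\<^sub>R axis i 1)) has_real_derivative
     partial_deriv i \<phi> (x + t *\<^sub>R axis i 1) * tensor g (x + t *\<^sub>R axis i 1) + ?g' (x + t *\<^sub>R axis i 1) * \<phi> (x + t *\<^sub>R axis i 1)) (at t)" for x t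
  proof -
    have lin: "((\<lambda>s. x + s *\<^sub>R axis i 1) has_derivative (\<lambda>s. s *\<^sub>R axis i 1)) (at t)"
      by (auto intro!: derivative_eq_intros)
    have a: "((\<lambda>s. f (x + s *\<^sub>R axis i 1)) has_real_derivative partial_deriv i f (x + t *\<^sub>R axis i 1)) (at t)"
      if "f differentiable (at (x + t *\<^sub>R axis i 1))" for f :: "real^'n \<Rightarrow> real"
    proof -
      let ?D = "frechet_derivative f (at (x + t *\<^sub>R axis i 1))"
      have D: "(f has_derivative ?D) (at (x + t *\<^sub>R axis i 1))" using that frechet_derivative_works by blast
      have "((\<lambda>s. f (x + s *\<^sub>R axis i 1)) has_derivative (\<lambda>s. ?D (s *\<^sub>R axis i 1))) (at t)"
        by (rule has_derivative_compose[OF lin D])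
      moreover have "?D (s *\<^sub>R axis i 1) = partial_deriv i f (x + t *\<^sub>R axis i 1) * s" for s
        using linear_scale[OF has_derivative_linear[OF D]] by (simp add: partial_deriv_def)
      ultimately show ?thesis by (simp add: has_field_derivative_def)
    qed
    have "tensor g differentiable (at y)" for y
      using has_derivative_tensor[of g y] g unfolding differentiable_def by blast
    from DERIV_mult[OF a[OF tp(1)] a[OF this]]
    show ?thesis by (simp add: partial_deriv_tensor[OF g])
  qed
  have "(LINT x|cube_measure. partial_deriv i \<phi> x * tensor g x + ?g' x * \<phi> x) = 0"
    by (rule integral_directional_deriv_eq_0[OF der]) (auto intro!: continuous_on_add continuous_on_mult cg tp(2,3) simp: tp(4,5) simp del: fun_upd_apply)
  moreover have "(LINT x|cube_measure. partial_deriv i \<phi> x * tensor g x + ?g' x * \<phi> x)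
      = (LINT x|cube_measure. partial_deriv i \<phi> x * tensor g x) + (LINT x|cube_measure. ?g' x * \<phi> x)"
    by (intro Bochner_Integration.integral_add continuous_cube_integrable continuous_intros cg tp(2,3))
  ultimately show "L2_inner (tensor g) (partial_deriv i \<phi>) = - L2_inner ?g' \<phi>"
    by (simp add: L2_inner_def mult.commute)
qed

section \<open>Cut-offs, uniqueness of weak derivatives, and integration by parts up to the
  boundary\<close>

definition bump :: "real \<Rightarrow> real \<Rightarrow> nat \<Rightarrow> real \<Rightarrow> real" where
  "bump a b n t = flat_exp (real (Suc n) * (t - a) - 1) * flat_exp (real (Suc n) * (b - t) - 1)"

lemma smooth_bump: "smooth (bump a b n)"
proof -
  have "smooth (\<lambda>t. flat_exp (real (Suc n) * t + (- real (Suc n) * a - 1)) * flat_exp (- real (Suc n) * t + (real (Suc n) * b - 1)))"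
    by (intro smooth_mult smooth_affine smooth_flat_exp)
  moreover have "bump a b n = (\<lambda>t. flat_exp (real (Suc n) * t + (- real (Suc n) * a - 1)) * flat_exp (- real (Suc n) * t + (real (Suc n) * b - 1)))"
    unfolding bump_def by (auto simp: fun_eq_iff algebra_simps)
  ultimately show ?thesis by simp
qed

lemma bump_bounds: "0 \<le> bump a b n t" "bump a b n t \<le> 1"
  by (auto simp: bump_def flat_exp_bounds intro!: mult_nonneg_nonneg mult_le_one)

lemma bump_eq_0: "t \<le> a + 1 / real (Suc n) \<or> t \<ge> b - 1 / real (Suc n) \<Longrightarrow> bump a b n t = 0"
  by (auto simp: bump_def flat_exp_def field_simps)

lemma flat_exp_tendsto:
  assumes "c > 0" shows "(\<lambda>n. flat_exp (real (Suc n) * c - 1)) \<longlonglongrightarrow> 1"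
proof -
  have lim: "filterlim (\<lambda>n. real (Suc n) * c - 1) at_top sequentially" using assms by real_asymp
  have "((\<lambda>u::real. exp (- (1 / u))) \<longlongrightarrow> 1) at_top" by real_asymp
  from filterlim_compose[OF this lim] have "(\<lambda>n. exp (- (1 / (real (Suc n) * c - 1)))) \<longlonglongrightarrow> 1" .
  then show ?thesis
  proof (rule Lim_transform_eventually)
    have "eventually (\<lambda>n. real (Suc n) * c - 1 > 0) sequentially" using lim unfolding filterlim_at_top_dense by blast
    then show "\<forall>\<^sub>F n in sequentially. exp (- (1 / (real (Suc n) * c - 1))) = flat_exp (real (Suc n) * c - 1)"
      by eventually_elim (simp add: flat_exp_def)
  qed
qed

lemma bump_tendsto: "(\<lambda>n. bump a b n t) \<longlonglongrightarrow> (if a < t \<and> t < b then 1 else 0)"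
proof (cases "a < t \<and> t < b")
  case True
  have "(\<lambda>n. bump a b n t) \<longlonglongrightarrow> 1 * 1"
    unfolding bump_def by (intro tendsto_mult flat_exp_tendsto) (use True in auto)
  then show ?thesis using True by simp
next
  case False
  then have "bump a b n t = 0" for n by (intro bump_eq_0) (smt (verit) divide_nonneg_nonneg of_nat_0_le_iff)
  moreover have "(if a < t \<and> t < b then 1 else 0 :: real) = 0" using False by simp
  ultimately show ?thesis by simp
qed

lemma unit_cube_interior_AE: "AE x in (cube_measure :: (real^'n::finite) measure). x \<in> interior unit_cube"
proof -
  have "unit_cube - interior unit_cube \<in> null_sets (lebesgue :: (real^'n) measure)"
    unfolding unit_cube_def interior_cbox negligible_iff_null_sets[symmetric] by (rule negligible_frontier_interval)
  then have "AE x in lebesgue. x \<notin> (unit_cube - interior unit_cube :: (real^'n) set)" by (rule AE_not_in)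
  then show ?thesis unfolding AE_cube_measure by eventually_elim auto
qed

text \<open>Clipping the box to the cube makes the bumps test functions. The limit is the indicator
  of the clipped open box, which differs from that of the box only on the boundary of the cube, a
  null set.\<close>

lemma box_bump:
  fixes a b :: "real^'n::finite"
  defines "B \<equiv> \<lambda>n. tensor (\<lambda>i. bump (max (a $ i) 0) (min (b $ i) 1) n)"
  shows "B n \<in> test_functions" "\<bar>B n x\<bar> \<le> 1" "continuous_on S (B n)"
    "AE x in cube_measure. (\<lambda>n. B n x) \<longlonglongrightarrow> indicator (box a b) x"
proof -
  show "B n \<in> test_functions" unfolding B_def
  proof (rule test_functions_tensor[where \<delta>="1 / real (Suc n)"])
    fix i :: 'n and t assume t: "t < 1 / real (Suc n) \<or> 1 - 1 / real (Suc n) < t"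
    show "bump (max (a $ i) 0) (min (b $ i) 1) n t = 0"
      by (rule bump_eq_0) (use t in linarith)
  qed (auto intro: smooth_bump)
  have "0 \<le> B n x" "B n x \<le> 1" unfolding B_def tensor_def by (auto intro!: prod_nonneg prod_le_1 bump_bounds)
  then show "\<bar>B n x\<bar> \<le> 1" by simp
  show "continuous_on S (B n)" unfolding B_def by (intro continuous_tensor smooth_continuous smooth_bump)
  show "AE x in cube_measure. (\<lambda>n. B n x) \<longlonglongrightarrow> indicator (box a b) x"
    using unit_cube_interior_AE
  proof eventually_elim
    case (elim x)
    have "(\<lambda>n. B n x) \<longlonglongrightarrow> (\<Prod>i\<in>UNIV. if max (a $ i) 0 < x $ i \<and> x $ i < min (b $ i) 1 then 1 else 0)"
      unfolding B_def tensor_def by (intro tendsto_prod bump_tendsto)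
    also have "(\<Prod>i\<in>UNIV. if max (a $ i) 0 < x $ i \<and> x $ i < min (b $ i) 1 then 1 else 0) = (indicator (box a b) x :: real)"
      using elim by (auto simp: indicator_def mem_box_cart interior_unit_cube_iff intro!: prod.neutral prod_zero)
    finally show ?case .
  qed
qed

lemma test_functions_L2: "\<phi> \<in> test_functions \<Longrightarrow> \<phi> \<in> L2_space"
  "\<phi> \<in> test_functions \<Longrightarrow> partial_deriv i \<phi> \<in> L2_space"
  using test_function_props(2,3) continuous_cube_L2 by blast+

text \<open>By Pythagoras an orthogonal v has squared distance at least \<open>L2_inner u u\<close>
  from u, and this distance can be made arbitrarily small.\<close>

lemma L2_orthogonal_dense_eq_0:
  assumes u: "u \<in> L2_closure {v \<in> L2_space. L2_inner u v = 0}"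
  shows "AE x in cube_measure. u x = 0"
proof -
  have uL: "u \<in> L2_space" using u by (simp add: L2_closure_def)
  have "L2_inner u u \<le> \<delta>" if "\<delta> > 0" for \<delta>
  proof -
    obtain v where v: "v \<in> L2_space" "L2_inner u v = 0" "L2_dist2 u v < \<delta>"
      using u \<open>\<delta> > 0\<close> unfolding L2_closure_def by blast
    have "L2_dist2 u v = L2_inner u u + L2_inner v v"
      using v unfolding L2_dist2_inner
      by (simp add: L2_inner_diff_left L2_inner_diff_right uL L2_diff L2_inner_commute[of v u])
    then show ?thesis using v(3) L2_inner_self_nonneg[of v] by simp
  qed
  then have "L2_inner u u \<le> 0" by (rule field_le_epsilon[of _ 0, simplified]) 
  then have "(LINT x|cube_measure. (u x)\<^sup>2) = 0" using L2_inner_self_nonneg[of u] by (simp add: L2_inner_def power2_eq_square antisym)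
  then show ?thesis using integral_nonneg_eq_0_iff_AE[OF L2_square_integrable[OF uL]] by simp
qed

text \<open>The difference d is orthogonal to all test functions, in particular to the bumps. The
  functions orthogonal to d therefore form an \<open>L2_subspace\<close>, which is dense, and d is
  orthogonal to itself.\<close>

lemma weak_deriv_unique:
  fixes u :: "real^'n::finite \<Rightarrow> real"
  assumes "has_weak_deriv i u v" "has_weak_deriv i u w" "v \<in> L2_space" "w \<in> L2_space"
  shows "AE x in cube_measure. v x = w x"
proof -
  define d where "d x = v x - w x" for x
  have dL: "d \<in> L2_space" unfolding d_def[abs_def] by (rule L2_diff) fact+
  have orth: "L2_inner d \<phi> = 0" if "\<phi> \<in> test_functions" for \<phi>
    using assms that unfolding has_weak_deriv_def d_def[abs_def]
    by (simp add: L2_inner_diff_left test_functions_L2)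
  let ?V = "{v \<in> L2_space. L2_inner d v = 0}"
  interpret L2_subspace ?V
  proof
    fix a b :: "real^'n"
    show "indicator (box a b) \<in> L2_closure ?V"
    proof (rule L2_closure_dominated[where g="\<lambda>_. 1"])
      let ?B = "\<lambda>n. tensor (\<lambda>i. bump (max (a $ i) 0) (min (b $ i) 1) n)"
      have "?B n \<in> ?V" for n using orth box_bump(1) test_functions_L2 by blast
      then show "?B n \<in> L2_closure ?V" for n
        unfolding L2_closure_def by (intro CollectI conjI allI impI bexI[of _ "?B n"]) (auto simp: L2_dist2_def)
      show "\<bar>?B n x\<bar> \<le> 1" for n x by (rule box_bump)
      show "AE x in cube_measure. (\<lambda>n. ?B n x) \<longlonglongrightarrow> indicator (box a b) x" by (rule box_bump)
      show "(\<lambda>_. 1) \<in> L2_space" by (intro continuous_cube_L2 continuous_intros)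
    qed (intro measurable_restrict_space1 measurable_completion, simp)
  next
    fix u v assume "u \<in> ?V" "v \<in> ?V"
    then show "(\<lambda>x. u x + v x) \<in> ?V"
      using dL by (simp add: L2_add L2_inner_commute[of d] L2_inner_add_left)
  next
    fix u c assume "u \<in> ?V"
    then show "(\<lambda>x. c * u x) \<in> ?V"
      by (simp add: L2_cmult L2_inner_cmult_right)
  qed
  have "AE x in cube_measure. d x = 0"
    by (rule L2_orthogonal_dense_eq_0) (use dense dL in auto)
  then show ?thesis by eventually_elim (simp add: d_def)
qed

lemma weak_deriv_L2: 
  assumes "u \<in> H1_space" shows "weak_deriv i u \<in> L2_space" "has_weak_deriv i u (weak_deriv i u)"
proof -
  have "\<exists>v. v \<in> L2_space \<and> has_weak_deriv i u v" using assms by (auto simp: H1_space_def)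
  from someI_ex[OF this] show "weak_deriv i u \<in> L2_space" "has_weak_deriv i u (weak_deriv i u)"
    by (auto simp: weak_deriv_def)
qed

lemma smooth_tensor_L2: "(\<And>i. smooth (g i)) \<Longrightarrow> tensor g \<in> L2_space"
  by (intro tensor_L2 smooth_continuous)

lemma
  fixes g :: "'n::finite \<Rightarrow> real \<Rightarrow> real"
  assumes g: "\<And>i. smooth (g i)"
  shows tensor_H1: "tensor g \<in> H1_space"
    and weak_deriv_tensor: "AE x in cube_measure. weak_deriv i (tensor g) x = tensor (g(i := deriv (g i))) x"
proof -
  have "tensor (g(i := deriv (g i))) \<in> L2_space" for i using g by (intro smooth_tensor_L2) (auto intro: smooth_deriv)
  note L = this and W = has_weak_deriv_tensor[of g, OF g]
  have H: "tensor g \<in> H1_space"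
    using L W smooth_tensor_L2[of g, OF g] unfolding H1_space_def by blast
  then show "tensor g \<in> H1_space" .
  from weak_deriv_L2[OF H] L W
  show "AE x in cube_measure. weak_deriv i (tensor g) x = tensor (g(i := deriv (g i))) x"
    by (intro weak_deriv_unique)
qed

text \<open>With u = n t - 1 the factor n t is u + 1, and the bounds on u times the derivative and
  on the derivative itself add up to 1 + 2.\<close>

lemma cutoff_product_bound:
  assumes "\<bar>x\<bar> \<le> M * t" "0 \<le> t" "0 \<le> M" "n > 0"
  shows "\<bar>x * (n * deriv flat_exp (n * t - 1))\<bar> \<le> 3 * M"
proof -
  let ?u = "n * t - 1"
  have "0 \<le> n * deriv flat_exp ?u" using assms flat_exp_deriv_bounds(1)[of ?u] by simp
  then have "\<bar>x * (n * deriv flat_exp ?u)\<bar> = \<bar>x\<bar> * (n * deriv flat_exp ?u)" by (simp only: abs_mult[of x] abs_of_nonneg)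
  also have "\<dots> \<le> M * t * (n * deriv flat_exp ?u)"
    by (intro mult_right_mono) fact+
  also have "\<dots> = M * (?u * deriv flat_exp ?u + deriv flat_exp ?u)" by (simp add: algebra_simps)
  also have "\<dots> \<le> M * 3"
    using flat_exp_deriv_bounds[of ?u] assms by (intro mult_left_mono) linarith+
  finally show ?thesis by simp
qed

lemma cutoff_deriv_tendsto:
  assumes "t > 0" shows "(\<lambda>n. real (Suc n) * deriv flat_exp (real (Suc n) * t - 1)) \<longlonglongrightarrow> 0"
proof -
  have lim: "filterlim (\<lambda>n. real (Suc n) * t - 1) at_top sequentially" using assms by real_asymp
  have "((\<lambda>u::real. (u + 1) / t * (exp (- (1 / u)) / u\<^sup>2)) \<longlongrightarrow> 0) at_top" using assms by real_asymp
  from filterlim_compose[OF this lim]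
  have "(\<lambda>n. (real (Suc n) * t - 1 + 1) / t * (exp (- (1 / (real (Suc n) * t - 1))) / (real (Suc n) * t - 1)\<^sup>2)) \<longlonglongrightarrow> 0" .
  then show ?thesis
  proof (rule Lim_transform_eventually)
    have "eventually (\<lambda>n. real (Suc n) * t - 1 > 0) sequentially" using lim unfolding filterlim_at_top_dense by blast
    then show "\<forall>\<^sub>F n in sequentially. (real (Suc n) * t - 1 + 1) / t * (exp (- (1 / (real (Suc n) * t - 1))) / (real (Suc n) * t - 1)\<^sup>2)
       = real (Suc n) * deriv flat_exp (real (Suc n) * t - 1)"
      by eventually_elim (use assms in \<open>simp add: deriv_flat_exp\<close>)
  qed
qed

lemma deriv_bump:
  "deriv (bump 0 1 n) t = real (Suc n) * deriv flat_exp (real (Suc n) * t - 1) * flat_exp (real (Suc n) * (1 - t) - 1)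
     - flat_exp (real (Suc n) * t - 1) * (real (Suc n) * deriv flat_exp (real (Suc n) * (1 - t) - 1))"
proof -
  have a: "((\<lambda>t. flat_exp (real (Suc n) * (t - 0) - 1)) has_real_derivative deriv flat_exp (real (Suc n) * (t - 0) - 1) * real (Suc n)) (at t)"
    by (rule DERIV_chain2[OF smooth_DERIV[OF smooth_flat_exp]]) (auto intro!: derivative_eq_intros)
  have b: "((\<lambda>t. flat_exp (real (Suc n) * (1 - t) - 1)) has_real_derivative deriv flat_exp (real (Suc n) * (1 - t) - 1) * (- real (Suc n))) (at t)"
    by (rule DERIV_chain2[OF smooth_DERIV[OF smooth_flat_exp]]) (auto intro!: derivative_eq_intros)
  have "((\<lambda>t. bump 0 1 n t) has_real_derivative
      deriv flat_exp (real (Suc n) * (t - 0) - 1) * real (Suc n) * flat_exp (real (Suc n) * (1 - t) - 1)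
     + deriv flat_exp (real (Suc n) * (1 - t) - 1) * (- real (Suc n)) * flat_exp (real (Suc n) * (t - 0) - 1)) (at t)"
    unfolding bump_def by (rule DERIV_mult[OF a b])
  then show ?thesis by (simp add: DERIV_imp_deriv algebra_simps)
qed

text \<open>The derivative of the cut-off is of order n near the endpoints, but there g is at most M
  times the distance to the endpoint. The three terms of the product rule contribute M, 3 M and 3
  M.\<close>

lemma smooth_vanishing_cutoff:
  assumes g: "smooth g" "g 0 = 0" "g 1 = 0"
  shows "\<exists>B. \<forall>n. \<forall>t\<in>{0<..<1}. \<bar>deriv (\<lambda>t. g t * bump 0 1 n t) t\<bar> \<le> B"
    and "t \<in> {0<..<1} \<Longrightarrow> (\<lambda>n. deriv (\<lambda>t. g t * bump 0 1 n t) t) \<longlonglongrightarrow> deriv g t"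
proof -
  have d: "deriv (\<lambda>t. g t * bump 0 1 n t) t = deriv g t * bump 0 1 n t + deriv (bump 0 1 n) t * g t" for n t
    by (intro DERIV_imp_deriv DERIV_mult smooth_DERIV g smooth_bump)
  have "bounded (deriv g ` {0..1})"
    by (intro compact_imp_bounded compact_continuous_image continuous_on_subset[OF smooth_continuous[OF smooth_deriv[OF g(1)]]]) auto
  then obtain M where M: "\<And>t. t \<in> {0..1} \<Longrightarrow> \<bar>deriv g t\<bar> \<le> M" unfolding bounded_iff by (metis imageI real_norm_def)
  then have M0: "0 \<le> M" using abs_ge_zero order_trans by (metis atLeastAtMost_iff order_refl zero_le_one)
  have gb: "\<bar>g t\<bar> \<le> M * t" "\<bar>g t\<bar> \<le> M * (1 - t)" if t: "t \<in> {0<..<1}" for t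
  proof -
    obtain z where "0 < z" "z < t" "g t - g 0 = (t - 0) * deriv g z"
      using MVT2[of 0 t g "deriv g"] smooth_DERIV[OF g(1)] t by auto
    then show "\<bar>g t\<bar> \<le> M * t" using M[of z] t g by (auto simp: abs_mult mult.commute[of M])
    obtain y where "t < y" "y < 1" "g 1 - g t = (1 - t) * deriv g y"
      using MVT2[of t 1 g "deriv g"] smooth_DERIV[OF g(1)] t by auto
    then have "\<bar>- g t\<bar> = \<bar>(1 - t) * deriv g y\<bar>" "\<bar>deriv g y\<bar> \<le> M" using M[of y] t g by auto
    then have "\<bar>g t\<bar> = (1 - t) * \<bar>deriv g y\<bar>" "\<bar>deriv g y\<bar> \<le> M" using t by (auto simp: abs_mult)
    then show "\<bar>g t\<bar> \<le> M * (1 - t)" using t by (simp add: mult.commute mult_left_mono)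
  qed
  show "\<exists>B. \<forall>n. \<forall>t\<in>{0<..<1}. \<bar>deriv (\<lambda>t. g t * bump 0 1 n t) t\<bar> \<le> B"
  proof (intro exI allI ballI)
    fix n and t :: real assume t: "t \<in> {0<..<1}"
    let ?n = "real (Suc n)"
    have "\<bar>deriv g t * bump 0 1 n t\<bar> \<le> M * 1" unfolding abs_mult
      using M[of t] t bump_bounds[of 0 1 n t] by (intro mult_mono) auto
    moreover have "\<bar>g t * (?n * deriv flat_exp (?n * t - 1)) * flat_exp (?n * (1 - t) - 1)\<bar> \<le> 3 * M * 1"
      unfolding abs_mult[of _ "flat_exp _"] using gb[OF t] t M0 flat_exp_bounds
      by (intro mult_mono cutoff_product_bound) auto
    moreover have "\<bar>g t * (?n * deriv flat_exp (?n * (1 - t) - 1)) * flat_exp (?n * t - 1)\<bar> \<le> 3 * M * 1"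
      unfolding abs_mult[of _ "flat_exp _"] using gb[OF t] t M0 flat_exp_bounds
      by (intro mult_mono cutoff_product_bound) auto
    moreover have "deriv (\<lambda>t. g t * bump 0 1 n t) t = deriv g t * bump 0 1 n t
       + g t * (?n * deriv flat_exp (?n * t - 1)) * flat_exp (?n * (1 - t) - 1)
       - g t * (?n * deriv flat_exp (?n * (1 - t) - 1)) * flat_exp (?n * t - 1)"
      unfolding d deriv_bump by (simp add: algebra_simps)
    ultimately show "\<bar>deriv (\<lambda>t. g t * bump 0 1 n t) t\<bar> \<le> 7 * M" by linarith
  qed
  show "(\<lambda>n. deriv (\<lambda>t. g t * bump 0 1 n t) t) \<longlonglongrightarrow> deriv g t" if t: "t \<in> {0<..<1}" for t
  proof -
    have b: "(\<lambda>n. bump 0 1 n t) \<longlonglongrightarrow> 1" using bump_tendsto[of 0 1 t] t by simp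
    have "(\<lambda>n. deriv (bump 0 1 n) t) \<longlonglongrightarrow> 0 * 1 - 1 * 0"
      unfolding deriv_bump using t by (intro tendsto_intros cutoff_deriv_tendsto flat_exp_tendsto) auto
    then have "(\<lambda>n. deriv g t * bump 0 1 n t + deriv (bump 0 1 n) t * g t) \<longlonglongrightarrow> deriv g t * 1 + (0 * 1 - 1 * 0) * g t"
      by (intro tendsto_intros b)
    then show ?thesis unfolding d by simp
  qed
qed

lemma tensor_cutoff_tendsto:
  fixes G :: "nat \<Rightarrow> 'n::finite \<Rightarrow> real \<Rightarrow> real"
  assumes u: "u \<in> L2_space" and cont: "\<And>n i. continuous_on UNIV (G n i)" "\<And>i. continuous_on UNIV (h i)"
    and lim: "\<And>i t. t \<in> {0<..<1} \<Longrightarrow> (\<lambda>n. G n i t) \<longlonglongrightarrow> h i t"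
    and bd: "\<And>i. \<exists>B. \<forall>n. \<forall>t\<in>{0<..<1}. \<bar>G n i t\<bar> \<le> B"
  shows "(\<lambda>n. L2_inner u (tensor (G n))) \<longlonglongrightarrow> L2_inner u (tensor h)"
proof -
  obtain B where B: "\<And>i n t. t \<in> {0<..<1} \<Longrightarrow> \<bar>G n i t\<bar> \<le> B i" using bd by metis
  have [measurable]: "u \<in> borel_measurable cube_measure" by (rule L2_measurable[OF u])
  have [measurable]: "tensor (G n) \<in> borel_measurable cube_measure" "tensor h \<in> borel_measurable cube_measure" for n
    by (intro L2_measurable tensor_L2 cont)+
  show ?thesis unfolding L2_inner_def
  proof (rule integral_dominated_convergence)
    show "integrable cube_measure (\<lambda>x. \<bar>u x\<bar> * (\<Prod>i\<in>UNIV. B i))" using L2_integrable[OF u] by simp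
    show "AE x in cube_measure. (\<lambda>n. u x * tensor (G n) x) \<longlonglongrightarrow> u x * tensor h x"
      using unit_cube_interior_AE
    proof eventually_elim
      case (elim x)
      then show ?case unfolding tensor_def
        by (intro tendsto_mult tendsto_const tendsto_prod lim) (auto simp: interior_unit_cube_iff)
    qed
    show "AE x in cube_measure. norm (u x * tensor (G n) x) \<le> \<bar>u x\<bar> * (\<Prod>i\<in>UNIV. B i)" for n
      using unit_cube_interior_AE
    proof eventually_elim
      case (elim x)
      have "\<bar>tensor (G n) x\<bar> \<le> (\<Prod>i\<in>UNIV. B i)"
        unfolding tensor_def abs_prod using elim by (intro prod_mono) (auto simp: interior_unit_cube_iff intro!: B)
      then show ?case by (simp add: abs_mult mult_left_mono)
    qed
  qed measurable
qed

text \<open>No boundary terms arise in direction \<open>i\<close>, since \<open>g i\<close> vanishes on the two faces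
  orthogonal to it; in the other directions nothing is integrated by parts.\<close>

lemma weak_deriv_tensor_parts:
  fixes g :: "'n::finite \<Rightarrow> real \<Rightarrow> real"
  assumes u: "u \<in> L2_space" "v \<in> L2_space" "has_weak_deriv i u v"
    and g: "\<And>j. smooth (g j)" "g i 0 = 0" "g i 1 = 0"
  shows "L2_inner v (tensor g) = - L2_inner u (tensor (g(i := deriv (g i))))"
proof -
  define G where "G n j = (\<lambda>t. g j t * bump 0 1 n t)" for n j
  have sG: "smooth (G n j)" for n j unfolding G_def by (intro smooth_mult g smooth_bump)
  have bounded: "\<exists>B. \<forall>t\<in>{0<..<1}. \<bar>f t\<bar> \<le> B" if "continuous_on UNIV f" for f :: "real \<Rightarrow> real"
  proof -
    have "bounded (f ` {0..1})"
      by (intro compact_imp_bounded compact_continuous_image continuous_on_subset[OF that]) auto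
    then obtain B where "\<And>t. t \<in> {0..1} \<Longrightarrow> \<bar>f t\<bar> \<le> B" unfolding bounded_iff by (metis imageI real_norm_def)
    then show ?thesis by (intro exI[of _ B]) auto
  qed
  have Gb: "\<exists>B. \<forall>n. \<forall>t\<in>{0<..<1}. \<bar>G n j t\<bar> \<le> B" for j
  proof -
    obtain B where B: "\<And>t. t \<in> {0<..<1} \<Longrightarrow> \<bar>g j t\<bar> \<le> B" using bounded[OF smooth_continuous[OF g(1)]] by metis
    have "\<bar>G n j t\<bar> \<le> B" if "t \<in> {0<..<1}" for n t
    proof -
      have "\<bar>G n j t\<bar> \<le> B * 1" unfolding G_def abs_mult
        using B[OF that] bump_bounds[of 0 1 n t] by (intro mult_mono) auto
      then show ?thesis by simp
    qed
    then show ?thesis by blast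
  qed
  have Gl: "(\<lambda>n. G n j t) \<longlonglongrightarrow> g j t" if "t \<in> {0<..<1}" for j t
  proof -
    have "(\<lambda>n. g j t * bump 0 1 n t) \<longlonglongrightarrow> g j t * 1" using bump_tendsto[of 0 1 t] that by (intro tendsto_intros) simp
    then show ?thesis by (simp add: G_def)
  qed
  have test: "tensor (G n) \<in> test_functions" for n
  proof (rule test_functions_tensor[where \<delta>="1 / real (Suc n)"])
    fix i and t :: real assume "t < 1 / real (Suc n) \<or> 1 - 1 / real (Suc n) < t"
    then have "bump 0 1 n t = 0" by (intro bump_eq_0) auto
    then show "G n i t = 0" by (simp add: G_def)
  qed (auto intro: sG)
  have pd: "partial_deriv i (tensor (G n)) = tensor ((G n)(i := deriv (G n i)))" for n
    by (rule partial_deriv_tensor) (rule sG)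
  have eq: "L2_inner v (tensor (G n)) = - L2_inner u (tensor ((G n)(i := deriv (G n i))))" for n
    using u(3) test[of n] unfolding has_weak_deriv_def pd[symmetric] by fastforce
  have l1: "(\<lambda>n. L2_inner v (tensor (G n))) \<longlonglongrightarrow> L2_inner v (tensor g)"
    by (rule tensor_cutoff_tendsto[OF u(2)]) (auto intro!: smooth_continuous sG g Gl Gb)
  have "(\<lambda>n. L2_inner u (tensor ((G n)(i := deriv (G n i))))) \<longlonglongrightarrow> L2_inner u (tensor (g(i := deriv (g i))))"
  proof (rule tensor_cutoff_tendsto[OF u(1)])
    show "continuous_on UNIV (((G n)(i := deriv (G n i))) j)" for n j using sG by (auto intro!: smooth_continuous smooth_deriv)
    show "continuous_on UNIV ((g(i := deriv (g i))) j)" for j using g by (auto intro!: smooth_continuous smooth_deriv)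
    show "(\<lambda>n. ((G n)(i := deriv (G n i))) j t) \<longlonglongrightarrow> (g(i := deriv (g i))) j t" if "t \<in> {0<..<1}" for j t
      using smooth_vanishing_cutoff(2)[OF g(1) g(2,3) that] Gl[OF that] by (auto simp: G_def)
    show "\<exists>B. \<forall>n. \<forall>t\<in>{0<..<1}. \<bar>((G n)(i := deriv (G n i))) j t\<bar> \<le> B" for j
      using smooth_vanishing_cutoff(1)[OF g(1) g(2,3)] Gb[of j] by (cases "j = i") (auto simp: G_def)
  qed
  then have "(\<lambda>n. L2_inner v (tensor (G n))) \<longlonglongrightarrow> - L2_inner u (tensor (g(i := deriv (g i))))"
    unfolding eq by (rule tendsto_minus)
  from LIMSEQ_unique[OF l1 this] show ?thesis .
qed

section \<open>Sine and cosine modes\<close>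

text \<open>S collects the directions in which the factor is a sine. Differentiating a cosine mode
  in direction i puts i into S, and a direction in S carries zero boundary values.\<close>

definition trig_mode :: "'n set \<Rightarrow> ('n::finite \<Rightarrow> nat) \<Rightarrow> real^'n \<Rightarrow> real" where
  "trig_mode S k = tensor (\<lambda>i t. if i \<in> S then sin (pi * real (k i) * t) else cos (pi * real (k i) * t))"

abbreviation cos_mode :: "('n::finite \<Rightarrow> nat) \<Rightarrow> real^'n \<Rightarrow> real" where
  "cos_mode \<equiv> trig_mode {}"

text \<open>Not normalised: the Fourier coefficient is this divided by the squared norm of the mode,
  which lies between 2^(-d) and 1.\<close>

definition cosine_coeff :: "(real^'n \<Rightarrow> real) \<Rightarrow> ('n::finite \<Rightarrow> nat) \<Rightarrow> real" where
  "cosine_coeff u k = L2_inner u (cos_mode k)"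

lemma smooth_trig_factor: "smooth (\<lambda>t. if i \<in> S then sin (pi * real (k i) * t) else cos (pi * real (k i) * t))"
  by (cases "i \<in> S") (simp_all add: smooth_sin smooth_cos)

lemma continuous_trig_mode: "continuous_on T (trig_mode S k)"
  unfolding trig_mode_def by (intro continuous_tensor smooth_continuous smooth_trig_factor)

lemma trig_mode_L2: "trig_mode S k \<in> L2_space"
  by (intro continuous_cube_L2 continuous_trig_mode)

lemma abs_trig_mode_le: "\<bar>trig_mode S k x\<bar> \<le> 1"
  unfolding trig_mode_def tensor_def abs_prod by (intro prod_le_1) auto

lemma integral_0_1_eq_diff:
  fixes F f :: "real \<Rightarrow> real"
  assumes "\<And>t. (F has_real_derivative f t) (at t)"
  shows "integral {0..1} f = F 1 - F 0"
proof (rule integral_unique[OF fundamental_theorem_of_calculus])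
  fix x :: real show "(F has_vector_derivative f x) (at x within {0..1})"
    using assms[of x] by (simp add: has_real_derivative_iff_has_vector_derivative[symmetric] has_field_derivative_at_within)
qed simp

text \<open>The antiderivative is, up to scaling, the Wronskian of the two factors divided by the
  difference of their eigenvalues, which is nonzero as the frequencies differ.\<close>

lemma trig_orthogonal_1:
  assumes "m \<noteq> (n::nat)"
  shows "integral {0..1} (\<lambda>t. cos (pi * real m * t) * cos (pi * real n * t)) = 0"
    and "integral {0..1} (\<lambda>t. sin (pi * real m * t) * sin (pi * real n * t)) = 0"
proof -
  define D where "D = pi * ((real n)\<^sup>2 - (real m)\<^sup>2)"
  have D: "D \<noteq> 0" using assms by (simp add: D_def power2_eq_iff)
  have s: "sin (pi * real j * 1) = 0" for j by (simp add: mult.commute)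
  have dcos: "((\<lambda>t. (real n * cos (pi * real m * t) * sin (pi * real n * t) - real m * sin (pi * real m * t) * cos (pi * real n * t)) / D) has_real_derivative
      D * (cos (pi * real m * t) * cos (pi * real n * t)) / D) (at t)" for t
    by (rule DERIV_cdivide) (auto intro!: derivative_eq_intros simp: D_def algebra_simps power2_eq_square)
  have "integral {0..1} (\<lambda>t. cos (pi * real m * t) * cos (pi * real n * t)) =
    (real n * cos (pi * real m * 1) * sin (pi * real n * 1) - real m * sin (pi * real m * 1) * cos (pi * real n * 1)) / D -
    (real n * cos (pi * real m * 0) * sin (pi * real n * 0) - real m * sin (pi * real m * 0) * cos (pi * real n * 0)) / D"
    by (rule integral_0_1_eq_diff) (use dcos D in simp)
  then show "integral {0..1} (\<lambda>t. cos (pi * real m * t) * cos (pi * real n * t)) = 0" unfolding s by simp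
  have dsin: "((\<lambda>t. (real m * cos (pi * real m * t) * sin (pi * real n * t) - real n * sin (pi * real m * t) * cos (pi * real n * t)) / D) has_real_derivative
      D * (sin (pi * real m * t) * sin (pi * real n * t)) / D) (at t)" for t
    by (rule DERIV_cdivide) (auto intro!: derivative_eq_intros simp: D_def algebra_simps power2_eq_square)
  have "integral {0..1} (\<lambda>t. sin (pi * real m * t) * sin (pi * real n * t)) =
    (real m * cos (pi * real m * 1) * sin (pi * real n * 1) - real n * sin (pi * real m * 1) * cos (pi * real n * 1)) / D -
    (real m * cos (pi * real m * 0) * sin (pi * real n * 0) - real n * sin (pi * real m * 0) * cos (pi * real n * 0)) / D"
    by (rule integral_0_1_eq_diff) (use dsin D in simp)
  then show "integral {0..1} (\<lambda>t. sin (pi * real m * t) * sin (pi * real n * t)) = 0" unfolding s by simp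
qed

lemma integral_trig_square_bounds:
  "0 \<le> integral {0..1} (\<lambda>t. sin (c * t) * sin (c * t))" "integral {0..1} (\<lambda>t. sin (c * t) * sin (c * t)) \<le> 1"
  "0 \<le> integral {0..1} (\<lambda>t. cos (c * t) * cos (c * t))" "integral {0..1} (\<lambda>t. cos (c * t) * cos (c * t)) \<le> (1::real)"
proof -
  have i: "(\<lambda>t. sin (c * t) * sin (c * t)) integrable_on {0..1}" "(\<lambda>t. cos (c * t) * cos (c * t)) integrable_on {0..1}"
    "(\<lambda>t::real. 1::real) integrable_on {0..1}"
    by (intro integrable_continuous_interval continuous_intros)+
  show "0 \<le> integral {0..1} (\<lambda>t. sin (c * t) * sin (c * t))" "0 \<le> integral {0..1} (\<lambda>t. cos (c * t) * cos (c * t))"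
    by (intro integral_nonneg i; simp)+
  have "integral {0..1} (\<lambda>t. sin (c * t) * sin (c * t)) \<le> integral {0..1} (\<lambda>t::real. 1::real)"
    by (intro integral_le i) (simp add: power2_eq_square[symmetric] abs_square_le_1)
  then show "integral {0..1} (\<lambda>t. sin (c * t) * sin (c * t)) \<le> 1" by simp
  have "integral {0..1} (\<lambda>t. cos (c * t) * cos (c * t)) \<le> integral {0..1} (\<lambda>t::real. 1::real)"
    by (intro integral_le i) (simp add: power2_eq_square[symmetric] abs_square_le_1)
  then show "integral {0..1} (\<lambda>t. cos (c * t) * cos (c * t)) \<le> 1" by simp
qed

lemma integral_cos_square_ge: "1 / 2 \<le> integral {0..1} (\<lambda>t. cos (pi * real m * t) * cos (pi * real m * t))"
proof (cases "m = 0")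
  case False
  let ?c = "pi * real m"
  have "integral {0..1} (\<lambda>t. cos (?c * t) * cos (?c * t)) =
    (1 / 2 + sin (?c * 1) * cos (?c * 1) / (2 * ?c)) - (0 / 2 + sin (?c * 0) * cos (?c * 0) / (2 * ?c))"
  proof (rule integral_0_1_eq_diff[where F="\<lambda>t. t / 2 + sin (?c * t) * cos (?c * t) / (2 * ?c)"])
    fix t
    have "((\<lambda>t. t / 2 + sin (?c * t) * cos (?c * t) / (2 * ?c)) has_real_derivative
      1 / 2 + (cos (?c * t) * ?c * cos (?c * t) - sin (?c * t) * (sin (?c * t) * ?c)) / (2 * ?c)) (at t)"
      by (intro DERIV_add DERIV_cdivide) (auto intro!: derivative_eq_intros)
    moreover have "1 / 2 + (cos (?c * t) * ?c * cos (?c * t) - sin (?c * t) * (sin (?c * t) * ?c)) / (2 * ?c)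
       = cos (?c * t) * cos (?c * t)"
    proof -
      have *: "1 / 2 + (c * C * c - s * (s * C)) / (2 * C) = c * c" if "C \<noteq> 0" "s\<^sup>2 + c\<^sup>2 = 1" for c s C :: real
      proof -
        have "(c * C * c - s * (s * C)) / (2 * C) = (c\<^sup>2 - s\<^sup>2) / 2" using that(1) by (simp add: field_simps power2_eq_square)
        then show ?thesis using that(2) by (simp add: power2_eq_square[symmetric] field_simps)
      qed
      show ?thesis by (rule *) (use False in \<open>auto simp: sin_cos_squared_add\<close>)
    qed
    ultimately show "((\<lambda>t. t / 2 + sin (?c * t) * cos (?c * t) / (2 * ?c)) has_real_derivative
      cos (?c * t) * cos (?c * t)) (at t)" by simp
  qed
  moreover have "sin (?c * 1) = 0" by (simp add: mult.commute)
  ultimately show ?thesis by simp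
qed simp

lemma L2_inner_trig_mode:
  "L2_inner (trig_mode S k) (trig_mode S l) = (\<Prod>i\<in>UNIV. integral {0..1} (\<lambda>t.
     (if i \<in> S then sin (pi * real (k i) * t) else cos (pi * real (k i) * t)) *
     (if i \<in> S then sin (pi * real (l i) * t) else cos (pi * real (l i) * t))))"
  unfolding trig_mode_def by (intro L2_inner_tensor smooth_continuous smooth_trig_factor)

lemma trig_mode_orthogonal: assumes "k \<noteq> l" shows "L2_inner (trig_mode S k) (trig_mode S l) = 0"
proof -
  obtain i where i: "k i \<noteq> l i" using assms by blast
  show ?thesis unfolding L2_inner_trig_mode
  proof (intro prod_zero bexI[of _ i])
    show "integral {0..1} (\<lambda>t. (if i \<in> S then sin (pi * real (k i) * t) else cos (pi * real (k i) * t)) *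
       (if i \<in> S then sin (pi * real (l i) * t) else cos (pi * real (l i) * t))) = 0"
      using trig_orthogonal_1[OF i] by (cases "i \<in> S") simp_all
  qed auto
qed

lemma trig_mode_norm_le: "L2_inner (trig_mode S k) (trig_mode S k) \<le> 1"
  unfolding L2_inner_trig_mode
proof (intro prod_le_1 conjI)
  fix i
  let ?I = "integral {0..1} (\<lambda>t. (if i \<in> S then sin (pi * real (k i) * t) else cos (pi * real (k i) * t)) *
       (if i \<in> S then sin (pi * real (k i) * t) else cos (pi * real (k i) * t)))"
  show "0 \<le> ?I" "?I \<le> 1" by (cases "i \<in> S"; simp add: integral_trig_square_bounds)+
qed

lemma cos_mode_norm_ge: "(1 / 2) ^ CARD('n) \<le> L2_inner (cos_mode k) (cos_mode (k :: 'n::finite \<Rightarrow> nat))"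
proof -
  have "(\<Prod>i\<in>(UNIV::'n set). 1 / 2) \<le> (\<Prod>i\<in>UNIV. integral {0..1} (\<lambda>t. cos (pi * real (k i) * t) * cos (pi * real (k i) * t)))"
    by (intro prod_mono conjI integral_cos_square_ge) auto
  then show ?thesis unfolding L2_inner_trig_mode by simp
qed

lemma cos_mode_norm_pos: "0 < L2_inner (cos_mode k) (cos_mode (k :: 'n::finite \<Rightarrow> nat))"
  by (rule less_le_trans[OF _ cos_mode_norm_ge]) simp

text \<open>Norms at most 1 suffice in place of an orthonormal family: they give (w, w) <= (w, v)
  for w the sum of the \<open>a k * e k\<close>, and the square of v - w does the rest. So the modes
  never have to be normalised.\<close>

lemma Bessel:
  assumes v: "v \<in> L2_space" and K: "finite K" and e: "\<And>k. k \<in> K \<Longrightarrow> e k \<in> L2_space"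
    and orth: "\<And>k l. k \<in> K \<Longrightarrow> l \<in> K \<Longrightarrow> k \<noteq> l \<Longrightarrow> L2_inner (e k) (e l) = 0"
    and norm: "\<And>k. k \<in> K \<Longrightarrow> L2_inner (e k) (e k) \<le> 1"
  shows "(\<Sum>k\<in>K. (L2_inner v (e k))\<^sup>2) \<le> L2_inner v v"
proof -
  define a where "a k = L2_inner v (e k)" for k
  define w where "w x = (\<Sum>k\<in>K. a k * e k x)" for x
  have wL: "w \<in> L2_space" unfolding w_def[abs_def] using e by (intro L2_sum L2_cmult)
  have we: "L2_inner w z = (\<Sum>k\<in>K. a k * L2_inner (e k) z)" if "z \<in> L2_space" for z
    unfolding w_def[abs_def] using e that by (subst L2_inner_sum_left) (auto intro: L2_cmult simp: L2_inner_cmult_left)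
  have "L2_inner (e k) w = a k * L2_inner (e k) (e k)" if "k \<in> K" for k
  proof -
    have "L2_inner (e k) w = (\<Sum>l\<in>K. a l * L2_inner (e l) (e k))"
      using we[OF e[OF that]] by (simp add: L2_inner_commute)
    also have "\<dots> = (\<Sum>l\<in>K. if l = k then a k * L2_inner (e k) (e k) else 0)"
      using orth that by (intro sum.cong) auto
    finally show ?thesis using K that by simp
  qed
  then have ww: "L2_inner w w = (\<Sum>k\<in>K. (a k)\<^sup>2 * L2_inner (e k) (e k))"
    unfolding we[OF wL] by (intro sum.cong) (auto simp: power2_eq_square)
  have vw: "L2_inner w v = (\<Sum>k\<in>K. (a k)\<^sup>2)"
    unfolding we[OF v] a_def by (simp add: L2_inner_commute[of _ v] power2_eq_square)
  have "0 \<le> L2_inner (\<lambda>x. v x - w x) (\<lambda>x. v x - w x)" by (rule L2_inner_self_nonneg)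
  also have "\<dots> = L2_inner v v - 2 * L2_inner w v + L2_inner w w"
    using v wL by (simp add: L2_inner_diff_left L2_inner_diff_right L2_diff L2_inner_commute[of v w])
  also have "L2_inner w w \<le> L2_inner w v" unfolding ww vw
    using norm by (intro sum_mono mult_left_le) auto
  finally show ?thesis unfolding vw a_def by linarith
qed

lemma Bessel_trig:
  "v \<in> L2_space \<Longrightarrow> finite K \<Longrightarrow> (\<Sum>k\<in>K. (L2_inner v (trig_mode S k))\<^sup>2) \<le> L2_inner v v"
  by (rule Bessel) (auto intro: trig_mode_L2 trig_mode_orthogonal trig_mode_norm_le)

section \<open>Completeness of the cosine modes\<close>

inductive_set cos_span :: "(real^'n::finite \<Rightarrow> real) set" where
  cos_span_mode: "(\<lambda>x. c * cos_mode k x) \<in> cos_span"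
| cos_span_add: "u \<in> cos_span \<Longrightarrow> v \<in> cos_span \<Longrightarrow> (\<lambda>x. u x + v x) \<in> cos_span"

lemma cos_span_sum_form: "u \<in> cos_span \<Longrightarrow> \<exists>K c. finite K \<and> u = (\<lambda>x. \<Sum>k\<in>K. c k * cos_mode k x)"
proof (induction rule: cos_span.induct)
  case (cos_span_mode c k)
  show ?case by (intro exI[of _ "{k}"] exI[of _ "\<lambda>_. c"]) simp
next
  case (cos_span_add u v)
  then obtain K c L d where e: "finite K" "u = (\<lambda>x. \<Sum>k\<in>K. c k * cos_mode k x)"
     "finite L" "v = (\<lambda>x. \<Sum>k\<in>L. d k * cos_mode k x)" by blast
  have "u x = (\<Sum>k\<in>K \<union> L. (if k \<in> K then c k else 0) * cos_mode k x)" for x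
    unfolding e(2) using e by (intro sum.mono_neutral_cong_left) auto
  moreover have "v x = (\<Sum>k\<in>K \<union> L. (if k \<in> L then d k else 0) * cos_mode k x)" for x
    unfolding e(4) using e by (intro sum.mono_neutral_cong_left) auto
  ultimately have "(\<lambda>x. u x + v x) = (\<lambda>x. \<Sum>k\<in>K \<union> L. ((if k \<in> K then c k else 0) + (if k \<in> L then d k else 0)) * cos_mode k x)"
    by (simp add: distrib_right sum.distrib)
  then show ?case using e
    by (intro exI[of _ "K \<union> L"] exI[of _ "\<lambda>k. (if k \<in> K then c k else 0) + (if k \<in> L then d k else 0)"] conjI) simp_all
qed

lemma cos_span_cmult: "u \<in> cos_span \<Longrightarrow> (\<lambda>x. c * u x) \<in> cos_span"
proof (induction rule: cos_span.induct)
  case (cos_span_mode d k)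
  show ?case using cos_span.cos_span_mode[of "c * d" k] by (simp add: mult.assoc)
next
  case (cos_span_add u v)
  then show ?case using cos_span.cos_span_add[OF cos_span_add.IH] by (simp add: distrib_left)
qed

lemma cos_span_sum: "finite K \<Longrightarrow> (\<And>k. k \<in> K \<Longrightarrow> u k \<in> cos_span) \<Longrightarrow> (\<lambda>x. \<Sum>k\<in>K. u k x) \<in> cos_span"
proof (induction K rule: finite_induct)
  case empty
  show ?case using cos_span_mode[of 0] by simp
next
  case (insert k K)
  then show ?case by (simp add: cos_span_add)
qed

text \<open>The product-to-sum formula is applied in each coordinate and the product is expanded; X
  is the set of coordinates in which the frequencies add, while in the others they are
  subtracted.\<close>

lemma cos_mode_mult: "(\<lambda>x. cos_mode k x * cos_mode l x) \<in> cos_span"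
proof -
  \<comment> \<open>The absolute difference of the frequencies is spelled out by cases because
    subtraction of naturals truncates.\<close>
  define m where "m X i = (if i \<in> X then k i + l i else if l i \<le> k i then k i - l i else l i - k i)" for X i
  have p: "cos (pi * real (k i) * t) * cos (pi * real (l i) * t) =
      1 / 2 * cos (pi * real (k i + l i) * t) + 1 / 2 * cos (pi * real (if l i \<le> k i then k i - l i else l i - k i) * t)" for i t
  proof -
    have "cos (pi * real (if l i \<le> k i then k i - l i else l i - k i) * t) = cos (pi * real (k i) * t - pi * real (l i) * t)"
    proof (cases "l i \<le> k i")
      case False
      then have "pi * real (l i - k i) * t = - (pi * real (k i) * t - pi * real (l i) * t)" by (simp add: of_nat_diff algebra_simps)
      then have "cos (pi * real (l i - k i) * t) = cos (pi * real (k i) * t - pi * real (l i) * t)"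
        by (simp only: cos_minus)
      then show ?thesis using False by (simp only: if_False)
    qed (simp add: of_nat_diff algebra_simps)
    moreover have "pi * real (k i + l i) * t = pi * real (k i) * t + pi * real (l i) * t" by (simp add: algebra_simps)
    ultimately show ?thesis by (simp only: cos_add cos_diff) (simp add: field_simps)
  qed
  have "cos_mode k x * cos_mode l x = (\<Sum>X\<in>Pow UNIV. (1 / 2) ^ CARD('a) * cos_mode (m X) x)" for x
  proof -
    have "cos_mode k x * cos_mode l x = (\<Prod>i\<in>UNIV. 1 / 2 * cos (pi * real (k i + l i) * (x $ i)) +
        1 / 2 * cos (pi * real (if l i \<le> k i then k i - l i else l i - k i) * (x $ i)))"
      unfolding trig_mode_def tensor_def prod.distrib[symmetric] by (intro prod.cong refl) (simp only: p empty_iff if_False)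
    also have "\<dots> = (\<Sum>X\<in>Pow UNIV. (1 / 2) ^ CARD('a) * cos_mode (m X) x)"
    proof (subst prod_add, simp, intro sum.cong refl)
      fix X :: "'a set"
      have "(\<Prod>i\<in>X. 1 / 2 * cos (pi * real (k i + l i) * x $ i)) *
         (\<Prod>i\<in>UNIV - X. 1 / 2 * cos (pi * real (if l i \<le> k i then k i - l i else l i - k i) * x $ i)) =
         (\<Prod>i\<in>X. 1 / 2 * cos (pi * real (m X i) * x $ i)) * (\<Prod>i\<in>UNIV - X. 1 / 2 * cos (pi * real (m X i) * x $ i))"
        by (intro arg_cong2[where f="(*)"] prod.cong) (auto simp: m_def)
      also have "\<dots> = (\<Prod>i\<in>UNIV. 1 / 2 * cos (pi * real (m X i) * x $ i))"
        by (subst mult.commute, subst prod.subset_diff[of X UNIV]) auto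
      also have "\<dots> = (1 / 2) ^ CARD('a) * cos_mode (m X) x"
        by (simp only: trig_mode_def tensor_def prod.distrib prod_constant empty_iff if_False)
      finally show "(\<Prod>i\<in>X. 1 / 2 * cos (pi * real (k i + l i) * x $ i)) *
         (\<Prod>i\<in>UNIV - X. 1 / 2 * cos (pi * real (if l i \<le> k i then k i - l i else l i - k i) * x $ i)) =
         (1 / 2) ^ CARD('a) * cos_mode (m X) x" .
    qed
    finally show ?thesis .
  qed
  then show ?thesis by (simp only:) (intro cos_span_sum cos_span_mode, simp)
qed

lemma cos_span_mult:
  assumes "u \<in> cos_span" "v \<in> cos_span" shows "(\<lambda>x. u x * v x) \<in> cos_span"
  using assms(1)
proof (induction rule: cos_span.induct)
  case (cos_span_mode c k)
  from assms(2) show ?case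
  proof (induction rule: cos_span.induct)
    case (cos_span_mode d l)
    have "(\<lambda>x. (c * d) * (cos_mode k x * cos_mode l x)) \<in> cos_span" by (intro cos_span_cmult cos_mode_mult)
    then show ?case by (simp add: mult_ac)
  next
    case (cos_span_add u v)
    show ?case using cos_span.cos_span_add[OF cos_span_add.IH] by (simp add: distrib_left)
  qed
next
  case (cos_span_add u v)
  show ?case using cos_span.cos_span_add[OF cos_span_add.IH] by (simp add: distrib_right)
qed

lemma cos_span_continuous: "u \<in> cos_span \<Longrightarrow> continuous_on S u"
  by (induction rule: cos_span.induct) (auto intro!: continuous_on_add continuous_on_mult continuous_trig_mode)

text \<open>Stone-Weierstrass: cosine polynomials form an algebra with constants, and they separate
  points because cos(pi t) is injective on [0, 1]. Uniform approximation is also mean square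
  approximation, as the cube has measure 1.\<close>

lemma continuous_in_cos_closure:
  fixes u :: "real^'n::finite \<Rightarrow> real"
  assumes u: "continuous_on unit_cube u" shows "u \<in> L2_closure cos_span"
proof -
  have "\<exists>v\<in>cos_span. v \<in> L2_space \<and> L2_dist2 u v < \<delta>" if "\<delta> > 0" for \<delta>
  proof -
    have "\<exists>v. v \<in> cos_span \<and> (\<forall>x\<in>unit_cube. \<bar>u x - v x\<bar> < sqrt (\<delta> / 2))"
    proof (rule Stone_Weierstrass_HOL[OF compact_unit_cube])
      show "(\<lambda>x::real^'n. c) \<in> cos_span" for c
        using cos_span_mode[of c "\<lambda>_. 0"] by (simp add: trig_mode_def tensor_def)
      show "\<exists>f. f \<in> cos_span \<and> f x \<noteq> f y" if xy: "x \<in> unit_cube \<and> y \<in> unit_cube \<and> x \<noteq> y" for x y :: "real^'n"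
      proof -
        obtain i where i: "x $ i \<noteq> y $ i" using xy by (metis vec_eq_iff)
        let ?k = "\<lambda>j. if j = i then 1 else 0 :: nat"
        have e: "cos_mode ?k z = cos (pi * (z $ i))" for z :: "real^'n"
        proof -
          have "cos_mode ?k z = (\<Prod>j\<in>UNIV. if j = i then cos (pi * (z $ i)) else 1)"
            unfolding trig_mode_def tensor_def by (intro prod.cong) auto
          then show ?thesis by simp
        qed
        have "cos (pi * (x $ i)) \<noteq> cos (pi * (y $ i))"
        proof
          assume "cos (pi * (x $ i)) = cos (pi * (y $ i))"
          moreover have r: "0 \<le> pi * (z $ i)" "pi * (z $ i) \<le> pi" if "z \<in> unit_cube" for z :: "real^'n"
            using that mult_left_mono[of "z $ i" 1 pi] by (simp_all add: unit_cube_iff)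
          ultimately have "pi * (x $ i) = pi * (y $ i)"
            using xy r[of x] r[of y] cos_inj_pi by blast
          then show False using i by simp
        qed
        have "(\<lambda>z. 1 * cos_mode ?k z) \<in> cos_span" by (rule cos_span_mode)
        then have "cos_mode ?k \<in> cos_span" unfolding mult_1 .
        moreover have "cos_mode ?k x \<noteq> cos_mode ?k y" using \<open>cos (pi * (x $ i)) \<noteq> cos (pi * (y $ i))\<close> unfolding e .
        ultimately show ?thesis by blast
      qed
      show "continuous_on unit_cube u" "0 < sqrt (\<delta> / 2)" using u \<open>\<delta> > 0\<close> by simp_all
      show "continuous_on unit_cube f" if "f \<in> cos_span" for f using that by (rule cos_span_continuous)
      show "(\<lambda>x. f x + g x) \<in> cos_span" if "f \<in> cos_span \<and> g \<in> cos_span" for f g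
        using cos_span_add[OF conjunct1[OF that] conjunct2[OF that]] .
      show "(\<lambda>x. f x * g x) \<in> cos_span" if "f \<in> cos_span \<and> g \<in> cos_span" for f g
        using cos_span_mult[OF conjunct1[OF that] conjunct2[OF that]] .
    qed
    then obtain v where v: "v \<in> cos_span" "\<And>x. x \<in> unit_cube \<Longrightarrow> \<bar>u x - v x\<bar> < sqrt (\<delta> / 2)" by blast
    have cv: "continuous_on unit_cube v" using v by (intro cos_span_continuous)
    interpret prob_space "cube_measure :: (real^'n) measure" by (rule prob_space_cube)
    have "L2_dist2 u v \<le> (LINT x|(cube_measure :: (real^'n) measure). \<delta> / 2)"
      unfolding L2_dist2_def
    proof (rule integral_mono)
      show "integrable cube_measure (\<lambda>x. (u x - v x)\<^sup>2)" by (intro continuous_cube_integrable continuous_intros u cv)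
      show "(u x - v x)\<^sup>2 \<le> \<delta> / 2" if "x \<in> space cube_measure" for x
      proof -
        have "(u x - v x)\<^sup>2 \<le> (sqrt (\<delta> / 2))\<^sup>2" using v(2)[of x] that by (subst abs_le_square_iff[symmetric]) simp
        then show ?thesis using \<open>\<delta> > 0\<close> by simp
      qed
      show "integrable (cube_measure :: (real^'n) measure) (\<lambda>x. \<delta> / 2)" 
        by (intro continuous_cube_integrable continuous_on_const)
    qed
    also have "\<dots> < \<delta>" using \<open>\<delta> > 0\<close> prob_space by simp
    finally show ?thesis by (intro bexI[OF _ v(1)] conjI continuous_cube_L2[OF cv])
  qed
  then show ?thesis using u by (simp add: L2_closure_def continuous_cube_L2)
qed

lemma cos_span_dense: "L2_space \<subseteq> L2_closure (cos_span :: (real^'n::finite \<Rightarrow> real) set)"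
proof -
  interpret L2_subspace "cos_span :: (real^'n \<Rightarrow> real) set"
  proof
    fix a b :: "real^'n"
    show "indicator (box a b) \<in> L2_closure cos_span"
    proof (rule L2_closure_dominated[where g="\<lambda>_. 1"])
      let ?B = "\<lambda>n. tensor (\<lambda>i. bump (max (a $ i) 0) (min (b $ i) 1) n)"
      show "?B n \<in> L2_closure cos_span" for n by (intro continuous_in_cos_closure box_bump)
      show "\<bar>?B n x\<bar> \<le> 1" for n x by (rule box_bump)
      show "AE x in cube_measure. (\<lambda>n. ?B n x) \<longlonglongrightarrow> indicator (box a b) x" by (rule box_bump)
      show "(\<lambda>_. 1) \<in> L2_space" by (intro continuous_cube_L2 continuous_intros)
    qed (intro measurable_restrict_space1 measurable_completion, simp)
  qed (auto intro: cos_span_add cos_span_cmult)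
  show ?thesis by (rule dense)
qed

text \<open>The orthogonal projection onto the modes in K; the quotient corrects for the missing
  normalisation of the modes.\<close>

definition cos_sum :: "('n::finite \<Rightarrow> nat) set \<Rightarrow> (real^'n \<Rightarrow> real) \<Rightarrow> real^'n \<Rightarrow> real" where
  "cos_sum K u x = (\<Sum>k\<in>K. cosine_coeff u k / L2_inner (cos_mode k) (cos_mode k) * cos_mode k x)"

lemma continuous_cos_sum: "continuous_on S (cos_sum K u)"
  unfolding cos_sum_def by (intro continuous_on_sum continuous_on_mult continuous_on_const continuous_trig_mode)

lemma cos_sum_L2: "cos_sum K u \<in> L2_space"
  by (intro continuous_cube_L2 continuous_cos_sum)

lemma L2_inner_cos_expansion:
  assumes "finite K" "l \<in> K"
  shows "L2_inner (\<lambda>x. \<Sum>k\<in>K. c k * cos_mode k x) (cos_mode l) = c l * L2_inner (cos_mode l) (cos_mode l)"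
proof -
  have "L2_inner (\<lambda>x. \<Sum>k\<in>K. c k * cos_mode k x) (cos_mode l) = (\<Sum>k\<in>K. c k * L2_inner (cos_mode k) (cos_mode l))"
    by (subst L2_inner_sum_left) (auto intro: L2_cmult trig_mode_L2 simp: L2_inner_cmult_left)
  also have "\<dots> = (\<Sum>k\<in>K. if k = l then c l * L2_inner (cos_mode l) (cos_mode l) else 0)"
    by (intro sum.cong) (auto simp: trig_mode_orthogonal)
  finally show ?thesis using assms by simp
qed

text \<open>Because the projection beats every other combination of the same modes, one good
  approximation from the span makes the projections onto all larger index sets good as well.\<close>

lemma cos_sum_best_approximation:
  assumes u: "u \<in> L2_space" and K: "finite K"
  shows "L2_dist2 u (cos_sum K u) \<le> L2_dist2 u (\<lambda>x. \<Sum>k\<in>K. c k * cos_mode k x)"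
proof -
  define w where "w x = (\<Sum>k\<in>K. c k * cos_mode k x)" for x
  define s where "s = cos_sum K u"
  define d where "d k = cosine_coeff u k / L2_inner (cos_mode k) (cos_mode k) - c k" for k
  have wL: "w \<in> L2_space" unfolding w_def[abs_def] by (intro L2_sum L2_cmult trig_mode_L2)
  have sL: "s \<in> L2_space" unfolding s_def by (rule cos_sum_L2)
  have orth: "L2_inner (cos_mode k) (\<lambda>x. u x - s x) = 0" if "k \<in> K" for k
  proof -
    have "L2_inner s (cos_mode k) = cosine_coeff u k"
      unfolding s_def cos_sum_def[abs_def] L2_inner_cos_expansion[OF K that] using cos_mode_norm_pos[of k] by simp
    then show ?thesis unfolding L2_inner_commute[of "cos_mode k"]
      by (simp add: L2_inner_diff_left u sL trig_mode_L2 cosine_coeff_def)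
  qed
  have sw: "s x - w x = (\<Sum>k\<in>K. d k * cos_mode k x)" for x
    by (simp add: s_def cos_sum_def w_def d_def sum_subtractf left_diff_distrib)
  have o2: "L2_inner (\<lambda>x. s x - w x) (\<lambda>x. u x - s x) = 0"
    unfolding sw using orth u sL
    by (subst L2_inner_sum_left) (auto intro!: L2_cmult trig_mode_L2 L2_diff simp: L2_inner_cmult_left)
  have "L2_dist2 u w = L2_inner (\<lambda>x. (u x - s x) + (s x - w x)) (\<lambda>x. (u x - s x) + (s x - w x))"
    by (simp add: L2_dist2_inner)
  also have "\<dots> = L2_dist2 u s + L2_inner (\<lambda>x. s x - w x) (\<lambda>x. s x - w x)"
  proof -
    have L: "(\<lambda>x. u x - s x) \<in> L2_space" "(\<lambda>x. s x - w x) \<in> L2_space" using u sL wL by (auto intro: L2_diff)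
    show ?thesis unfolding L2_inner_add_left[OF L L2_add[OF L]]
      unfolding L2_inner_commute[of _ "\<lambda>x. u x - s x + (s x - w x)"]
      unfolding L2_inner_add_left[OF L L(1)] L2_inner_add_left[OF L L(2)] o2 L2_inner_commute[of "\<lambda>x. u x - s x" "\<lambda>x. s x - w x"]
      by (simp add: L2_dist2_inner)
  qed
  finally show ?thesis using L2_inner_self_nonneg[of "\<lambda>x. s x - w x"] by (simp add: s_def w_def[abs_def])
qed

lemma cos_sum_approximates:
  assumes u: "u \<in> L2_space" and "\<delta> > 0"
  obtains K where "finite K" "\<And>K'. finite K' \<Longrightarrow> K \<subseteq> K' \<Longrightarrow> L2_dist2 u (cos_sum K' u) < \<delta>"
proof -
  obtain v where v: "v \<in> cos_span" "L2_dist2 u v < \<delta>"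
    using cos_span_dense u \<open>\<delta> > 0\<close> unfolding L2_closure_def by blast
  then obtain K c where K: "finite K" and vK: "v = (\<lambda>x. \<Sum>k\<in>K. c k * cos_mode k x)" using cos_span_sum_form by blast
  have "L2_dist2 u (cos_sum K' u) < \<delta>" if K': "finite K'" "K \<subseteq> K'" for K'
  proof -
    have "v = (\<lambda>x. \<Sum>k\<in>K'. (if k \<in> K then c k else 0) * cos_mode k x)"
      unfolding vK using K' by (intro ext sum.mono_neutral_cong_left) auto
    then show ?thesis using cos_sum_best_approximation[OF u K'(1), of "\<lambda>k. if k \<in> K then c k else 0"] v(2) by simp
  qed
  with K show ?thesis using that by blast
qed

section \<open>Sums over modes and the supremum norm\<close>

text \<open>A substitute for the eigenvalue that stays away from 0 at the constant mode as well, so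
  that its negative powers can be summed over all modes.\<close>

definition mode_weight :: "('n::finite \<Rightarrow> nat) \<Rightarrow> real" where
  "mode_weight k = 1 + (\<Sum>i\<in>UNIV. (real (k i))\<^sup>2)"

text \<open>The eigenvalue of the negative Neumann Laplacian that belongs to
  \<open>cos_mode k\<close>.\<close>

definition mode_eigenvalue :: "('n::finite \<Rightarrow> nat) \<Rightarrow> real" where
  "mode_eigenvalue k = pi\<^sup>2 * (\<Sum>i\<in>UNIV. (real (k i))\<^sup>2)"

lemma mode_weight_ge_1: "1 \<le> mode_weight k"
  by (simp add: mode_weight_def sum_nonneg)

lemma mode_weight_pos: "0 < mode_weight k"
  using mode_weight_ge_1[of k] by linarith

lemma mode_weight_ge: "1 + (real (k i))\<^sup>2 \<le> mode_weight k"
  unfolding mode_weight_def using member_le_sum[of i UNIV "\<lambda>i. (real (k i))\<^sup>2"] by simp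

lemma mode_weight_le_eigenvalue:
  assumes "k \<noteq> (\<lambda>_. 0)" shows "mode_weight k \<le> mode_eigenvalue k"
proof -
  obtain i where "k i \<noteq> 0" using assms by blast
  then have "1 \<le> (real (k i))\<^sup>2" by simp
  also have "\<dots> \<le> (\<Sum>i\<in>UNIV. (real (k i))\<^sup>2)" by (rule member_le_sum) auto
  finally have 1: "1 \<le> (\<Sum>i\<in>UNIV. (real (k i))\<^sup>2)" .
  have "2 \<le> pi\<^sup>2" using mult_mono[of 2 pi 2 pi] pi_ge_two by (simp add: power2_eq_square)
  then have "2 * (\<Sum>i\<in>UNIV. (real (k i))\<^sup>2) \<le> pi\<^sup>2 * (\<Sum>i\<in>UNIV. (real (k i))\<^sup>2)"
    using 1 by (intro mult_right_mono) auto
  then show ?thesis using 1 unfolding mode_weight_def mode_eigenvalue_def by linarith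
qed

lemma sum_prod_modes_le:
  fixes f :: "nat \<Rightarrow> real" and K :: "('n::finite \<Rightarrow> nat) set"
  assumes f: "\<And>m. 0 \<le> f m" and c: "(\<Sum>m\<le>A. f m) \<le> c" and K: "\<And>k i. k \<in> K \<Longrightarrow> k i \<le> A"
  shows "(\<Sum>k\<in>K. \<Prod>i\<in>UNIV. f (k i)) \<le> c ^ CARD('n)"
proof -
  have "K \<subseteq> PiE UNIV (\<lambda>_. {..A})" using K by auto
  then have "(\<Sum>k\<in>K. \<Prod>i\<in>UNIV. f (k i)) \<le> (\<Sum>k\<in>PiE (UNIV :: 'n set) (\<lambda>_. {..A}). \<Prod>i\<in>UNIV. f (k i))"
    by (intro sum_mono2) (auto intro!: prod_nonneg f finite_PiE)
  also have "\<dots> = (\<Prod>i\<in>(UNIV::'n set). \<Sum>m\<le>A. f m)" by (rule prod_sum_PiE[symmetric]) auto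
  also have "\<dots> \<le> c ^ CARD('n)" using c by (simp add: power_mono sum_nonneg f)
  finally show ?thesis .
qed

lemma finite_modes_bounded:
  fixes K :: "('n::finite \<Rightarrow> nat) set"
  assumes "finite K" obtains A where "\<And>k i. k \<in> K \<Longrightarrow> k i \<le> A"
proof -
  have "finite (\<Union>k\<in>K. range k)" using assms by auto
  then have "k i \<le> Max (\<Union>k\<in>K. range k)" if "k \<in> K" for k i using that by (intro Max_ge) auto
  then show ?thesis by (rule that)
qed

lemma power_powr: "0 < (x::real) \<Longrightarrow> (x ^ n) powr s = x powr (real n * s)"
  by (metis powr_powr powr_realpow)

text \<open>Each factor is at most the weight and there are at most three of them. The majorant
  factorises, which turns sums over modes into powers of sums over naturals.\<close>

lemma prod_le_mode_weight:
  fixes k :: "'n::finite \<Rightarrow> nat"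
  assumes "CARD('n) \<le> 3" "0 \<le> s"
  shows "mode_weight k powr (- s) \<le> (\<Prod>i\<in>UNIV. (1 + (real (k i))\<^sup>2) powr (- s / 3))"
proof -
  have pos: "0 < 1 + (real (k i))\<^sup>2" for i by (simp add: add_pos_nonneg)
  have "(\<Prod>i\<in>UNIV. 1 + (real (k i))\<^sup>2) \<le> mode_weight k ^ 3"
    by (rule prod_le_power) (use assms(1) less_imp_le[OF pos] mode_weight_ge[of k] mode_weight_ge_1[of k] in blast)+
  then have "(mode_weight k ^ 3) powr (- s / 3) \<le> (\<Prod>i\<in>UNIV. 1 + (real (k i))\<^sup>2) powr (- s / 3)"
    using assms(2) pos by (intro powr_mono2') (auto intro!: prod_pos)
  also have "(mode_weight k ^ 3) powr (- s / 3) = mode_weight k powr (- s)"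
    using power_powr[OF mode_weight_pos[of k], of 3] by simp
  also have "(\<Prod>i\<in>UNIV. 1 + (real (k i))\<^sup>2) powr (- s / 3) = (\<Prod>i\<in>UNIV. (1 + (real (k i))\<^sup>2) powr (- s / 3))"
    by (rule prod_powr_distrib)
  finally show ?thesis .
qed

text \<open>Each of at most three coordinates receives a third of s, and the one-dimensional series
  of m powr (- 2 s / 3) converges exactly for s > 3/2. The bound for the factorised majorant is kept
  because the H^2 estimate uses it directly.\<close>

lemma sum_mode_weight_powr_bounded:
  assumes "CARD('n::finite) \<le> 3" "s > 3 / 2"
  obtains C where "C > 0" "\<And>K :: ('n \<Rightarrow> nat) set. finite K \<Longrightarrow> (\<Sum>k\<in>K. mode_weight k powr (- s)) \<le> C"
    "\<And>K :: ('n \<Rightarrow> nat) set. finite K \<Longrightarrow> (\<Sum>k\<in>K. \<Prod>i\<in>UNIV. (1 + (real (k i))\<^sup>2) powr (- s / 3)) \<le> C"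
proof -
  define f where "f m = (1 + (real m)\<^sup>2) powr (- s / 3)" for m :: nat
  have f0: "0 \<le> f m" for m by (simp add: f_def)
  have "summable f"
  proof (rule summable_comparison_test')
    show "summable (\<lambda>m. real m powr (- (2 * s / 3)))" using assms by (simp add: summable_real_powr_iff)
    show "norm (f m) \<le> real m powr (- (2 * s / 3))" if "1 \<le> m" for m
    proof -
      have "f m \<le> ((real m)\<^sup>2) powr (- s / 3)"
        unfolding f_def using that assms by (intro powr_mono2') auto
      also have "\<dots> = real m powr (- (2 * s / 3))"
        using power_powr[of "real m" 2] that by simp
      finally show ?thesis using f0 by simp
    qed
  qed
  then have b: "(\<Sum>m\<le>A. f m) \<le> suminf f" for A by (intro sum_le_suminf) (auto simp: f0)
  have P: "(\<Sum>k\<in>K. \<Prod>i\<in>UNIV. f (k i)) \<le> suminf f ^ CARD('n)" if "finite K" for K :: "('n \<Rightarrow> nat) set"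
  proof -
    obtain A where "\<And>k i. k \<in> K \<Longrightarrow> k i \<le> A" using finite_modes_bounded[OF \<open>finite K\<close>] by blast
    then show ?thesis by (intro sum_prod_modes_le[where A=A] f0 b) auto
  qed
  have "(\<Sum>k\<in>K. mode_weight k powr (- s)) \<le> suminf f ^ CARD('n)" if "finite K" for K :: "('n \<Rightarrow> nat) set"
  proof -
    have "(\<Sum>k\<in>K. mode_weight k powr (- s)) \<le> (\<Sum>k\<in>K. \<Prod>i\<in>UNIV. f (k i))"
      unfolding f_def using assms by (intro sum_mono prod_le_mode_weight) auto
    then show ?thesis using P[OF that] by linarith
  qed
  then show ?thesis using P by (intro that[of "suminf f ^ CARD('n) + 1"]) (fastforce simp: f_def add_nonneg_pos suminf_nonneg[OF \<open>summable f\<close> f0])+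
qed

text \<open>A discrete form of the integral of x powr (- 2/3): factoring a difference of cubes makes
  the sum of these powers telescope.\<close>

lemma powr_third_increment:
  fixes a b :: real assumes "0 \<le> a" "a \<le> b" "0 < b"
  shows "(b - a) * b powr (- (2 / 3)) \<le> 3 * (b powr (1 / 3) - a powr (1 / 3))"
proof -
  define \<alpha> \<beta> where "\<alpha> = a powr (1 / 3)" and "\<beta> = b powr (1 / 3)"
  have "(x powr (1 / 3)) ^ 3 = x" if "0 \<le> x" for x :: real using that by (cases "x = 0") (auto simp: powr_power)
  then have ab: "\<alpha> ^ 3 = a" "\<beta> ^ 3 = b" using assms by (auto simp: \<alpha>_def \<beta>_def)
  have le: "0 \<le> \<alpha>" "\<alpha> \<le> \<beta>" "0 < \<beta>" using assms by (auto simp: \<alpha>_def \<beta>_def intro!: powr_mono2)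
  have "b powr (- (2 / 3)) = 1 / \<beta>\<^sup>2" using assms by (simp add: \<beta>_def powr_power powr_minus_divide)
  moreover have "b - a = (\<beta> - \<alpha>) * (\<beta>\<^sup>2 + \<alpha> * \<beta> + \<alpha>\<^sup>2)"
    unfolding ab[symmetric] by (simp add: power2_eq_square power3_eq_cube algebra_simps)
  moreover have "(\<beta> - \<alpha>) * (\<beta>\<^sup>2 + \<alpha> * \<beta> + \<alpha>\<^sup>2) \<le> (\<beta> - \<alpha>) * (3 * \<beta>\<^sup>2)"
  proof (intro mult_left_mono)
    have "\<alpha> * \<beta> \<le> \<beta>\<^sup>2" "\<alpha>\<^sup>2 \<le> \<beta>\<^sup>2" using le by (auto simp: power2_eq_square intro!: mult_right_mono mult_mono)
    then show "\<beta>\<^sup>2 + \<alpha> * \<beta> + \<alpha>\<^sup>2 \<le> 3 * \<beta>\<^sup>2" by simp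
  qed (use le in simp)
  ultimately have "(b - a) * b powr (- (2 / 3)) \<le> (\<beta> - \<alpha>) * (3 * \<beta>\<^sup>2) * (1 / \<beta>\<^sup>2)"
    by (simp only:) (intro mult_right_mono, auto)
  also have "\<dots> = 3 * (\<beta> - \<alpha>)" using le by simp
  finally show ?thesis by (simp add: \<alpha>_def \<beta>_def)
qed

text \<open>In three dimensions the sum of 1/|k|^2 over frequencies up to A grows linearly in A, the
  borderline growth of the critical embedding. Each coordinate contributes 6 (A + 1) powr (1/3), and
  216 = 6^3.\<close>

lemma sum_inverse_mode_weight_le:
  fixes K :: "('n::finite \<Rightarrow> nat) set"
  assumes card: "CARD('n) \<le> 3" and K: "\<And>k i. k \<in> K \<Longrightarrow> k i \<le> A"
  shows "(\<Sum>k\<in>K. 1 / mode_weight k) \<le> 216 * (real A + 1)"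
proof -
  define f where "f m = (1 + (real m)\<^sup>2) powr (- (1 / 3))" for m :: nat
  have f: "(\<Sum>m\<le>A. f m) \<le> 6 * (real A + 1) powr (1 / 3)" for A
  proof (induction A)
    case 0
    show ?case by (simp add: f_def)
  next
    case (Suc A)
    define b where "b = real A + 2"
    have b: "b > 0" by (simp add: b_def)
    have "(1 + real (Suc A))\<^sup>2 / 4 \<le> 1 + (real (Suc A))\<^sup>2"
      using zero_le_power2[of "real (Suc A) - 1"] by (simp add: power2_eq_square algebra_simps)
    then have "f (Suc A) \<le> (b\<^sup>2 / 4) powr (- (1 / 3))" unfolding f_def
      by (intro powr_mono2') (use b in \<open>auto simp: b_def add.commute\<close>)
    also have "\<dots> = b powr (- (2 / 3)) * 4 powr (1 / 3)"
      using b power_powr[of b 2 "- (1 / 3)"] by (simp add: powr_divide powr_minus_divide)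
    also have "\<dots> \<le> b powr (- (2 / 3)) * 2"
    proof (intro mult_left_mono)
      have "(4::real) powr (1 / 3) \<le> 8 powr (1 / 3)" by (intro powr_mono2) auto
      also have "(8::real) powr (1 / 3) = 2" using power_powr[of 2 3 "1/3"] by simp
      finally show "(4::real) powr (1 / 3) \<le> 2" .
    qed simp
    also have "\<dots> \<le> 6 * (b powr (1 / 3) - (b - 1) powr (1 / 3))"
      using powr_third_increment[of "b - 1" b] by (simp add: b_def)
    finally have "f (Suc A) \<le> 6 * (b powr (1 / 3) - (b - 1) powr (1 / 3))" .
    moreover have "b = real (Suc A) + 1" "b - 1 = real A + 1" by (simp_all add: b_def)
    ultimately show ?case using Suc by (simp add: add.commute)
  qed
  have "(\<Sum>k\<in>K. 1 / mode_weight k) \<le> (\<Sum>k\<in>K. \<Prod>i\<in>UNIV. f (k i))"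
  proof (intro sum_mono)
    fix k :: "'n \<Rightarrow> nat"
    have "1 / mode_weight k = mode_weight k powr (- 1)" using mode_weight_pos[of k] by (simp add: powr_minus_divide)
    then show "1 / mode_weight k \<le> (\<Prod>i\<in>UNIV. f (k i))"
      using prod_le_mode_weight[of 1 k] card by (simp add: f_def)
  qed
  also have "\<dots> \<le> (6 * (real A + 1) powr (1 / 3)) ^ CARD('n)"
  proof (rule sum_prod_modes_le)
    show "0 \<le> f m" for m by (simp add: f_def)
    show "(\<Sum>m\<le>A. f m) \<le> 6 * (real A + 1) powr (1 / 3)" by (rule f)
  qed (rule K)
  also have "\<dots> \<le> (6 * (real A + 1) powr (1 / 3)) ^ 3"
    using card ge_one_powr_ge_zero[of "real A + 1" "1/3"] by (intro power_increasing) auto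
  also have "\<dots> = 216 * (real A + 1)" by (simp add: power_mult_distrib powr_power)
  finally show ?thesis .
qed

lemma cos_sum_abs_le:
  fixes u :: "real^'n::finite \<Rightarrow> real"
  shows "\<bar>cos_sum K u x\<bar> \<le> 2 ^ CARD('n) * (\<Sum>k\<in>K. \<bar>cosine_coeff u k\<bar>)"
proof -
  have "\<bar>cosine_coeff u k / L2_inner (cos_mode k) (cos_mode k) * cos_mode k x\<bar> \<le> 2 ^ CARD('n) * \<bar>cosine_coeff u k\<bar>" for k
  proof -
    have "\<bar>cosine_coeff u k / L2_inner (cos_mode k) (cos_mode k)\<bar> \<le> \<bar>cosine_coeff u k\<bar> / (1 / 2) ^ CARD('n)"
      using cos_mode_norm_ge[of k] cos_mode_norm_pos[of k] by (simp add: abs_divide frac_le)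
    moreover have "\<bar>cosine_coeff u k / L2_inner (cos_mode k) (cos_mode k) * cos_mode k x\<bar> \<le> \<bar>cosine_coeff u k / L2_inner (cos_mode k) (cos_mode k)\<bar>"
      unfolding abs_mult[of "_ / _"] by (intro mult_left_le abs_trig_mode_le) auto
    ultimately show ?thesis by (simp add: power_one_over field_simps)
  qed
  then show ?thesis unfolding cos_sum_def sum_distrib_left by (intro order_trans[OF sum_abs] sum_mono)
qed

text \<open>Partial sums are bounded by D everywhere but are only known to converge in L^2. The
  excess of |u| over D is at most the distance to any partial sum, so its square has integral 0; no
  convergence of the series in the supremum norm has to be identified.\<close>

lemma Linf_norm_le_cos_coeff:
  fixes u :: "real^'n::finite \<Rightarrow> real"
  assumes u: "u \<in> L2_space" and B: "\<And>K. finite K \<Longrightarrow> (\<Sum>k\<in>K. \<bar>cosine_coeff u k\<bar>) \<le> B"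
  shows "Linf_norm u \<le> ennreal (2 ^ CARD('n) * B)"
proof -
  define D where "D = 2 ^ CARD('n) * B"
  define g where "g x = (max 0 (\<bar>u x\<bar> - D))\<^sup>2" for x
  have [measurable]: "u \<in> borel_measurable cube_measure" by (rule L2_measurable[OF u])
  have B0: "0 \<le> B" using B[of "{}"] by simp
  have D0: "0 \<le> D" unfolding D_def using B0 by simp
  have gi: "integrable cube_measure g"
  proof (rule Bochner_Integration.integrable_bound[OF L2_square_integrable[OF u]])
    have "norm (g x) \<le> norm ((u x)\<^sup>2)" for x
    proof -
      have "\<bar>max 0 (\<bar>u x\<bar> - D)\<bar> \<le> \<bar>u x\<bar>" using D0 by linarith
      then have "(max 0 (\<bar>u x\<bar> - D))\<^sup>2 \<le> (u x)\<^sup>2" by (rule abs_le_square_iff[THEN iffD1])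
      then show ?thesis unfolding g_def real_norm_def abs_power2 .
    qed
    then show "AE x in cube_measure. norm (g x) \<le> norm ((u x)\<^sup>2)" by (intro AE_I2)
    show "g \<in> borel_measurable cube_measure" unfolding g_def[abs_def] by measurable
  qed
  have "(LINT x|cube_measure. g x) \<le> \<delta>" if \<delta>: "\<delta> > 0" for \<delta>
  proof -
    obtain K where K: "finite K" "\<And>K'. finite K' \<Longrightarrow> K \<subseteq> K' \<Longrightarrow> L2_dist2 u (cos_sum K' u) < \<delta>"
      using cos_sum_approximates[OF u \<delta>] by metis
    have "(LINT x|cube_measure. g x) \<le> (LINT x|cube_measure. (u x - cos_sum K u x)\<^sup>2)"
    proof (rule integral_mono[OF gi L2_square_integrable[OF L2_diff[OF u cos_sum_L2]]])
      fix x
      have "2 ^ CARD('n) * (\<Sum>k\<in>K. \<bar>cosine_coeff u k\<bar>) \<le> D" unfolding D_def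
        by (intro mult_left_mono B K(1)) simp
      then have "\<bar>cos_sum K u x\<bar> \<le> D" using cos_sum_abs_le[of K u x] by linarith
      then have "\<bar>max 0 (\<bar>u x\<bar> - D)\<bar> \<le> \<bar>u x - cos_sum K u x\<bar>" by linarith
      then show "g x \<le> (u x - cos_sum K u x)\<^sup>2" unfolding g_def by (rule abs_le_square_iff[THEN iffD1])
    qed
    also have "\<dots> < \<delta>" using K(2)[OF K(1) order_refl] by (simp add: L2_dist2_def)
    finally show ?thesis by simp
  qed
  then have "(LINT x|cube_measure. g x) \<le> 0" by (rule field_le_epsilon[of _ 0, simplified])
  moreover have "0 \<le> (LINT x|cube_measure. g x)" by (intro Bochner_Integration.integral_nonneg) (simp add: g_def)
  ultimately have "(LINT x|cube_measure. g x) = 0" by linarith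
  moreover have "AE x in cube_measure. 0 \<le> g x" by (simp add: g_def)
  ultimately have "AE x in cube_measure. g x = 0"
    using integral_nonneg_eq_0_iff_AE[OF gi] by blast
  then have "AE x in cube_measure. ennreal \<bar>u x\<bar> \<le> ennreal D"
    by eventually_elim (auto simp: g_def intro!: ennreal_leI)
  then show ?thesis unfolding Linf_norm_def D_def[symmetric] by (intro esssup_I) auto
qed

section \<open>Weak derivatives on the side of the coefficients\<close>

lemma tensor_trig_deriv:
  assumes "i \<in> S"
  shows "tensor ((\<lambda>j t. if j \<in> S then sin (pi * real (k j) * t) else cos (pi * real (k j) * t))
      (i := deriv (\<lambda>t. if i \<in> S then sin (pi * real (k i) * t) else cos (pi * real (k i) * t))))
    = (\<lambda>x. pi * real (k i) * trig_mode (S - {i}) k x)"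
proof
  fix x
  have "((\<lambda>t. sin (pi * real (k i) * t)) has_real_derivative pi * real (k i) * cos (pi * real (k i) * t)) (at t)" for t
    by (auto intro!: derivative_eq_intros)
  then have d: "deriv (\<lambda>t. sin (pi * real (k i) * t)) = (\<lambda>t. pi * real (k i) * cos (pi * real (k i) * t))"
    by (intro ext DERIV_imp_deriv)
  show "tensor ((\<lambda>j t. if j \<in> S then sin (pi * real (k j) * t) else cos (pi * real (k j) * t))
      (i := deriv (\<lambda>t. if i \<in> S then sin (pi * real (k i) * t) else cos (pi * real (k i) * t)))) x
    = pi * real (k i) * trig_mode (S - {i}) k x"
  proof -
    have "(\<Prod>j\<in>UNIV - {i}. if j \<in> S - {i} then sin (pi * real (k j) * x $ j) else cos (pi * real (k j) * x $ j)) =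
      (\<Prod>j\<in>UNIV - {i}. if j \<in> S then sin (pi * real (k j) * x $ j) else cos (pi * real (k j) * x $ j))"
      by (intro prod.cong) auto
    then show ?thesis unfolding tensor_upd unfolding trig_mode_def tensor_remove[of _ x i]
      by (simp only: d assms if_True if_False Diff_iff singletonI simp_thms)
  qed
qed

text \<open>In direction i the mode is a sine and vanishes on the two faces, so the derivative can
  be moved to the mode whatever the boundary values of u are.\<close>

lemma weak_deriv_trig_coeff:
  assumes "u \<in> L2_space" "v \<in> L2_space" "has_weak_deriv i u v" "i \<in> S"
  shows "L2_inner v (trig_mode S k) = - (pi * real (k i) * L2_inner u (trig_mode (S - {i}) k))"
proof -
  let ?g = "\<lambda>j t. if j \<in> S then sin (pi * real (k j) * t) else cos (pi * real (k j) * t)"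
  have "L2_inner v (tensor ?g) = - L2_inner u (tensor (?g(i := deriv (?g i))))"
    by (rule weak_deriv_tensor_parts[OF assms(1-3)])
       (rule smooth_trig_factor, use \<open>i \<in> S\<close> in \<open>auto simp: mult.commute[of pi]\<close>)
  also have "\<dots> = - L2_inner u (\<lambda>x. pi * real (k i) * trig_mode (S - {i}) k x)"
    using tensor_trig_deriv[OF \<open>i \<in> S\<close>] by simp
  finally show ?thesis by (simp add: trig_mode_def[of S] L2_inner_cmult_right)
qed

lemma H1_L2: "u \<in> H1_space \<Longrightarrow> u \<in> L2_space"
  by (simp add: H1_space_def)

lemma cos_mode_H1: "cos_mode k \<in> H1_space"
  unfolding trig_mode_def by (rule tensor_H1) (rule smooth_trig_factor)

lemma weak_deriv_cos_mode:
  "AE x in cube_measure. weak_deriv i (cos_mode k) x = - (pi * real (k i)) * trig_mode {i} k x"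
proof -
  let ?g = "\<lambda>j t. if j \<in> {} then sin (pi * real (k j) * t) else cos (pi * real (k j) * t)"
  have "AE x in cube_measure. weak_deriv i (tensor ?g) x = tensor (?g(i := deriv (?g i))) x"
    by (rule weak_deriv_tensor) (rule smooth_trig_factor)
  moreover have "tensor (?g(i := deriv (?g i))) x = - (pi * real (k i)) * trig_mode {i} k x" for x
  proof -
    have "((\<lambda>t. cos (pi * real (k i) * t)) has_real_derivative - (pi * real (k i)) * sin (pi * real (k i) * t)) (at t)" for t
      by (auto intro!: derivative_eq_intros)
    then have d: "deriv (\<lambda>t. cos (pi * real (k i) * t)) = (\<lambda>t. - (pi * real (k i)) * sin (pi * real (k i) * t))"
      by (intro ext DERIV_imp_deriv)
    have "(\<Prod>j\<in>UNIV - {i}. if j \<in> {i} then sin (pi * real (k j) * x $ j) else cos (pi * real (k j) * x $ j)) =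
      (\<Prod>j\<in>UNIV - {i}. if j \<in> {} then sin (pi * real (k j) * x $ j) else cos (pi * real (k j) * x $ j))"
      by (intro prod.cong) auto
    then show ?thesis unfolding tensor_upd unfolding trig_mode_def tensor_remove[of _ x i]
      by (simp only: d if_True if_False empty_iff singletonI)
  qed
  ultimately show ?thesis by (simp add: trig_mode_def[of "{}"])
qed

lemma L2_inner_vec_weak_grad:
  assumes "u \<in> H1_space" "v \<in> H1_space"
  shows "L2_inner_vec (weak_grad u) (weak_grad v) = (\<Sum>i\<in>UNIV. L2_inner (weak_deriv i u) (weak_deriv i v))"
  unfolding L2_inner_vec_def weak_grad_def L2_inner_def inner_vec_def
  using assms by (simp add: Bochner_Integration.integral_sum L2_mult_integrable weak_deriv_L2)

text \<open>The derivative of the cosine mode is a sine in that direction, and moving the remaining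
  derivative off u turns it back into the cosine mode; each move contributes a factor pi
  k_i.\<close>

lemma weak_grad_cos_mode:
  assumes u: "u \<in> H1_space"
  shows "L2_inner_vec (weak_grad u) (weak_grad (cos_mode k)) = mode_eigenvalue k * cosine_coeff u k"
proof -
  have "L2_inner (weak_deriv i u) (weak_deriv i (cos_mode k)) = pi\<^sup>2 * (real (k i))\<^sup>2 * cosine_coeff u k" for i
  proof -
    have "L2_inner (weak_deriv i u) (weak_deriv i (cos_mode k)) = L2_inner (weak_deriv i u) (\<lambda>x. - (pi * real (k i)) * trig_mode {i} k x)"
      unfolding L2_inner_commute[of "weak_deriv i u"]
      by (intro L2_inner_AE_cong weak_deriv_cos_mode L2_measurable L2_cmult trig_mode_L2 weak_deriv_L2 u cos_mode_H1)
    also have "\<dots> = - (pi * real (k i)) * L2_inner (weak_deriv i u) (trig_mode {i} k)" by (rule L2_inner_cmult_right)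
    also have "L2_inner (weak_deriv i u) (trig_mode {i} k) = - (pi * real (k i) * L2_inner u (trig_mode ({i} - {i}) k))"
      by (intro weak_deriv_trig_coeff H1_L2 weak_deriv_L2 u) simp
    finally show ?thesis by (simp add: cosine_coeff_def power2_eq_square)
  qed
  then show ?thesis unfolding L2_inner_vec_weak_grad[OF u cos_mode_H1]
    by (simp add: mode_eigenvalue_def sum_distrib_left sum_distrib_right)
qed

text \<open>For each i the modes \<open>trig_mode {i}\<close> are an orthogonal family of their own,
  so Bessel applies to each partial derivative separately.\<close>

lemma cos_coeff_H1_le:
  assumes u: "u \<in> H1_space" and K: "finite K"
  shows "(\<Sum>k\<in>K. mode_weight k * (cosine_coeff u k)\<^sup>2) \<le> L2_inner u u + L2_inner_vec (weak_grad u) (weak_grad u)"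
proof -
  have g: "(\<Sum>k\<in>K. (real (k i))\<^sup>2 * (cosine_coeff u k)\<^sup>2) \<le> L2_inner (weak_deriv i u) (weak_deriv i u)" for i
  proof -
    have "(real (k i))\<^sup>2 * (cosine_coeff u k)\<^sup>2 \<le> (L2_inner (weak_deriv i u) (trig_mode {i} k))\<^sup>2" for k
    proof -
      have "L2_inner (weak_deriv i u) (trig_mode {i} k) = - (pi * real (k i) * L2_inner u (trig_mode ({i} - {i}) k))"
        by (intro weak_deriv_trig_coeff H1_L2 weak_deriv_L2 u) simp
      then have "(L2_inner (weak_deriv i u) (trig_mode {i} k))\<^sup>2 = pi\<^sup>2 * ((real (k i))\<^sup>2 * (cosine_coeff u k)\<^sup>2)"
        by (simp add: cosine_coeff_def power_mult_distrib)
      moreover have "1 \<le> pi\<^sup>2" using pi_ge_two by (simp add: one_le_power)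
      ultimately show ?thesis using mult_right_mono[of 1 "pi\<^sup>2" "(real (k i))\<^sup>2 * (cosine_coeff u k)\<^sup>2"] by simp
    qed
    then have "(\<Sum>k\<in>K. (real (k i))\<^sup>2 * (cosine_coeff u k)\<^sup>2) \<le> (\<Sum>k\<in>K. (L2_inner (weak_deriv i u) (trig_mode {i} k))\<^sup>2)"
      by (rule sum_mono)
    also have "\<dots> \<le> L2_inner (weak_deriv i u) (weak_deriv i u)" by (intro Bessel_trig weak_deriv_L2 u K)
    finally show ?thesis .
  qed
  have "(\<Sum>k\<in>K. mode_weight k * (cosine_coeff u k)\<^sup>2) = (\<Sum>k\<in>K. (cosine_coeff u k)\<^sup>2) + (\<Sum>i\<in>UNIV. \<Sum>k\<in>K. (real (k i))\<^sup>2 * (cosine_coeff u k)\<^sup>2)"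
    unfolding mode_weight_def by (subst sum.swap) (simp add: distrib_right sum.distrib sum_distrib_right)
  also have "\<dots> \<le> L2_inner u u + (\<Sum>i\<in>UNIV. L2_inner (weak_deriv i u) (weak_deriv i u))"
    unfolding cosine_coeff_def using g by (intro add_mono sum_mono Bessel_trig K H1_L2 u) (simp add: cosine_coeff_def)
  finally show ?thesis by (simp add: L2_inner_vec_weak_grad u)
qed

section \<open>The critical Sobolev embedding\<close>

lemma sum_abs_weighted_le:
  fixes w x :: "'a \<Rightarrow> real"
  assumes "\<And>k. k \<in> K \<Longrightarrow> 0 < w k"
  shows "(\<Sum>k\<in>K. \<bar>x k\<bar>)\<^sup>2 \<le> (\<Sum>k\<in>K. 1 / w k) * (\<Sum>k\<in>K. w k * (x k)\<^sup>2)"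
proof -
  have "(\<Sum>k\<in>K. \<bar>x k\<bar>) = (\<Sum>k\<in>K. sqrt (1 / w k) * (sqrt (w k) * \<bar>x k\<bar>))"
    using assms by (intro sum.cong refl) (force simp: real_sqrt_divide)
  then have "(\<Sum>k\<in>K. \<bar>x k\<bar>)\<^sup>2 \<le> (\<Sum>k\<in>K. (sqrt (1 / w k))\<^sup>2) * (\<Sum>k\<in>K. (sqrt (w k) * \<bar>x k\<bar>)\<^sup>2)"
    using Cauchy_Schwarz_ineq_sum by metis
  also have "\<dots> = (\<Sum>k\<in>K. 1 / w k) * (\<Sum>k\<in>K. w k * (x k)\<^sup>2)"
    using assms by (intro arg_cong2[where f="(*)"] sum.cong refl) (auto simp: power_mult_distrib less_imp_le)
  finally show ?thesis .
qed

text \<open>A discrete layer-cake formula, used with z the square of the function. The cube of z is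
  reached by summing the increments of the cubed thresholds below z, and at each such threshold the
  high part h satisfies 1 <= 4 h / L, as in Chebyshev's inequality. Only finitely many thresholds
  occur, hence no measurability of level sets is involved.\<close>

lemma sixth_power_telescope:
  fixes L :: "nat \<Rightarrow> real"
  assumes L: "\<And>A. 0 < L A" "\<And>A. L A \<le> L (Suc A)" 
    and high: "\<And>A. L A < z \<Longrightarrow> L A \<le> 4 * h A" and h: "\<And>A. 0 \<le> h A" and z: "0 \<le> z" "z \<le> L N"
  shows "z ^ 3 \<le> L 0 ^ 3 + (\<Sum>A<N. (L (Suc A) ^ 3 - L A ^ 3) * (4 / L A * h A))"
  using z(2)
proof (induction N)
  case 0
  then show ?case using z by (simp add: power_mono)
next
  case (Suc N)
  have inc: "0 \<le> L (Suc A) ^ 3 - L A ^ 3" for A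
    using L[of A] by (simp add: power_mono less_imp_le)
  show ?case
  proof (cases "z \<le> L N")
    case True
    have "0 \<le> (L (Suc N) ^ 3 - L N ^ 3) * (4 / L N * h N)"
      using inc[of N] h[of N] L(1)[of N] by (intro mult_nonneg_nonneg) (auto simp: less_imp_le)
    then show ?thesis using Suc.IH[OF True] by simp
  next
    case False
    have mono: "L A \<le> L N" if "A \<le> N" for A using that L(2) by (rule lift_Suc_mono_le[rotated])
    have "L 0 ^ 3 + (\<Sum>A<Suc N. (L (Suc A) ^ 3 - L A ^ 3) * (4 / L A * h A)) \<ge> L 0 ^ 3 + (\<Sum>A<Suc N. (L (Suc A) ^ 3 - L A ^ 3) * 1)"
    proof (intro add_left_mono sum_mono mult_left_mono inc)
      fix A assume "A \<in> {..<Suc N}"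
      then have "L A < z" using mono[of A] False by simp
      from high[OF this] L(1)[of A] show "1 \<le> 4 / L A * h A" by (simp add: field_simps)
    qed
    moreover have "L 0 ^ 3 + (\<Sum>A<Suc N. (L (Suc A) ^ 3 - L A ^ 3) * 1) = L (Suc N) ^ 3"
      using sum_lessThan_telescope[of "\<lambda>n. L n ^ 3" "Suc N"] by simp
    moreover have "z ^ 3 \<le> L (Suc N) ^ 3" using Suc.prems z by (intro power_mono)
    ultimately show ?thesis by linarith
  qed
qed

lemma L2_norm_cos_expansion_le:
  assumes "finite K"
  shows "(LINT x|cube_measure. (\<Sum>k\<in>K. c k * cos_mode k x)\<^sup>2) \<le> (\<Sum>k\<in>K. (c k)\<^sup>2)"
proof -
  let ?v = "\<lambda>x. \<Sum>k\<in>K. c k * cos_mode k x"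
  have vL: "?v \<in> L2_space" by (intro L2_sum L2_cmult trig_mode_L2)
  have "L2_inner ?v ?v = (\<Sum>k\<in>K. c k * L2_inner (cos_mode k) ?v)"
    by (subst L2_inner_sum_left) (auto intro!: L2_cmult trig_mode_L2 vL simp: L2_inner_cmult_left)
  also have "\<dots> = (\<Sum>k\<in>K. (c k)\<^sup>2 * L2_inner (cos_mode k) (cos_mode k))"
    using assms by (intro sum.cong refl) (simp add: L2_inner_commute[of "cos_mode _" ?v] L2_inner_cos_expansion power2_eq_square)
  also have "\<dots> \<le> (\<Sum>k\<in>K. (c k)\<^sup>2)" by (intro sum_mono mult_left_le trig_mode_norm_le) simp
  finally show ?thesis by (simp add: L2_inner_def power2_eq_square)
qed

text \<open>The low modes are bounded uniformly and the high modes are small in \<open>L\<^sup>2\<close>; the frequency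
  at which the sum is split depends on the level set under consideration
  (the argument of Chemin and Xu for the critical Sobolev embedding).\<close>

lemma sixth_power_cos_expansion_le:
  fixes c :: "('n::finite \<Rightarrow> nat) \<Rightarrow> real"
  assumes card: "CARD('n) \<le> 3" and K: "finite K" and G: "G > 0"
    and c: "(\<Sum>k\<in>K. mode_weight k * (c k)\<^sup>2) \<le> G"
  shows "(LINT x|cube_measure. (\<Sum>k\<in>K. c k * cos_mode k x) ^ 6) \<le> 10 ^ 11 * G ^ 3"
proof -
  define v where "v x = (\<Sum>k\<in>K. c k * cos_mode k x)" for x
  \<comment> \<open>Modes are ordered by their largest frequency, so that the low modes lie in a box
    and \<open>sum_inverse_mode_weight_le\<close> applies to them.\<close>
  define q where "q k = Max (range k)" for k :: "'n \<Rightarrow> nat"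
  have q: "k i \<le> q k" for k i by (simp add: q_def)
  have q2: "(real (q k))\<^sup>2 \<le> mode_weight k" for k
  proof -
    have "q k \<in> range k" unfolding q_def by (intro Max_in) auto
    then obtain i where "q k = k i" by auto
    then show ?thesis using mode_weight_ge[of k i] by simp
  qed
  \<comment> \<open>864 = 4 * 216: by Cauchy-Schwarz the square of the low part is at most 216 (A +
    1) G, a quarter of the threshold. Above the threshold at least half of the value must then come
    from the high part.\<close>
  define L where "L A = 864 * (real A + 1) * G" for A :: nat
  define lo where "lo A x = (\<Sum>k\<in>{k\<in>K. q k \<le> A}. c k * cos_mode k x)" for A x
  define hi where "hi A x = (\<Sum>k\<in>{k\<in>K. A < q k}. c k * cos_mode k x)" for A x
  have split: "v x = lo A x + hi A x" for A x
    unfolding v_def lo_def hi_def using K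
    by (subst sum.union_disjoint[symmetric]) (auto intro!: sum.cong)
  have L0: "0 < L A" for A using G by (simp add: L_def)
  have lo: "4 * (lo A x)\<^sup>2 \<le> L A" for A x
  proof -
    have "\<bar>lo A x\<bar> \<le> (\<Sum>k\<in>{k\<in>K. q k \<le> A}. \<bar>c k\<bar>)" unfolding lo_def
      by (intro order_trans[OF sum_abs] sum_mono) (auto simp: abs_mult intro!: mult_left_le abs_trig_mode_le)
    then have "(lo A x)\<^sup>2 \<le> (\<Sum>k\<in>{k\<in>K. q k \<le> A}. \<bar>c k\<bar>)\<^sup>2" by (simp add: abs_le_square_iff[symmetric])
    also have "\<dots> \<le> (\<Sum>k\<in>{k\<in>K. q k \<le> A}. 1 / mode_weight k) * (\<Sum>k\<in>{k\<in>K. q k \<le> A}. mode_weight k * (c k)\<^sup>2)"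
      by (rule sum_abs_weighted_le[OF mode_weight_pos])
    also have "\<dots> \<le> (216 * (real A + 1)) * G"
    proof (rule mult_mono)
      show "(\<Sum>k\<in>{k\<in>K. q k \<le> A}. 1 / mode_weight k) \<le> 216 * (real A + 1)"
        by (rule sum_inverse_mode_weight_le[OF card]) (use q order_trans in blast)
      have "(\<Sum>k\<in>{k\<in>K. q k \<le> A}. mode_weight k * (c k)\<^sup>2) \<le> (\<Sum>k\<in>K. mode_weight k * (c k)\<^sup>2)"
        using K by (intro sum_mono2) (auto intro!: mult_nonneg_nonneg simp: less_imp_le[OF mode_weight_pos])
      then show "(\<Sum>k\<in>{k\<in>K. q k \<le> A}. mode_weight k * (c k)\<^sup>2) \<le> G" using c by linarith
    qed (auto intro!: sum_nonneg mult_nonneg_nonneg simp: less_imp_le[OF mode_weight_pos])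
    finally show ?thesis by (simp add: L_def algebra_simps)
  qed
  obtain N where N: "(v x)\<^sup>2 \<le> L N" for x
  proof -
    obtain N where N: "\<And>k i. k \<in> K \<Longrightarrow> k i \<le> N" using finite_modes_bounded[OF K] by metis
    have "q k \<le> N" if "k \<in> K" for k using N[OF that] by (simp add: q_def)
    then have "{k\<in>K. q k \<le> N} = K" by auto
    then have "v x = lo N x" for x by (simp add: v_def lo_def)
    moreover have "(lo N x)\<^sup>2 \<le> L N" for x using lo[of N x] zero_le_power2[of "lo N x"] by linarith
    ultimately show ?thesis using that by metis
  qed
  have pw: "v x ^ 6 \<le> L 0 ^ 3 + (\<Sum>A<N. (L (Suc A) ^ 3 - L A ^ 3) * (4 / L A * (hi A x)\<^sup>2))" for x
  proof -
    have "((v x)\<^sup>2) ^ 3 \<le> L 0 ^ 3 + (\<Sum>A<N. (L (Suc A) ^ 3 - L A ^ 3) * (4 / L A * (hi A x)\<^sup>2))"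
    proof (rule sixth_power_telescope[OF L0])
      show "L A \<le> L (Suc A)" for A using G by (simp add: L_def)
      show "L A \<le> 4 * (hi A x)\<^sup>2" if "L A < (v x)\<^sup>2" for A
      proof -
        have "(2 * lo A x)\<^sup>2 < (v x)\<^sup>2" using that lo[of A x] by (simp add: power_mult_distrib)
        then have "2 * \<bar>lo A x\<bar> < \<bar>v x\<bar>" using abs_le_square_iff[of "v x" "2 * lo A x"] by (simp add: abs_mult not_le[symmetric])
        then have "\<bar>v x\<bar> \<le> \<bar>2 * hi A x\<bar>" using split[of x A] by linarith
        then have "(v x)\<^sup>2 \<le> (2 * hi A x)\<^sup>2" by (simp only: abs_le_square_iff)
        then show ?thesis using that by (simp add: power_mult_distrib)
      qed
    qed (use N in auto)
    then show ?thesis by (simp flip: power_mult)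
  qed
  have cv: "continuous_on unit_cube v" "continuous_on unit_cube (hi A)" for A
    unfolding v_def[abs_def] hi_def[abs_def] by (intro continuous_on_sum continuous_on_mult continuous_on_const continuous_trig_mode)+
  interpret prob_space "cube_measure :: (real^'n) measure" by (rule prob_space_cube)
  \<comment> \<open>The increment of the cube of m = A + 1 is at most 7 m^2; multiplied by 4 and
    divided by one factor 864 m G this leaves 28 * 864^2 G^2 m, which is linear in m.\<close>
  have w: "(L (Suc A) ^ 3 - L A ^ 3) * (4 / L A) \<le> 28 * 864\<^sup>2 * G\<^sup>2 * (real A + 1)" (is "?w A \<le> ?b A") for A
  proof -
    define m where "m = real A + 1"
    have m: "m \<ge> 1" by (simp add: m_def)
    have e: "L A = 864 * m * G" "L (Suc A) = 864 * (m + 1) * G" by (simp_all add: L_def m_def algebra_simps)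
    have "?w A = 4 * (864 * G)\<^sup>2 * (((m + 1) ^ 3 - m ^ 3) / m)"
      unfolding e using m G by (simp add: field_simps power2_eq_square power3_eq_cube)
    also have "(m + 1) ^ 3 - m ^ 3 \<le> 7 * m\<^sup>2"
    proof -
      have "(m + 1) ^ 3 - m ^ 3 = 3 * m\<^sup>2 + 3 * m + 1" by (simp add: power3_eq_cube power2_eq_square algebra_simps)
      moreover have "m \<le> m\<^sup>2" "1 \<le> m\<^sup>2" using m by (auto simp: power2_eq_square mult_ge1_I intro: mult_le_cancel_left1[THEN iffD2])
      ultimately show ?thesis by linarith
    qed
    finally have "?w A \<le> 4 * (864 * G)\<^sup>2 * (7 * m\<^sup>2 / m)" using m by (simp add: divide_right_mono mult_left_mono)
    also have "\<dots> = ?b A" using m by (simp add: m_def[symmetric] power2_eq_square)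
    finally show ?thesis .
  qed
  have w0: "0 \<le> ?w A" for A using L0[of A] G by (intro mult_nonneg_nonneg) (auto simp: L_def power_mono intro!: mult_mono)
  have "(LINT x|cube_measure. v x ^ 6) \<le> (LINT x|cube_measure. L 0 ^ 3 + (\<Sum>A<N. (L (Suc A) ^ 3 - L A ^ 3) * (4 / L A * (hi A x)\<^sup>2)))"
    by (intro integral_mono pw continuous_cube_integrable continuous_intros cv)
  also have "\<dots> = L 0 ^ 3 + (\<Sum>A<N. ?w A * (LINT x|cube_measure. (hi A x)\<^sup>2))"
  proof -
    have i: "integrable cube_measure (\<lambda>x. (L (Suc A) ^ 3 - L A ^ 3) * (4 / L A * (hi A x)\<^sup>2))" for A
      by (intro continuous_cube_integrable continuous_intros cv)
    have s: "integrable cube_measure (\<lambda>x. \<Sum>A<N. (L (Suc A) ^ 3 - L A ^ 3) * (4 / L A * (hi A x)\<^sup>2))"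
      by (intro Bochner_Integration.integrable_sum i)
    have p: "(LINT x|(cube_measure :: (real^'n) measure). L 0 ^ 3) = L 0 ^ 3" using prob_space by simp
    have "(LINT x|cube_measure. (\<Sum>A<N. (L (Suc A) ^ 3 - L A ^ 3) * (4 / L A * (hi A x)\<^sup>2))) = (\<Sum>A<N. ?w A * (LINT x|cube_measure. (hi A x)\<^sup>2))"
      unfolding Bochner_Integration.integral_sum[OF i] by (simp only: integral_mult_right_zero mult.assoc)
    then show ?thesis
      by (subst Bochner_Integration.integral_add[OF _ s]) (simp_all only: p, simp)
  qed
  also have "(\<Sum>A<N. ?w A * (LINT x|cube_measure. (hi A x)\<^sup>2)) \<le> (\<Sum>A<N. ?b A * (\<Sum>k\<in>{k\<in>K. A < q k}. (c k)\<^sup>2))"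
    unfolding hi_def using K
    by (intro sum_mono mult_mono w L2_norm_cos_expansion_le w0) (auto intro!: Bochner_Integration.integral_nonneg G mult_nonneg_nonneg less_imp_le[OF G])
  \<comment> \<open>After exchanging the sums, a mode k is counted for the thresholds A < q k only.
    The linear weights sum to at most (q k)^2, hence to \<open>mode_weight k\<close>, and the H^1
    sum reappears.\<close>
  also have "\<dots> = (\<Sum>k\<in>K. (c k)\<^sup>2 * (\<Sum>A\<in>{A\<in>{..<N}. A < q k}. ?b A))"
    unfolding sum_distrib_left sum_distrib_right using K
    by (subst sum.swap_restrict) (auto intro!: sum.cong simp: mult_ac)
  also have "\<dots> \<le> (\<Sum>k\<in>K. (c k)\<^sup>2 * (28 * 864\<^sup>2 * G\<^sup>2 * mode_weight k))"
  proof (intro sum_mono mult_left_mono)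
    fix k :: "'n \<Rightarrow> nat"
    have g: "(\<Sum>A<m. real A + 1) \<le> (real m)\<^sup>2" for m by (induction m) (auto simp: power2_eq_square algebra_simps)
    have "(\<Sum>A\<in>{A\<in>{..<N}. A < q k}. real A + 1) \<le> (\<Sum>A<q k. real A + 1)" by (intro sum_mono2) auto
    also have "\<dots> \<le> mode_weight k" using g[of "q k"] q2[of k] by linarith
    finally show "(\<Sum>A\<in>{A\<in>{..<N}. A < q k}. ?b A) \<le> 28 * 864\<^sup>2 * G\<^sup>2 * mode_weight k"
      unfolding sum_distrib_left[symmetric] by (intro mult_left_mono) auto
  qed simp
  also have "\<dots> = 28 * 864\<^sup>2 * G\<^sup>2 * (\<Sum>k\<in>K. mode_weight k * (c k)\<^sup>2)"
    unfolding sum_distrib_left by (intro sum.cong refl) (simp add: mult_ac)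
  also have "\<dots> \<le> 28 * 864\<^sup>2 * G\<^sup>2 * G" using c by (intro mult_left_mono) auto
  finally have "(LINT x|cube_measure. v x ^ 6) \<le> L 0 ^ 3 + 28 * 864\<^sup>2 * G\<^sup>2 * G" by simp
  also have "\<dots> \<le> 10 ^ 11 * G ^ 3" using G by (simp add: L_def power_mult_distrib power2_eq_square power3_eq_cube)
  finally show ?thesis by (simp add: v_def)
qed

text \<open>Fatou's lemma along a subsequence of projections that converges almost everywhere.
  Dividing by squared norms of at least 1/8 turns G into 64 G, and 10^17 absorbs 10^11 *
  64^3.\<close>

lemma Sobolev_L6:
  fixes u :: "real^'n::finite \<Rightarrow> real"
  assumes card: "CARD('n) \<le> 3" and u: "u \<in> L2_space" and G: "G > 0"
    and c: "\<And>K. finite K \<Longrightarrow> (\<Sum>k\<in>K. mode_weight k * (cosine_coeff u k)\<^sup>2) \<le> G"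
  shows "(\<integral>\<^sup>+x. ennreal ((u x) ^ 6) \<partial>cube_measure) \<le> ennreal (10 ^ 17 * G ^ 3)"
proof -
  have [measurable]: "u \<in> borel_measurable cube_measure" by (rule L2_measurable[OF u])
  have "\<exists>K. finite K \<and> L2_dist2 u (cos_sum K u) < 1 / real (Suc n)" for n
    using cos_sum_approximates[OF u, of "1 / real (Suc n)"] by (metis order_refl of_nat_0_less_iff zero_less_Suc zero_less_divide_1_iff)
  then obtain K where K: "\<And>n. finite (K n)" "\<And>n. L2_dist2 u (cos_sum (K n) u) < 1 / real (Suc n)" by metis
  define s where "s n = cos_sum (K n) u" for n
  have sL: "s n \<in> L2_space" for n by (simp add: s_def cos_sum_L2)
  have [measurable]: "s n \<in> borel_measurable cube_measure" for n by (rule L2_measurable[OF sL])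
  have "(\<lambda>n. LINT x|cube_measure. norm ((u x - s n x)\<^sup>2)) \<longlonglongrightarrow> 0"
  proof (rule tendsto_sandwich[OF _ _ tendsto_const LIMSEQ_Suc[OF lim_1_over_n]])
    show "\<forall>\<^sub>F n in sequentially. 0 \<le> (LINT x|cube_measure. norm ((u x - s n x)\<^sup>2))" by simp
    show "\<forall>\<^sub>F n in sequentially. (LINT x|cube_measure. norm ((u x - s n x)\<^sup>2)) \<le> 1 / real (Suc n)"
      using K(2) by (intro always_eventually allI) (simp add: L2_dist2_def s_def less_imp_le)
  qed
  from tendsto_L1_AE_subseq[OF L2_square_integrable[OF L2_diff[OF u sL]] this]
  obtain r :: "nat \<Rightarrow> nat" where ae: "AE x in cube_measure. (\<lambda>n. (u x - s (r n) x)\<^sup>2) \<longlonglongrightarrow> 0" by blast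
  have lim: "AE x in cube_measure. (\<lambda>n. ennreal (s (r n) x ^ 6)) \<longlonglongrightarrow> ennreal (u x ^ 6)"
    using ae
  proof eventually_elim
    case (elim x)
    from tendsto_real_sqrt[OF elim] have "(\<lambda>n. \<bar>u x - s (r n) x\<bar>) \<longlonglongrightarrow> 0" by simp
    then have "(\<lambda>n. u x - s (r n) x) \<longlonglongrightarrow> 0" by (rule tendsto_rabs_zero_cancel)
    from tendsto_diff[OF tendsto_const[of "u x"] this] have "(\<lambda>n. s (r n) x) \<longlonglongrightarrow> u x" by simp
    then show ?case by (intro tendsto_ennrealI tendsto_power)
  qed
  have bd: "(\<integral>\<^sup>+x. ennreal (s n x ^ 6) \<partial>cube_measure) \<le> ennreal (10 ^ 17 * G ^ 3)" for n
  proof -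
    define d where "d k = cosine_coeff u k / L2_inner (cos_mode k) (cos_mode k)" for k
    have d: "mode_weight k * (d k)\<^sup>2 \<le> 64 * (mode_weight k * (cosine_coeff u k)\<^sup>2)" for k
    proof -
      have "1 / 8 \<le> L2_inner (cos_mode k) (cos_mode k)"
      proof -
        have "1 / 8 = (1 / 2 :: real) ^ 3" by (simp add: power3_eq_cube)
        also have "\<dots> \<le> (1 / 2) ^ CARD('n)" using card by (intro power_decreasing) auto
        also have "\<dots> \<le> L2_inner (cos_mode k) (cos_mode k)" by (rule cos_mode_norm_ge)
        finally show ?thesis .
      qed
      then have "\<bar>d k\<bar> \<le> \<bar>8 * cosine_coeff u k\<bar>" unfolding d_def abs_divide
        using mult_right_mono[of "1/8" "L2_inner (cos_mode k) (cos_mode k)" "8 * \<bar>cosine_coeff u k\<bar>"] cos_mode_norm_pos[of k]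
        by (simp add: pos_divide_le_eq abs_mult mult_ac)
      then have "(d k)\<^sup>2 \<le> (8 * cosine_coeff u k)\<^sup>2" by (simp only: abs_le_square_iff)
      then show ?thesis using mult_left_mono[OF _ less_imp_le[OF mode_weight_pos[of k]]] by (simp add: power_mult_distrib mult.left_commute)
    qed
    have "(\<Sum>k\<in>K n. mode_weight k * (d k)\<^sup>2) \<le> 64 * G"
    proof -
      have "(\<Sum>k\<in>K n. mode_weight k * (d k)\<^sup>2) \<le> (\<Sum>k\<in>K n. 64 * (mode_weight k * (cosine_coeff u k)\<^sup>2))"
        by (intro sum_mono d)
      then show ?thesis using c[OF K(1), of n] by (simp add: sum_distrib_left[symmetric])
    qed
    then have "(LINT x|cube_measure. (\<Sum>k\<in>K n. d k * cos_mode k x) ^ 6) \<le> 10 ^ 11 * (64 * G) ^ 3"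
      using G by (intro sixth_power_cos_expansion_le card K) auto
    also have "\<dots> \<le> 10 ^ 17 * G ^ 3" using G by (simp add: power_mult_distrib)
    finally have "(LINT x|cube_measure. s n x ^ 6) \<le> 10 ^ 17 * G ^ 3" by (simp add: s_def cos_sum_def d_def)
    moreover have "integrable cube_measure (\<lambda>x. s n x ^ 6)" unfolding s_def
      by (intro continuous_cube_integrable continuous_on_power continuous_cos_sum)
    ultimately show ?thesis by (subst nn_integral_eq_integral) (auto intro!: ennreal_leI)
  qed
  have "(\<integral>\<^sup>+x. ennreal (u x ^ 6) \<partial>cube_measure) = (\<integral>\<^sup>+x. liminf (\<lambda>n. ennreal (s (r n) x ^ 6)) \<partial>cube_measure)"
  proof (intro nn_integral_cong_AE)
    show "AE x in cube_measure. ennreal (u x ^ 6) = liminf (\<lambda>n. ennreal (s (r n) x ^ 6))"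
      using lim by eventually_elim (rule lim_imp_Liminf[symmetric], simp_all only: sequentially_bot not_False_eq_True)
  qed
  also have "\<dots> \<le> liminf (\<lambda>n. \<integral>\<^sup>+x. ennreal (s (r n) x ^ 6) \<partial>cube_measure)"
    by (intro nn_integral_liminf) measurable
  also have "\<dots> \<le> ennreal (10 ^ 17 * G ^ 3)"
    by (intro Liminf_le always_eventually allI bd) simp
  finally show ?thesis .
qed

section \<open>Cosine coefficients of functions with two weak derivatives\<close>

text \<open>In three dimensions the squared product is the product of the three pairs. In two
  dimensions there is a single pair, and Q >= 1 supplies the missing factor.\<close>

lemma prod_square_le_cube:
  fixes a :: "'n::finite \<Rightarrow> real"
  assumes card: "CARD('n) \<in> {2, 3}" and a: "\<And>i. 1 \<le> a i"
    and Q: "\<And>i j. i \<noteq> j \<Longrightarrow> a i * a j \<le> Q"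
  shows "(\<Prod>i\<in>UNIV. a i)\<^sup>2 \<le> Q ^ 3"
proof -
  consider i j where "UNIV = {i, j}" "i \<noteq> (j::'n)" | i j l where "UNIV = {i, j, l}" "i \<noteq> (j::'n)" "j \<noteq> l" "i \<noteq> l"
    using card by (auto simp: card_2_iff card_3_iff)
  then show ?thesis
  proof cases
    case 1
    have p: "(\<Prod>i\<in>UNIV. a i) = a i * a j" by (subst 1(1)) (use 1(2) in simp)
    have "1 * 1 \<le> a i * a j" by (intro mult_mono a) (use a[of i] in auto)
    then have q: "1 \<le> a i * a j" "1 \<le> Q" using Q[OF 1(2)] by auto
    have "(a i * a j)\<^sup>2 \<le> Q\<^sup>2" using q Q[OF 1(2)] by (intro power_mono) auto
    also have "\<dots> \<le> Q ^ 3" using q by (intro power_increasing) auto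
    finally show ?thesis unfolding p .
  next
    case 2
    have p: "(\<Prod>i\<in>UNIV. a i) = a i * a j * a l" by (subst 2(1)) (use 2(2-4) in \<open>simp add: mult.assoc\<close>)
    have pos: "0 < a i" "0 < a j" "0 < a l" using a[of i] a[of j] a[of l] by auto
    have "(a i * a j * a l)\<^sup>2 = (a i * a j) * (a j * a l) * (a i * a l)" by (simp add: power2_eq_square mult_ac)
    also have "\<dots> \<le> Q * Q * Q"
      using Q[OF 2(2)] Q[OF 2(3)] Q[OF 2(4)] pos by (intro mult_mono) (auto intro!: mult_nonneg_nonneg less_imp_le order_trans[OF _ Q[OF 2(2)]])
    finally show ?thesis unfolding p by (simp add: power3_eq_cube)
  qed
qed

text \<open>No boundary condition is imposed on \<open>u\<close>: its cosine coefficients are controlled by the mixed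
  second derivatives only, whose expansion in products of two sines and cosines needs none.\<close>

lemma sum_abs_cos_coeff_H2_le:
  assumes card: "CARD('n::finite) \<in> {2, 3}"
  obtains C where "C > 0"
    "\<And>(u :: real^'n \<Rightarrow> real) K. u \<in> H2_space \<Longrightarrow> finite K \<Longrightarrow> (\<Sum>k\<in>K. \<bar>cosine_coeff u k\<bar>) \<le> C * H2_norm u"
proof -
  have card3: "CARD('n) \<le> 3" using card by auto
  obtain C where C: "C > 0"
    "\<And>K :: ('n \<Rightarrow> nat) set. finite K \<Longrightarrow> (\<Sum>k\<in>K. \<Prod>i\<in>UNIV. (1 + (real (k i))\<^sup>2) powr (- 2 / 3)) \<le> C"
  proof -
    have "(2::real) > 3 / 2" by simp
    from sum_mode_weight_powr_bounded[OF card3 this] that show ?thesis by metis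
  qed
  have "(\<Sum>k\<in>K. \<bar>cosine_coeff u k\<bar>) \<le> sqrt C * H2_norm u" if u: "u \<in> H2_space" and K: "finite K" for u :: "real^'n \<Rightarrow> real" and K
  proof -
    define d where "d i = weak_deriv i u" for i
    \<comment> \<open>W is the weight that the H^2 norm controls without pure second derivatives.
      Its lower bound Q factorises over the coordinates, and 1/Q is summable because it decays like
      the power - 4/3 in each of them.\<close>
    define W where "W k = mode_weight k + (\<Sum>i\<in>UNIV. \<Sum>j\<in>UNIV - {i}. (real (k i))\<^sup>2 * (real (k j))\<^sup>2)" for k :: "'n \<Rightarrow> nat"
    define Q where "Q k = (\<Prod>i\<in>UNIV. (1 + (real (k i))\<^sup>2) powr (2 / 3))" for k :: "'n \<Rightarrow> nat"
    have H1: "u \<in> H1_space" "d i \<in> H1_space" for i using u by (auto simp: H2_space_def d_def)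
    have second: "(\<Sum>k\<in>K. (real (k i))\<^sup>2 * (real (k j))\<^sup>2 * (cosine_coeff u k)\<^sup>2) \<le> L2_inner (weak_deriv j (d i)) (weak_deriv j (d i))"
      if ij: "j \<noteq> i" for i j
    proof -
      have "(real (k i))\<^sup>2 * (real (k j))\<^sup>2 * (cosine_coeff u k)\<^sup>2 \<le> (L2_inner (weak_deriv j (d i)) (trig_mode {i, j} k))\<^sup>2" for k
      proof -
        \<comment> \<open>The set of sines shrinks from {i, j} to {i} to the empty set, so each
          derivative is removed in a direction with zero boundary values. For j = i the second
          removal would meet a cosine.\<close>
        have "L2_inner (weak_deriv j (d i)) (trig_mode {i, j} k) = - (pi * real (k j) * L2_inner (d i) (trig_mode ({i, j} - {j}) k))"
          by (intro weak_deriv_trig_coeff H1_L2 weak_deriv_L2 H1) simp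
        also have "{i, j} - {j} = {i}" using ij by auto
        also have "L2_inner (d i) (trig_mode {i} k) = - (pi * real (k i) * L2_inner u (trig_mode ({i} - {i}) k))"
          unfolding d_def by (intro weak_deriv_trig_coeff H1_L2 weak_deriv_L2 H1) simp
        finally have "(L2_inner (weak_deriv j (d i)) (trig_mode {i, j} k))\<^sup>2 = pi ^ 4 * ((real (k i))\<^sup>2 * (real (k j))\<^sup>2 * (cosine_coeff u k)\<^sup>2)"
          by (simp add: cosine_coeff_def power_mult_distrib)
        moreover have "1 \<le> pi ^ 4" using pi_ge_two by (simp add: one_le_power)
        ultimately show ?thesis using mult_right_mono[of 1 "pi ^ 4" "(real (k i))\<^sup>2 * (real (k j))\<^sup>2 * (cosine_coeff u k)\<^sup>2"] by simp
      qed
      then have "(\<Sum>k\<in>K. (real (k i))\<^sup>2 * (real (k j))\<^sup>2 * (cosine_coeff u k)\<^sup>2) \<le> (\<Sum>k\<in>K. (L2_inner (weak_deriv j (d i)) (trig_mode {i, j} k))\<^sup>2)"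
        by (rule sum_mono)
      also have "\<dots> \<le> L2_inner (weak_deriv j (d i)) (weak_deriv j (d i))" by (intro Bessel_trig weak_deriv_L2 H1 K)
      finally show ?thesis .
    qed
    have "(\<Sum>k\<in>K. W k * (cosine_coeff u k)\<^sup>2) = (\<Sum>k\<in>K. mode_weight k * (cosine_coeff u k)\<^sup>2)
       + (\<Sum>k\<in>K. \<Sum>i\<in>UNIV. \<Sum>j\<in>UNIV - {i}. (real (k i))\<^sup>2 * (real (k j))\<^sup>2 * (cosine_coeff u k)\<^sup>2)"
      by (simp add: W_def distrib_right sum.distrib sum_distrib_right)
    also have "(\<Sum>k\<in>K. \<Sum>i\<in>UNIV. \<Sum>j\<in>UNIV - {i}. (real (k i))\<^sup>2 * (real (k j))\<^sup>2 * (cosine_coeff u k)\<^sup>2)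
       = (\<Sum>i\<in>UNIV. \<Sum>j\<in>UNIV - {i}. \<Sum>k\<in>K. (real (k i))\<^sup>2 * (real (k j))\<^sup>2 * (cosine_coeff u k)\<^sup>2)"
      by (subst sum.swap, intro sum.cong refl, rule sum.swap)
    also have "\<dots> \<le> (\<Sum>i\<in>UNIV. \<Sum>j\<in>UNIV. L2_inner (weak_deriv j (d i)) (weak_deriv j (d i)))"
    proof (intro sum_mono)
      fix i :: 'n
      have "(\<Sum>j\<in>UNIV - {i}. \<Sum>k\<in>K. (real (k i))\<^sup>2 * (real (k j))\<^sup>2 * (cosine_coeff u k)\<^sup>2) \<le> (\<Sum>j\<in>UNIV - {i}. L2_inner (weak_deriv j (d i)) (weak_deriv j (d i)))"
        by (intro sum_mono second) auto
      also have "\<dots> \<le> (\<Sum>j\<in>UNIV. L2_inner (weak_deriv j (d i)) (weak_deriv j (d i)))"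
        by (intro sum_mono2) (auto simp: L2_inner_self_nonneg)
      finally show "(\<Sum>j\<in>UNIV - {i}. \<Sum>k\<in>K. (real (k i))\<^sup>2 * (real (k j))\<^sup>2 * (cosine_coeff u k)\<^sup>2) \<le> (\<Sum>j\<in>UNIV. L2_inner (weak_deriv j (d i)) (weak_deriv j (d i)))" .
    qed
    also have "(\<Sum>k\<in>K. mode_weight k * (cosine_coeff u k)\<^sup>2) \<le> L2_inner u u + (\<Sum>i\<in>UNIV. L2_inner (weak_deriv i u) (weak_deriv i u))"
      using cos_coeff_H1_le[OF H1(1) K] by (simp add: L2_inner_vec_weak_grad H1)
    finally have Wsum: "(\<Sum>k\<in>K. W k * (cosine_coeff u k)\<^sup>2) \<le> (H2_norm u)\<^sup>2"
      unfolding H2_norm_def d_def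
      by (subst real_sqrt_pow2) (auto intro!: add_nonneg_nonneg sum_nonneg L2_inner_self_nonneg)
    have Qpos: "0 < Q k" for k
    proof -
      have "0 < 1 + (real (k i))\<^sup>2" for i by (simp add: add_pos_nonneg)
      then have "0 < (1 + (real (k i))\<^sup>2) powr (2 / 3)" for i by (metis less_irrefl powr_gt_zero)
      then show ?thesis unfolding Q_def by (intro prod_pos) auto
    qed
    \<comment> \<open>The comparison is made between cubes: \<open>Q k ^ 3\<close> is the squared
      product over the coordinates, which pairwise products control.\<close>
    have QW: "Q k \<le> W k" for k
    proof -
      have m: "(1 + (real (k i))\<^sup>2) * (1 + (real (k j))\<^sup>2) \<le> W k" if "i \<noteq> j" for i j
      proof -
        have "(real (k i))\<^sup>2 + (real (k j))\<^sup>2 = (\<Sum>l\<in>{i, j}. (real (k l))\<^sup>2)" using that by simp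
        also have "\<dots> \<le> (\<Sum>l\<in>UNIV. (real (k l))\<^sup>2)" by (intro sum_mono2) auto
        finally have 1: "1 + (real (k i))\<^sup>2 + (real (k j))\<^sup>2 \<le> mode_weight k" by (simp add: mode_weight_def)
        have "(real (k i))\<^sup>2 * (real (k j))\<^sup>2 \<le> (\<Sum>j\<in>UNIV - {i}. (real (k i))\<^sup>2 * (real (k j))\<^sup>2)"
          using that by (intro member_le_sum[of j "UNIV - {i}" "\<lambda>j. (real (k i))\<^sup>2 * (real (k j))\<^sup>2"]) auto
        also have "\<dots> \<le> (\<Sum>i\<in>UNIV. \<Sum>j\<in>UNIV - {i}. (real (k i))\<^sup>2 * (real (k j))\<^sup>2)"
          by (intro member_le_sum[of i UNIV "\<lambda>i. \<Sum>j\<in>UNIV - {i}. (real (k i))\<^sup>2 * (real (k j))\<^sup>2"] sum_nonneg) auto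
        finally show ?thesis using 1 by (simp add: W_def algebra_simps)
      qed
      have "(\<Prod>i\<in>UNIV. 1 + (real (k i))\<^sup>2)\<^sup>2 \<le> W k ^ 3"
        by (rule prod_square_le_cube[OF card]) (use m in auto)
      moreover have "Q k ^ 3 = (\<Prod>i\<in>UNIV. 1 + (real (k i))\<^sup>2)\<^sup>2"
      proof -
        have "((1 + x\<^sup>2) powr (2 / 3)) ^ 3 = (1 + x\<^sup>2)\<^sup>2" for x :: real
          using add_pos_nonneg[of 1 "x\<^sup>2"] by (simp add: powr_power)
        then show ?thesis unfolding Q_def by (simp add: prod_power_distrib)
      qed
      ultimately have "Q k ^ 3 \<le> W k ^ 3" by simp
      moreover have "0 \<le> W k" unfolding W_def by (intro add_nonneg_nonneg sum_nonneg) (auto simp: less_imp_le[OF mode_weight_pos])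
      ultimately show ?thesis by (intro power_le_imp_le_base[of "Q k" 2 "W k"]) (simp_all add: eval_nat_numeral)
    qed
    have "(\<Sum>k\<in>K. \<bar>cosine_coeff u k\<bar>)\<^sup>2 \<le> (\<Sum>k\<in>K. 1 / Q k) * (\<Sum>k\<in>K. Q k * (cosine_coeff u k)\<^sup>2)"
      by (rule sum_abs_weighted_le[OF Qpos])
    also have "\<dots> \<le> C * (H2_norm u)\<^sup>2"
    proof (rule mult_mono)
      have "1 / Q k = (\<Prod>i\<in>UNIV. (1 + (real (k i))\<^sup>2) powr (- 2 / 3))" for k
        by (simp add: Q_def prod_dividef powr_minus_divide)
      then show "(\<Sum>k\<in>K. 1 / Q k) \<le> C" using C(2)[OF K] by simp
      have "(\<Sum>k\<in>K. Q k * (cosine_coeff u k)\<^sup>2) \<le> (\<Sum>k\<in>K. W k * (cosine_coeff u k)\<^sup>2)"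
        by (intro sum_mono mult_right_mono QW) auto
      then show "(\<Sum>k\<in>K. Q k * (cosine_coeff u k)\<^sup>2) \<le> (H2_norm u)\<^sup>2" using Wsum by linarith
    qed (use C in \<open>auto intro!: sum_nonneg simp: less_imp_le[OF Qpos]\<close>)
    also have "\<dots> = (sqrt C * H2_norm u)\<^sup>2" using C by (simp add: power_mult_distrib)
    finally show ?thesis
      by (rule power2_le_imp_le) (use C in \<open>auto simp: H2_norm_def intro!: mult_nonneg_nonneg add_nonneg_nonneg sum_nonneg L2_inner_self_nonneg\<close>)
  qed
  then show ?thesis using C by (intro that[of "sqrt C"]) auto
qed

section \<open>Summation over dyadic shells of modes\<close>

lemma card_mode_shell_le:
  fixes K :: "('n::finite \<Rightarrow> nat) set"
  assumes card: "CARD('n) \<le> 3" and K: "\<And>k. k \<in> K \<Longrightarrow> mode_weight k < 4 ^ Suc r"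
  shows "real (card K) \<le> 8 ^ Suc r"
proof -
  have b: "k i \<le> 2 ^ Suc r - 1" if "k \<in> K" for k i
  proof -
    have "(real (k i))\<^sup>2 < (2 ^ Suc r)\<^sup>2" using K[OF that] mode_weight_ge[of k i] by (simp add: power2_eq_square power_mult_distrib[symmetric])
    then have "real (k i) < 2 ^ Suc r" by (rule power2_less_imp_less) simp
    then have "k i < 2 ^ Suc r" by (metis of_nat_less_numeral_power_cancel_iff of_nat_numeral of_nat_power of_nat_less_iff)
    then show ?thesis by simp
  qed
  have "(\<Sum>k\<in>K. \<Prod>i\<in>UNIV. (\<lambda>_. 1 :: real) (k i)) \<le> (2 ^ Suc r) ^ CARD('n)"
  proof (rule sum_prod_modes_le)
    show "k i \<le> 2 ^ Suc r - 1" if "k \<in> K" for k i using b[OF that] .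
    show "(\<Sum>m\<le>(2::nat) ^ Suc r - 1. 1 :: real) \<le> 2 ^ Suc r"
    proof -
      have "(\<Sum>m\<le>(2::nat) ^ Suc r - 1. 1 :: real) = real (2 ^ Suc r - 1) + 1" by simp
      also have "\<dots> = 2 ^ Suc r" using one_le_power[of "2::nat" "Suc r"] by (subst of_nat_diff) auto
      finally show ?thesis by simp
    qed
  qed simp
  also have "\<dots> \<le> (2 ^ Suc r) ^ 3" using card by (intro power_increasing one_le_power) auto
  also have "\<dots> = (8 ^ Suc r :: real)" by (simp add: power_mult[symmetric] mult.commute[of _ "3::nat"] power_mult)
  finally show ?thesis by simp
qed

text \<open>A shell of weight about 4^r has at most 8^(r+1) modes and contributes at most a multiple
  of 4^(- r p) 8^(r q), a geometric series when 3 q < 2 p. The assumed bound sees only the number of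
  modes, which is all that the estimates for the nonlinearity provide.\<close>

lemma sum_mode_weight_shells_le:
  fixes g :: "('n::finite \<Rightarrow> nat) \<Rightarrow> real"
  assumes card: "CARD('n) \<le> 3" and g: "\<And>k. 0 \<le> g k" and A: "0 \<le> A" and q: "0 \<le> q" "3 * q < 2 * p" 
    and bound: "\<And>S N. finite S \<Longrightarrow> real (card S) \<le> N \<Longrightarrow> 1 \<le> N \<Longrightarrow> (\<Sum>k\<in>S. g k) \<le> A * N powr q"
    and K: "finite K"
  shows "(\<Sum>k\<in>K. mode_weight k powr (- p) * g k) \<le> 8 powr q / (1 - 2 powr (3 * q - 2 * p)) * A"
proof -
  define r where "r k = nat \<lfloor>log 4 (mode_weight k)\<rfloor>" for k :: "'n \<Rightarrow> nat"
  have r: "4 ^ r k \<le> mode_weight k" "mode_weight k < 4 ^ Suc (r k)" for k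
  proof -
    have l: "0 \<le> log 4 (mode_weight k)" using mode_weight_ge_1[of k] by simp
    have "real (r k) \<le> log 4 (mode_weight k)" "log 4 (mode_weight k) < real (Suc (r k))"
      using l unfolding r_def by linarith+
    then show "4 ^ r k \<le> mode_weight k" "mode_weight k < 4 ^ Suc (r k)"
      using mode_weight_pos[of k] by (simp_all only: le_log_iff log_less_iff powr_realpow zero_less_numeral one_less_numeral_iff semiring_norm)
  qed
  define \<rho> where "\<rho> = 2 powr (3 * q - 2 * p)"
  have \<rho>: "0 < \<rho>" "\<rho> < 1" using q by (simp_all add: \<rho>_def powr_less_one)
  have "(\<Sum>k\<in>K. mode_weight k powr (- p) * g k) = (\<Sum>n\<in>r ` K. \<Sum>k\<in>{k\<in>K. r k = n}. mode_weight k powr (- p) * g k)"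
    by (rule sum.image_gen[OF K])
  also have "\<dots> \<le> (\<Sum>n\<in>r ` K. 8 powr q * A * \<rho> ^ n)"
  proof (rule sum_mono)
    fix n
    have "(\<Sum>k\<in>{k\<in>K. r k = n}. mode_weight k powr (- p) * g k) \<le> (\<Sum>k\<in>{k\<in>K. r k = n}. (4 ^ n) powr (- p) * g k)"
    proof (intro sum_mono mult_right_mono g)
      fix k assume "k \<in> {k\<in>K. r k = n}"
      then show "mode_weight k powr (- p) \<le> (4 ^ n) powr (- p)" using r(1)[of k] q by (intro powr_mono2') auto
    qed
    also have "\<dots> = (4 ^ n) powr (- p) * (\<Sum>k\<in>{k\<in>K. r k = n}. g k)" by (simp add: sum_distrib_left)
    also have "\<dots> \<le> (4 ^ n) powr (- p) * (A * (8 ^ Suc n) powr q)"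
    proof (intro mult_left_mono bound)
      show "real (card {k\<in>K. r k = n}) \<le> 8 ^ Suc n" by (rule card_mode_shell_le[OF card]) (use r in auto)
      show "1 \<le> (8::real) ^ Suc n" by (rule one_le_power) simp
    qed (use K in auto)
    also have "\<dots> = 8 powr q * A * \<rho> ^ n"
    proof -
      have "(4::real) ^ n = 2 powr (2 * real n)" "(8::real) ^ Suc n = 8 * 2 powr (3 * real n)"
        using powr_realpow[of "2::real" "2 * n"] powr_realpow[of "2::real" "3 * n"] by (simp_all add: power_mult)
      then have "(4 ^ n) powr (- p) * (A * (8 ^ Suc n) powr q) = 8 powr q * A * (2 powr (2 * real n * (- p)) * 2 powr (3 * real n * q))"
        by (simp add: powr_mult powr_powr)
      also have "2 powr (2 * real n * (- p)) * 2 powr (3 * real n * q) = \<rho> ^ n"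
      proof -
        have "\<rho> ^ n = 2 powr (real n * (3 * q - 2 * p))" by (simp add: \<rho>_def powr_power)
        then show ?thesis by (simp add: powr_add[symmetric] algebra_simps)
      qed
      finally show ?thesis .
    qed
    finally show "(\<Sum>k\<in>{k\<in>K. r k = n}. mode_weight k powr (- p) * g k) \<le> 8 powr q * A * \<rho> ^ n" .
  qed
  also have "\<dots> = 8 powr q * A * (\<Sum>n\<in>r ` K. \<rho> ^ n)" by (simp add: sum_distrib_left)
  also have "(\<Sum>n\<in>r ` K. \<rho> ^ n) \<le> 1 / (1 - \<rho>)"
    using sum_le_suminf[of "\<lambda>n. \<rho> ^ n" "r ` K"] \<rho> K by (simp add: summable_geometric suminf_geometric)
  finally show ?thesis using A by (simp add: \<rho>_def mult_left_mono)
qed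

section \<open>Cosine coefficients of the nonlinearity\<close>

lemma sum_abs_cos_coeff_le:
  assumes v: "v \<in> L2_space" and S: "finite S"
  shows "(\<Sum>k\<in>S. \<bar>cosine_coeff v k\<bar>) \<le> sqrt (real (card S) * L2_inner v v)"
proof (rule real_le_rsqrt)
  have "(\<Sum>k\<in>S. \<bar>cosine_coeff v k\<bar>)\<^sup>2 \<le> (\<Sum>k\<in>S. 1 / 1) * (\<Sum>k\<in>S. 1 * (cosine_coeff v k)\<^sup>2)"
    by (rule sum_abs_weighted_le) simp
  also have "\<dots> \<le> real (card S) * L2_inner v v"
    using Bessel_trig[OF v S, of "{}"] by (simp add: cosine_coeff_def mult_left_mono)
  finally show "(\<Sum>k\<in>S. \<bar>cosine_coeff v k\<bar>)\<^sup>2 \<le> real (card S) * L2_inner v v" .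
qed

lemma abs_cos_coeff_le:
  assumes "integrable cube_measure v" shows "\<bar>cosine_coeff v k\<bar> \<le> (LINT x|cube_measure. \<bar>v x\<bar>)"
proof -
  have "\<bar>v x * cos_mode k x\<bar> \<le> \<bar>v x\<bar>" for x
    by (simp add: abs_mult mult_left_le abs_trig_mode_le)
  moreover have [measurable]: "cos_mode k \<in> borel_measurable cube_measure" by (intro L2_measurable trig_mode_L2)
  moreover have "integrable cube_measure (\<lambda>x. v x * cos_mode k x)"
    by (rule Bochner_Integration.integrable_bound[OF integrable_abs[OF assms]])
       (use calculation assms in auto)
  ultimately show ?thesis unfolding cosine_coeff_def L2_inner_def
    by (intro order_trans[OF integral_abs_bound] integral_mono integrable_abs assms)
qed

lemma integrable_power_nn_integral:
  fixes u :: "real^'n::finite \<Rightarrow> real"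
  assumes u: "u \<in> borel_measurable cube_measure" and b: "(\<integral>\<^sup>+x. ennreal (u x ^ m) \<partial>cube_measure) \<le> ennreal B" and m: "even m" and B: "0 \<le> B"
  shows "integrable cube_measure (\<lambda>x. u x ^ m)" "(LINT x|cube_measure. u x ^ m) \<le> B"
proof -
  have nn: "0 \<le> u x ^ m" for x using m by (rule zero_le_even_power)
  show i: "integrable cube_measure (\<lambda>x. u x ^ m)"
    by (rule integrableI_nonneg) (use u nn b in \<open>auto simp: ennreal_less_top intro: le_less_trans\<close>)
  then show "(LINT x|cube_measure. u x ^ m) \<le> B"
    using b B nn by (subst (asm) nn_integral_eq_integral) (auto simp: ennreal_le_iff)
qed

text \<open>The last two serve a split at level R: below it the square of f(x) costs R^2 x^4, above
  it f(x) itself is at most a multiple of x^4 / R.\<close>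

lemma f_pot_bounds:
  "(f_pot x)\<^sup>2 \<le> 2 * x ^ 6 + 2 * x\<^sup>2" "x\<^sup>2 \<le> 1 + x ^ 4"
  "\<bar>x\<bar> \<le> R \<Longrightarrow> 1 \<le> R \<Longrightarrow> (f_pot x)\<^sup>2 \<le> 2 * R\<^sup>2 * x ^ 4 + 2 * x\<^sup>2"
  "R < \<bar>x\<bar> \<Longrightarrow> 1 \<le> R \<Longrightarrow> \<bar>f_pot x\<bar> \<le> 2 / R * x ^ 4"
proof -
  have "0 \<le> (x ^ 3 + x)\<^sup>2" by simp
  then show 1: "(f_pot x)\<^sup>2 \<le> 2 * x ^ 6 + 2 * x\<^sup>2"
    by (simp add: f_pot_def power2_eq_square power_def algebra_simps eval_nat_numeral)
  have "0 \<le> (x\<^sup>2 - 1 / 2)\<^sup>2" by simp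
  then show "x\<^sup>2 \<le> 1 + x ^ 4" by (simp add: power2_eq_square algebra_simps eval_nat_numeral)
  show "(f_pot x)\<^sup>2 \<le> 2 * R\<^sup>2 * x ^ 4 + 2 * x\<^sup>2" if "\<bar>x\<bar> \<le> R" "1 \<le> R"
  proof -
    have "x\<^sup>2 \<le> R\<^sup>2" using that by (simp add: abs_le_square_iff[symmetric])
    then have "x\<^sup>2 * x ^ 4 \<le> R\<^sup>2 * x ^ 4" by (intro mult_right_mono) auto
    moreover have "x\<^sup>2 * x ^ 4 = x ^ 6" by (simp add: power_add[symmetric])
    ultimately show ?thesis using 1 by simp
  qed
  show "\<bar>f_pot x\<bar> \<le> 2 / R * x ^ 4" if R: "R < \<bar>x\<bar>" "1 \<le> R"
  proof -
    define y where "y = \<bar>x\<bar>"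
    have y: "1 < y" "R < y" using R by (auto simp: y_def)
    have "\<bar>f_pot x\<bar> \<le> y ^ 3 + y" unfolding f_pot_def y_def by (intro order_trans[OF abs_triangle_ineq4]) (simp add: power_abs)
    moreover have "y \<le> y ^ 3" using power_increasing[of 1 3 y] y by simp
    ultimately have "\<bar>f_pot x\<bar> \<le> 2 * y ^ 3" by linarith
    then have "R * \<bar>f_pot x\<bar> \<le> R * (2 * y ^ 3)" using R by (intro mult_left_mono) auto
    moreover have "R * y ^ 3 \<le> y * y ^ 3" using y by (intro mult_right_mono) auto
    moreover have "y * y ^ 3 = x ^ 4" by (simp add: y_def power_abs[symmetric] eval_nat_numeral abs_mult[symmetric])
    ultimately have "R * \<bar>f_pot x\<bar> \<le> 2 * x ^ 4" by linarith
    then show ?thesis using R by (simp add: pos_le_divide_eq mult.commute)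
  qed
qed

lemma L2_inner_self_le_L4:
  fixes u :: "real^'n::finite \<Rightarrow> real"
  assumes u: "u \<in> L2_space" and E: "1 \<le> E" "(\<integral>\<^sup>+x. ennreal (u x ^ 4) \<partial>cube_measure) \<le> ennreal E"
  shows "L2_inner u u \<le> 2 * E"
proof -
  interpret prob_space "cube_measure :: (real^'n) measure" by (rule prob_space_cube)
  have p1: "(LINT x|(cube_measure :: (real^'n) measure). 1) = (1::real)" using prob_space by simp
  have i4: "integrable cube_measure (\<lambda>x. u x ^ 4)" and b4: "(LINT x|cube_measure. u x ^ 4) \<le> E"
    by (rule integrable_power_nn_integral[OF L2_measurable[OF u] E(2)]; use E in simp)+
  have "(LINT x|cube_measure. (u x)\<^sup>2) \<le> (LINT x|cube_measure. 1 + u x ^ 4)"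
    using L2_square_integrable[OF u] i4 by (intro integral_mono f_pot_bounds) auto
  also have "\<dots> = 1 + (LINT x|cube_measure. u x ^ 4)" by (subst Bochner_Integration.integral_add) (use i4 p1 in auto)
  finally show ?thesis using b4 E by (simp add: L2_inner_def power2_eq_square)
qed

text \<open>A fourth moment of u puts f(u) in L^(4/3) only, where Hausdorff-Young and Hoelder would
  give (N E) powr (3/4) for N coefficients. Splitting f(u) into a square-integrable and an
  integrable part gives the same power with Bessel and the trivial bound on a coefficient.\<close>

lemma
  fixes u :: "real^'n::finite \<Rightarrow> real"
  assumes u: "u \<in> L2_space" and E: "1 \<le> E" "(\<integral>\<^sup>+x. ennreal (u x ^ 4) \<partial>cube_measure) \<le> ennreal E"
    and S: "0 \<le> S" "(\<integral>\<^sup>+x. ennreal (u x ^ 6) \<partial>cube_measure) \<le> ennreal S"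
  shows f_pot_L2: "(\<lambda>x. f_pot (u x)) \<in> L2_space"
    and sum_f_pot_coeff_le_L6: "finite T \<Longrightarrow> (\<Sum>k\<in>T. \<bar>cosine_coeff (\<lambda>x. f_pot (u x)) k\<bar>) \<le> sqrt (real (card T) * (2 * S + 4 * E))"
    and sum_f_pot_coeff_le_L4: "finite T \<Longrightarrow> real (card T) \<le> N \<Longrightarrow> 1 \<le> N \<Longrightarrow>
       (\<Sum>k\<in>T. \<bar>cosine_coeff (\<lambda>x. f_pot (u x)) k\<bar>) \<le> 5 * (N * E) powr (3 / 4)"
proof -
  interpret prob_space "cube_measure :: (real^'n) measure" by (rule prob_space_cube)
  have um [measurable]: "u \<in> borel_measurable cube_measure" by (rule L2_measurable[OF u])
  have i4: "integrable cube_measure (\<lambda>x. u x ^ 4)" and b4: "(LINT x|cube_measure. u x ^ 4) \<le> E"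
    by (rule integrable_power_nn_integral[OF um E(2)]; use E in simp)+
  have i6: "integrable cube_measure (\<lambda>x. u x ^ 6)" and b6: "(LINT x|cube_measure. u x ^ 6) \<le> S"
    by (rule integrable_power_nn_integral[OF um S(2)]; use S in simp)+
  note i2 = L2_square_integrable[OF u]
  have b2: "(LINT x|cube_measure. (u x)\<^sup>2) \<le> 2 * E"
    using L2_inner_self_le_L4[OF u E] by (simp add: L2_inner_def power2_eq_square)
  have fm [measurable]: "(\<lambda>x. f_pot (u x)) \<in> borel_measurable cube_measure" unfolding f_pot_def by measurable
  have if2: "integrable cube_measure (\<lambda>x. (f_pot (u x))\<^sup>2)"
  proof (rule Bochner_Integration.integrable_bound)
    show "integrable cube_measure (\<lambda>x. 2 * u x ^ 6 + 2 * (u x)\<^sup>2)" using i2 i6 by auto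
    show "AE x in cube_measure. norm ((f_pot (u x))\<^sup>2) \<le> norm (2 * u x ^ 6 + 2 * (u x)\<^sup>2)"
      by (intro AE_I2) (auto intro!: order_trans[OF f_pot_bounds(1)])
  qed measurable
  then show fL: "(\<lambda>x. f_pot (u x)) \<in> L2_space" by (simp add: L2_space_def)
  show "(\<Sum>k\<in>T. \<bar>cosine_coeff (\<lambda>x. f_pot (u x)) k\<bar>) \<le> sqrt (real (card T) * (2 * S + 4 * E))" if T: "finite T"
  proof -
    have "(LINT x|cube_measure. (f_pot (u x))\<^sup>2) \<le> (LINT x|cube_measure. 2 * u x ^ 6 + 2 * (u x)\<^sup>2)"
      using i2 i6 by (intro integral_mono f_pot_bounds if2) auto
    also have "\<dots> = 2 * (LINT x|cube_measure. u x ^ 6) + 2 * (LINT x|cube_measure. (u x)\<^sup>2)" using i2 i6 by simp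
    finally have "(LINT x|cube_measure. (f_pot (u x))\<^sup>2) \<le> 2 * S + 4 * E" using b2 b6 by linarith
    then have "L2_inner (\<lambda>x. f_pot (u x)) (\<lambda>x. f_pot (u x)) \<le> 2 * S + 4 * E" by (simp add: L2_inner_def power2_eq_square)
    then show ?thesis
      by (intro order_trans[OF sum_abs_cos_coeff_le[OF fL T]] real_sqrt_le_mono mult_left_mono) auto
  qed
  show "(\<Sum>k\<in>T. \<bar>cosine_coeff (\<lambda>x. f_pot (u x)) k\<bar>) \<le> 5 * (N * E) powr (3 / 4)"
    if T: "finite T" and N: "real (card T) \<le> N" "1 \<le> N"
  proof -
    \<comment> \<open>This level balances the two parts: sqrt (N E) R for the bounded one and N E /
      R for the other are both (N E) powr (3/4), up to constants.\<close>
    define R where "R = (N * E) powr (1 / 4)"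
    have NE: "1 \<le> N * E" using N E mult_mono[of 1 N 1 E] by simp
    have R: "1 \<le> R" unfolding R_def using NE by (simp add: ge_one_powr_ge_zero)
    define lo where "lo x = (if \<bar>u x\<bar> \<le> R then f_pot (u x) else 0)" for x
    define hi where "hi x = (if \<bar>u x\<bar> \<le> R then 0 else f_pot (u x))" for x
    have [measurable]: "lo \<in> borel_measurable cube_measure" "hi \<in> borel_measurable cube_measure"
      unfolding lo_def[abs_def] hi_def[abs_def] by measurable
    have il: "integrable cube_measure (\<lambda>x. (lo x)\<^sup>2)" "integrable cube_measure (\<lambda>x. (hi x)\<^sup>2)"
      by (rule Bochner_Integration.integrable_bound[OF if2]; simp add: lo_def hi_def)+
    then have L: "lo \<in> L2_space" "hi \<in> L2_space" by (auto simp: L2_space_def)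
    have "L2_inner lo lo \<le> 6 * R\<^sup>2 * E"
    proof -
      have "(LINT x|cube_measure. (lo x)\<^sup>2) \<le> (LINT x|cube_measure. 2 * R\<^sup>2 * u x ^ 4 + 2 * (u x)\<^sup>2)"
        using i2 i4 f_pot_bounds(3)[OF _ R] by (intro integral_mono il) (auto simp: lo_def)
      also have "\<dots> = 2 * R\<^sup>2 * (LINT x|cube_measure. u x ^ 4) + 2 * (LINT x|cube_measure. (u x)\<^sup>2)" using i2 i4 by simp
      also have "\<dots> \<le> 2 * R\<^sup>2 * E + 2 * (2 * E)" using b4 b2 by (intro add_mono mult_left_mono) auto
      also have "\<dots> \<le> 6 * R\<^sup>2 * E" using R E by (simp add: one_le_power)
      finally show ?thesis by (simp add: L2_inner_def power2_eq_square)
    qed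
    then have 1: "(\<Sum>k\<in>T. \<bar>cosine_coeff lo k\<bar>) \<le> sqrt (N * (6 * R\<^sup>2 * E))"
      using N by (intro order_trans[OF sum_abs_cos_coeff_le[OF L(1) T]] real_sqrt_le_mono mult_mono L2_inner_self_nonneg) auto
    have "\<bar>cosine_coeff hi k\<bar> \<le> 2 / R * E" for k
    proof -
      have "(LINT x|cube_measure. \<bar>hi x\<bar>) \<le> (LINT x|cube_measure. 2 / R * u x ^ 4)"
      proof (rule integral_mono[OF integrable_abs[OF L2_integrable[OF L(2)]]])
        show "\<bar>hi x\<bar> \<le> 2 / R * u x ^ 4" for x using f_pot_bounds(4)[OF _ R, of "u x"] R by (auto simp: hi_def)
        show "integrable cube_measure (\<lambda>x. 2 / R * u x ^ 4)" by (rule integrable_mult_right[OF i4])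
      qed
      also have "\<dots> = 2 / R * (LINT x|cube_measure. u x ^ 4)" by (rule integral_mult_right_zero)
      also have "\<dots> \<le> 2 / R * E" using R by (intro mult_left_mono b4) simp
      finally show ?thesis using abs_cos_coeff_le[OF L2_integrable[OF L(2)], of k] by linarith
    qed
    note hib = this
    have 2: "(\<Sum>k\<in>T. \<bar>cosine_coeff hi k\<bar>) \<le> N * (2 / R * E)"
    proof -
      have c0: "0 \<le> 2 / R * E" using R E by simp
      have "(\<Sum>k\<in>T. \<bar>cosine_coeff hi k\<bar>) \<le> (\<Sum>k\<in>T. 2 / R * E)" by (intro sum_mono hib)
      also have "\<dots> = real (card T) * (2 / R * E)" by simp
      also have "\<dots> \<le> N * (2 / R * E)" by (rule mult_right_mono[OF N(1) c0])
      finally show ?thesis .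
    qed
    have "cosine_coeff (\<lambda>x. f_pot (u x)) k = cosine_coeff lo k + cosine_coeff hi k" for k
    proof -
      have "(\<lambda>x. f_pot (u x)) = (\<lambda>x. lo x + hi x)" by (auto simp: lo_def hi_def)
      then show ?thesis unfolding cosine_coeff_def by (simp add: L2_inner_add_left L trig_mode_L2)
    qed
    then have "(\<Sum>k\<in>T. \<bar>cosine_coeff (\<lambda>x. f_pot (u x)) k\<bar>) \<le> (\<Sum>k\<in>T. \<bar>cosine_coeff lo k\<bar>) + (\<Sum>k\<in>T. \<bar>cosine_coeff hi k\<bar>)"
      unfolding sum.distrib[symmetric] by (intro sum_mono) (simp add: abs_triangle_ineq)
    also have "\<dots> \<le> sqrt (N * (6 * R\<^sup>2 * E)) + N * (2 / R * E)" using 1 2 by linarith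
    also have "sqrt (N * (6 * R\<^sup>2 * E)) \<le> 3 * (N * E) powr (3 / 4)"
    proof (rule real_le_lsqrt)
      have *: "(3 * M powr (3 / 4))\<^sup>2 = 9 * (M * (M powr (1 / 4))\<^sup>2)" if "1 \<le> M" for M :: real
        using that powr_add[of M 1 "1 / 2"] by (simp add: power_mult_distrib powr_power)
      have "(3 * (N * E) powr (3 / 4))\<^sup>2 = 9 * ((N * E) * R\<^sup>2)" unfolding R_def by (rule *[OF NE])
      moreover have "0 \<le> (N * E) * R\<^sup>2" using NE by simp
      ultimately show "N * (6 * R\<^sup>2 * E) \<le> (3 * (N * E) powr (3 / 4))\<^sup>2" by (simp add: mult_ac)
      show "0 \<le> 3 * (N * E) powr (3 / 4)" by (intro mult_nonneg_nonneg powr_ge_zero) simp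
    qed
    also have "N * (2 / R * E) = 2 * (N * E) powr (3 / 4)"
    proof -
      have *: "M / M powr (1 / 4) = M powr (3 / 4)" if "1 \<le> M" for M :: real
        using that powr_diff[of M 1 "1 / 4"] by simp
      have "N * (2 / R * E) = 2 * ((N * E) / R)" by simp
      then show ?thesis unfolding R_def *[OF NE] .
    qed
    finally show ?thesis by simp
  qed
qed

text \<open>Interpolating the two bounds gives N the exponent q = 2/3 - \<delta>/4. Against p = 1 -
  \<delta>/4 this leaves 3 q - 2 p = - \<delta>/4, the exponent in the denominator; for \<delta> = 0
  the shells would not be summable.\<close>

lemma sum_weighted_f_pot_coeff_le:
  fixes u :: "real^'n::finite \<Rightarrow> real"
  assumes card: "CARD('n) \<le> 3" and u: "u \<in> L2_space" and E: "1 \<le> E" "(\<integral>\<^sup>+x. ennreal (u x ^ 4) \<partial>cube_measure) \<le> ennreal E"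
    and S: "0 \<le> S" "(\<integral>\<^sup>+x. ennreal (u x ^ 6) \<partial>cube_measure) \<le> ennreal S"
    and \<delta>: "0 < \<delta>" "\<delta> \<le> 1 / 3" and K: "finite K"
  shows "(\<Sum>k\<in>K. mode_weight k powr (- (1 - \<delta> / 4)) * \<bar>cosine_coeff (\<lambda>x. f_pot (u x)) k\<bar>)
    \<le> 8 powr (2 / 3 - \<delta> / 4) / (1 - 2 powr (- (\<delta> / 4))) *
      ((5 * E powr (3 / 4)) powr (2 / 3 - \<delta>) * (sqrt (2 * S + 4 * E)) powr (1 / 3 + \<delta>))"
proof -
  let ?g = "\<lambda>k. \<bar>cosine_coeff (\<lambda>x. f_pot (u x)) k\<bar>"
  let ?A = "(5 * E powr (3 / 4)) powr (2 / 3 - \<delta>) * (sqrt (2 * S + 4 * E)) powr (1 / 3 + \<delta>)"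
  have "(\<Sum>k\<in>K. mode_weight k powr (- (1 - \<delta> / 4)) * ?g k) \<le>
     8 powr (2 / 3 - \<delta> / 4) / (1 - 2 powr (3 * (2 / 3 - \<delta> / 4) - 2 * (1 - \<delta> / 4))) * ?A"
  proof (rule sum_mode_weight_shells_le[OF card])
    fix T :: "('n \<Rightarrow> nat) set" and N :: real assume T: "finite T" "real (card T) \<le> N" "1 \<le> N"
    define x where "x = (\<Sum>k\<in>T. ?g k)"
    have x: "0 \<le> x" "x \<le> 5 * (N * E) powr (3 / 4)" "x \<le> sqrt (N * (2 * S + 4 * E))"
    proof -
      have "sqrt (real (card T) * (2 * S + 4 * E)) \<le> sqrt (N * (2 * S + 4 * E))"
        using T S E by (intro real_sqrt_le_mono mult_right_mono) auto
      with sum_f_pot_coeff_le_L6[OF u E S T(1)] show "x \<le> sqrt (N * (2 * S + 4 * E))" unfolding x_def by linarith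
    qed (auto simp: x_def intro!: sum_nonneg sum_f_pot_coeff_le_L4[OF u E S T])
    \<comment> \<open>The exponents add up to 1; the first factor is bounded by the fourth moment,
      the second by the sixth.\<close>
    have "x = x powr (2 / 3 - \<delta>) * x powr (1 / 3 + \<delta>)" using x(1) by (cases "x = 0") (simp_all add: powr_add[symmetric])
    also have "\<dots> \<le> (5 * (N * E) powr (3 / 4)) powr (2 / 3 - \<delta>) * (sqrt (N * (2 * S + 4 * E))) powr (1 / 3 + \<delta>)"
      using x \<delta> by (intro mult_mono powr_mono2) auto
    also have "\<dots> = ?A * (N powr (3 / 4 * (2 / 3 - \<delta>)) * N powr (1 / 2 * (1 / 3 + \<delta>)))"
      using T E S by (simp add: powr_mult powr_powr real_sqrt_mult powr_half_sqrt[symmetric] mult_ac)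
    also have "N powr (3 / 4 * (2 / 3 - \<delta>)) * N powr (1 / 2 * (1 / 3 + \<delta>)) = N powr (2 / 3 - \<delta> / 4)"
      using T by (simp add: powr_add[symmetric] algebra_simps)
    finally show "(\<Sum>k\<in>T. ?g k) \<le> ?A * N powr (2 / 3 - \<delta> / 4)" by (simp add: x_def)
  qed (use \<delta> K in \<open>auto intro!: mult_nonneg_nonneg\<close>)
  then show ?thesis by (simp add: algebra_simps)
qed

text \<open>Bernoulli's inequality bounds the inverse from below by 1 + n x, hence by (n x) powr s.
  This is the discrete analogue of the decay of exp(- y) against y powr (- s); s distributes the
  decay between time and frequency.\<close>

lemma damping_le:
  assumes x: "(0::real) < x" and n: "0 < n" and s: "0 \<le> s" "s \<le> 1"
  shows "(1 / (1 + x)) ^ n \<le> (real n * x) powr (- s)"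
proof -
  have nx: "0 < real n * x" using x n by simp
  have "(real n * x) powr s \<le> 1 + real n * x"
  proof (cases "real n * x \<le> 1")
    case True
    then have "(real n * x) powr s \<le> 1" using nx s by (intro powr_le1) auto
    then show ?thesis using nx by linarith
  next
    case False
    then have "(real n * x) powr s \<le> (real n * x) powr 1" using s by (intro powr_mono) auto
    then show ?thesis using nx by simp
  qed
  also have "\<dots> \<le> (1 + x) ^ n" using Bernoulli_inequality[of x n] x by simp
  finally have "(real n * x) powr s \<le> (1 + x) ^ n" .
  moreover have "0 < (real n * x) powr s" using nx by (metis less_irrefl powr_gt_zero)
  ultimately have "1 / (1 + x) ^ n \<le> 1 / (real n * x) powr s" by (intro frac_le) auto
  then show ?thesis by (simp add: powr_minus_divide power_one_over)
qed

lemma sum_powr_le: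
  assumes s: "0 < s" "s < 1"
  shows "(\<Sum>n=1..j. real n powr (- s)) \<le> real j powr (1 - s) / (1 - s)"
proof (induction j)
  case (Suc j)
  have "(1 - s) * real (Suc j) powr (- s) \<le> real (Suc j) powr (1 - s) - real j powr (1 - s)"
  proof (cases "j = 0")
    case True
    then show ?thesis using s by simp
  next
    case False
    have "\<exists>z. real j < z \<and> z < real (Suc j) \<and> real (Suc j) powr (1 - s) - real j powr (1 - s) = (real (Suc j) - real j) * ((1 - s) * z powr (- s))"
    proof (rule MVT2)
      fix x assume "real j \<le> x"
      then have "x > 0" using False by simp
      then show "((\<lambda>x. x powr (1 - s)) has_real_derivative (1 - s) * x powr (- s)) (at x)"
        using has_real_derivative_powr[of x "1 - s"] by simp
    qed simp
    then obtain z where z: "real j < z" "z < real (Suc j)" "real (Suc j) powr (1 - s) - real j powr (1 - s) = (1 - s) * z powr (- s)" by auto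
    have "real (Suc j) powr (- s) \<le> z powr (- s)" using z False s by (intro powr_mono2') auto
    then show ?thesis using z(3) s by (simp add: mult_left_mono)
  qed
  then have "real (Suc j) powr (- s) \<le> (real (Suc j) powr (1 - s) - real j powr (1 - s)) / (1 - s)"
    using s by (simp add: pos_le_divide_eq mult.commute)
  then show ?case using Suc by (simp add: diff_divide_distrib)
qed simp

text \<open>The solution z of the recursion with the noise alone is subtracted before absolute
  values are taken: the forcing may be summed in absolute value, but the noise is small only through
  cancellation in time.\<close>

lemma linear_recursion_bound:
  fixes x z F :: "nat \<Rightarrow> real"
  assumes a: "0 \<le> a" "a \<le> 1" and b: "0 \<le> b"
    and x: "\<And>i. 1 \<le> i \<Longrightarrow> i \<le> j \<Longrightarrow> x i = a * (x (i - 1) - b * F i + N i)"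
    and z: "z 0 = 0" "\<And>i. z (Suc i) = a * (z i + N (Suc i))"
  shows "\<bar>x j\<bar> \<le> \<bar>x 0\<bar> + b * (\<Sum>i=1..j. a ^ (j - i + 1) * \<bar>F i\<bar>) + \<bar>z j\<bar>"
proof -
  have "\<bar>x i - z i\<bar> \<le> \<bar>x 0\<bar> + b * (\<Sum>l=1..i. a ^ (i - l + 1) * \<bar>F l\<bar>)" if "i \<le> j" for i
    using that
  proof (induction i)
    case (Suc i)
    have "x (Suc i) - z (Suc i) = a * ((x i - z i) - b * F (Suc i))"
      using x[of "Suc i"] Suc.prems by (simp add: z algebra_simps)
    then have "\<bar>x (Suc i) - z (Suc i)\<bar> = a * \<bar>(x i - z i) - b * F (Suc i)\<bar>" using a by (simp add: abs_mult)
    also have "\<dots> \<le> a * (\<bar>x i - z i\<bar> + b * \<bar>F (Suc i)\<bar>)"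
      using a b by (intro mult_left_mono order_trans[OF abs_triangle_ineq4]) (simp_all add: abs_mult)
    also have "\<dots> \<le> a * (\<bar>x 0\<bar> + b * (\<Sum>l=1..i. a ^ (i - l + 1) * \<bar>F l\<bar>) + b * \<bar>F (Suc i)\<bar>)"
      using Suc a by (intro mult_left_mono add_right_mono) auto
    also have "\<dots> = a * \<bar>x 0\<bar> + b * (\<Sum>l=1..Suc i. a ^ (Suc i - l + 1) * \<bar>F l\<bar>)"
    proof -
      have "(\<Sum>l=1..i. a ^ (Suc i - l + 1) * \<bar>F l\<bar>) = a * (\<Sum>l=1..i. a ^ (i - l + 1) * \<bar>F l\<bar>)"
        unfolding sum_distrib_left by (intro sum.cong refl) (simp add: Suc_diff_le)
      then show ?thesis by (simp add: algebra_simps)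
    qed
    also have "a * \<bar>x 0\<bar> \<le> \<bar>x 0\<bar>" using a by (simp add: mult_left_le_one_le)
    finally show ?case by simp
  qed (simp add: z)
  from this[of j] show ?thesis by simp
qed

section \<open>The scheme in cosine coordinates\<close>

text \<open>The recursion of one mode started at 0 and driven by N alone. As the scheme is implicit,
  the factor also acts on the newest input.\<close>

primrec damped_sum :: "real \<Rightarrow> (nat \<Rightarrow> real) \<Rightarrow> nat \<Rightarrow> real" where
  "damped_sum a N 0 = 0"
| "damped_sum a N (Suc i) = a * (damped_sum a N i + N (Suc i))"

text \<open>The amplification factor of one implicit Euler step for the biharmonic part of the
  equation in the mode k.\<close>

definition mode_damping :: "real \<Rightarrow> real \<Rightarrow> ('n::finite \<Rightarrow> nat) \<Rightarrow> real" where
  "mode_damping \<epsilon> \<tau> k = 1 / (1 + \<tau> * \<epsilon> * (mode_eigenvalue k)\<^sup>2)"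

lemma mode_damping_bounds:
  assumes "0 < \<epsilon>" "0 < \<tau>" shows "0 < mode_damping \<epsilon> \<tau> k" "mode_damping \<epsilon> \<tau> k \<le> 1"
proof -
  have "0 \<le> \<tau> * \<epsilon> * (mode_eigenvalue k)\<^sup>2" using assms by simp
  then show "0 < mode_damping \<epsilon> \<tau> k" "mode_damping \<epsilon> \<tau> k \<le> 1" by (auto simp: mode_damping_def)
qed

text \<open>Both equations are tested with the same cosine mode and w is eliminated. The
  nonlinearity at the new time stays on the right as if it were given data, since only bounds from
  the energy are used for it.\<close>

lemma CH_scheme_mode:
  fixes X :: "nat \<Rightarrow> real^'n::finite \<Rightarrow> real"
  assumes scheme: "CH_scheme \<epsilon> \<gamma> \<tau> J dW u0 X w" and "0 < \<epsilon>" "0 < \<tau>" and u0: "u0 \<in> H1_space" and i: "1 \<le> i" "i \<le> J"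
  shows "cosine_coeff (X i) k = mode_damping \<epsilon> \<tau> k * (cosine_coeff (X (i - 1)) k
     - \<tau> / \<epsilon> * mode_eigenvalue k * cosine_coeff (\<lambda>x. f_pot (X i x)) k + \<epsilon> powr \<gamma> * L2_inner (dW i) (cos_mode k))"
proof -
  have H: "X i \<in> H1_space" "w i \<in> H1_space" using scheme i by (auto simp: CH_scheme_def)
  have H': "X (i - 1) \<in> H1_space"
  proof (cases "i = 1")
    case True
    then show ?thesis using scheme u0 by (simp add: CH_scheme_def)
  next
    case False
    then have "i - 1 \<in> {1..J}" using i by auto
    then show ?thesis using scheme by (auto simp: CH_scheme_def)
  qed
  have i': "i \<in> {1..J}" using i by simp
  have e1: "L2_inner (\<lambda>x. X i x - X (i - 1) x) (cos_mode k) + \<tau> * L2_inner_vec (weak_grad (w i)) (weak_grad (cos_mode k))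
     = \<epsilon> powr \<gamma> * L2_inner (dW i) (cos_mode k)"
    and e2: "\<epsilon> * L2_inner_vec (weak_grad (X i)) (weak_grad (cos_mode k)) + 1 / \<epsilon> * L2_inner (\<lambda>x. f_pot (X i x)) (cos_mode k)
     = L2_inner (w i) (cos_mode k)"
    using scheme i' cos_mode_H1 unfolding CH_scheme_def by blast+
  define l where "l = mode_eigenvalue k"
  define x y F n where "x = cosine_coeff (X i) k" and "y = cosine_coeff (X (i - 1)) k" and "F = cosine_coeff (\<lambda>x. f_pot (X i x)) k"
    and "n = \<epsilon> powr \<gamma> * L2_inner (dW i) (cos_mode k)"
  have "x - y + \<tau> * (l * cosine_coeff (w i) k) = n"
  proof -
    have "L2_inner (\<lambda>x. X i x - X (i - 1) x) (cos_mode k) = x - y"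
      unfolding x_def y_def cosine_coeff_def by (intro L2_inner_diff_left H1_L2 H H' trig_mode_L2)
    then show ?thesis using e1 unfolding weak_grad_cos_mode[OF H(2)] l_def n_def by simp
  qed
  moreover have "cosine_coeff (w i) k = \<epsilon> * (l * x) + 1 / \<epsilon> * F"
    using e2 by (simp add: x_def F_def l_def weak_grad_cos_mode H cosine_coeff_def)
  ultimately have "x * (1 + \<tau> * \<epsilon> * l\<^sup>2) = y - \<tau> / \<epsilon> * l * F + n"
    by (simp add: algebra_simps power2_eq_square)
  moreover have "0 < 1 + \<tau> * \<epsilon> * l\<^sup>2" using assms by (simp add: add_pos_nonneg)
  ultimately show ?thesis
    unfolding mode_damping_def x_def[symmetric] y_def[symmetric] F_def[symmetric] n_def[symmetric] l_def[symmetric]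
    by (simp add: field_simps)
qed

text \<open>Both summands of the energy are bounded by b separately. The potential controls the
  fourth power through x^4 <= 8 F(x) + 2, that is, (x^2 - 2)^2 >= 0.\<close>

lemma energy_bounds:
  fixes u :: "real^'n::finite \<Rightarrow> real"
  assumes u: "u \<in> L2_space" and b: "energy \<epsilon> u \<le> ennreal b" "0 \<le> b" and \<epsilon>: "0 < \<epsilon>"
  shows "L2_inner_vec (weak_grad u) (weak_grad u) \<le> 2 * b / \<epsilon>"
    and "(\<integral>\<^sup>+x. ennreal (u x ^ 4) \<partial>cube_measure) \<le> ennreal (8 * (\<epsilon> * b) + 2)"
proof -
  have "ennreal (\<epsilon> / 2 * L2_inner_vec (weak_grad u) (weak_grad u)) \<le> ennreal b"
    using b(1) unfolding energy_def by (rule order_trans[rotated]) simp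
  then show "L2_inner_vec (weak_grad u) (weak_grad u) \<le> 2 * b / \<epsilon>"
    using b(2) \<epsilon> by (simp add: ennreal_le_iff field_simps)
  interpret prob_space "cube_measure :: (real^'n) measure" by (rule prob_space_cube)
  have [measurable]: "u \<in> borel_measurable cube_measure" by (rule L2_measurable[OF u])
  define F where "F = (\<integral>\<^sup>+x. ennreal \<bar>F_pot (u x)\<bar> \<partial>cube_measure)"
  have "ennreal (1 / \<epsilon>) * F \<le> ennreal b"
    using b(1) unfolding energy_def F_def by (rule order_trans[rotated]) simp
  then have "ennreal \<epsilon> * (ennreal (1 / \<epsilon>) * F) \<le> ennreal \<epsilon> * ennreal b" by (rule mult_left_mono) simp
  moreover have "ennreal \<epsilon> * (ennreal (1 / \<epsilon>) * F) = F"
    unfolding mult.assoc[symmetric] ennreal_mult''[symmetric, OF less_imp_le[OF divide_pos_pos[OF zero_less_one \<epsilon>]]] using \<epsilon> by simp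
  ultimately have F: "F \<le> ennreal (\<epsilon> * b)" using \<epsilon> b(2) by (simp add: ennreal_mult)
  have "x ^ 4 \<le> 8 * \<bar>F_pot x\<bar> + 2" for x
  proof -
    have "0 \<le> (x\<^sup>2 - 2)\<^sup>2" by simp
    moreover have "x ^ 4 = x\<^sup>2 * x\<^sup>2" by (simp add: power_add[symmetric])
    moreover have "\<bar>F_pot x\<bar> = (x\<^sup>2 - 1)\<^sup>2 / 4" by (simp add: F_pot_def)
    ultimately show ?thesis by (simp add: power2_eq_square algebra_simps)
  qed
  note x4 = this
  have e: "ennreal 8 * ennreal y + ennreal 2 = ennreal (8 * y + 2)" if "0 \<le> y" for y
    using that by (simp add: ennreal_mult)
  have "(\<integral>\<^sup>+x. ennreal (u x ^ 4) \<partial>cube_measure) \<le> (\<integral>\<^sup>+x. ennreal 8 * ennreal \<bar>F_pot (u x)\<bar> + ennreal 2 \<partial>cube_measure)"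
    unfolding e[OF abs_ge_zero] by (intro nn_integral_mono ennreal_leI x4)
  also have "\<dots> = ennreal 8 * F + ennreal 2"
    unfolding F_def F_pot_def using emeasure_space_1 by (subst nn_integral_add) (simp_all add: nn_integral_cmult)
  also have "\<dots> \<le> ennreal 8 * ennreal (\<epsilon> * b) + ennreal 2" by (intro add_right_mono mult_left_mono F) simp
  also have "\<dots> = ennreal (8 * (\<epsilon> * b) + 2)"
    using \<epsilon> b(2) by (intro e) simp
  finally show "(\<integral>\<^sup>+x. ennreal (u x ^ 4) \<partial>cube_measure) \<le> ennreal (8 * (\<epsilon> * b) + 2)" .
qed

text \<open>The damping, raised to n, contributes (n \<tau> \<epsilon> \<lambda>^2) powr (- s). Of
  the factor \<tau> \<lambda> in front this leaves \<tau> powr (1 - s) n powr (- s), whose sum over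
  time is bounded for s < 1, and \<lambda> powr (1 - 2 s) for the sum over the modes.\<close>

lemma mode_forcing_le:
  fixes k :: "'n::finite \<Rightarrow> nat"
  assumes "0 < \<epsilon>" "0 < \<tau>" "0 < n" "k \<noteq> (\<lambda>_. 0)" "1 / 2 \<le> s" "s \<le> 1"
  shows "\<tau> / \<epsilon> * mode_eigenvalue k * mode_damping \<epsilon> \<tau> k ^ n
    \<le> \<epsilon> powr (- 1 - s) * (\<tau> powr (1 - s) * real n powr (- s)) * mode_weight k powr (- (2 * s - 1))"
proof -
  define l where "l = mode_eigenvalue k"
  have l: "mode_weight k \<le> l" "0 < l" using mode_weight_le_eigenvalue[OF assms(4)] mode_weight_pos[of k] by (auto simp: l_def)
  have "mode_damping \<epsilon> \<tau> k ^ n \<le> (real n * (\<tau> * \<epsilon> * l\<^sup>2)) powr (- s)"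
    unfolding mode_damping_def l_def[symmetric] using assms l by (intro damping_le) auto
  also have "\<dots> = real n powr (- s) * \<tau> powr (- s) * \<epsilon> powr (- s) * l powr (- (2 * s))"
    using assms l power_powr[OF l(2), of 2 "- s"] by (simp add: powr_mult mult.assoc)
  finally have "\<tau> / \<epsilon> * l * mode_damping \<epsilon> \<tau> k ^ n \<le> \<tau> / \<epsilon> * l * (real n powr (- s) * \<tau> powr (- s) * \<epsilon> powr (- s) * l powr (- (2 * s)))"
    using assms l by (intro mult_left_mono) auto
  also have "\<dots> = (\<epsilon> powr (- 1) * \<epsilon> powr (- s)) * ((\<tau> powr 1 * \<tau> powr (- s)) * real n powr (- s)) * (l powr 1 * l powr (- (2 * s)))"
    using assms l by (simp add: powr_minus_divide)
  also have "\<dots> = \<epsilon> powr (- 1 - s) * (\<tau> powr (1 - s) * real n powr (- s)) * l powr (- (2 * s - 1))"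
    unfolding powr_add[symmetric] by simp
  also have "\<dots> \<le> \<epsilon> powr (- 1 - s) * (\<tau> powr (1 - s) * real n powr (- s)) * mode_weight k powr (- (2 * s - 1))"
    using l assms mode_weight_pos[of k] by (intro mult_left_mono powr_mono2') auto
  finally show ?thesis by (simp add: l_def)
qed

text \<open>For \<delta> = 0 the exponent would be - 5/2 - \<theta>. A positive \<delta> costs 11/8
  \<delta> + 3/4 \<delta> \<theta>, which has to stay below the spare 1; the choice 1 / (3 +
  \<theta>) achieves this for every \<theta>.\<close>

lemma exponent_bookkeeping:
  fixes \<epsilon> \<theta> \<delta> :: real
  assumes \<epsilon>: "0 < \<epsilon>" "\<epsilon> < 1" and \<theta>: "0 < \<theta>" and \<delta>: "\<delta> = 1 / (3 + \<theta>)"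
  shows "\<epsilon> powr (- 1 - (1 - \<delta> / 8)) * (\<epsilon> powr (- (\<theta> * (3 / 4) * (2 / 3 - \<delta>))) * \<epsilon> powr ((- 3 - 3 * \<theta>) / 2 * (1 / 3 + \<delta>)))
     \<le> \<epsilon> powr (- (7 / 2) - \<theta>)"
proof -
  have d: "\<delta> * (3 + \<theta>) = 1" "0 < \<delta>" using \<theta> unfolding \<delta> by simp_all
  have e: "- (7 / 2) - \<theta> \<le> - 1 - (1 - \<delta> / 8) + (- (\<theta> * (3 / 4) * (2 / 3 - \<delta>)) + (- 3 - 3 * \<theta>) / 2 * (1 / 3 + \<delta>))"
  proof -
    have "\<delta> * \<theta> = 1 - 3 * \<delta>" using d(1) by (simp add: distrib_left)
    moreover have "\<delta> \<le> 1 / 3" using \<theta> unfolding \<delta> by (intro divide_left_mono) auto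
    moreover have "- 1 - (1 - \<delta> / 8) + (- (\<theta> * (3 / 4) * (2 / 3 - \<delta>)) + (- 3 - 3 * \<theta>) / 2 * (1 / 3 + \<delta>))
      = - 5 / 2 - \<theta> - 11 / 8 * \<delta> - 3 / 4 * (\<delta> * \<theta>)" by (simp add: field_simps)
    ultimately show ?thesis using d by argo
  qed
  have "\<epsilon> powr (- 1 - (1 - \<delta> / 8)) * (\<epsilon> powr (- (\<theta> * (3 / 4) * (2 / 3 - \<delta>))) * \<epsilon> powr ((- 3 - 3 * \<theta>) / 2 * (1 / 3 + \<delta>)))
     = \<epsilon> powr (- 1 - (1 - \<delta> / 8) + (- (\<theta> * (3 / 4) * (2 / 3 - \<delta>)) + (- 3 - 3 * \<theta>) / 2 * (1 / 3 + \<delta>)))"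
    by (simp only: powr_add)
  also have "\<dots> \<le> \<epsilon> powr (- (7 / 2) - \<theta>)" by (rule powr_mono'[OF e]) (use \<epsilon> in auto)
  finally show ?thesis .
qed

text \<open>The part of the argument that holds for one realisation; the noise is passed on as a sum
  of damped sums. The constant mode is taken out because its eigenvalue is 0 and nothing damps it;
  the energy bounds it directly.\<close>

lemma CH_scheme_coeff_bound:
  assumes card: "CARD('n::finite) \<in> {2, 3}" and T: "0 < T" and \<theta>: "0 < \<theta>" and CE: "0 < C\<^sub>E"
  obtains C where "0 < C"
    "\<And>\<epsilon> \<gamma> \<tau> J dW u0 (X :: nat \<Rightarrow> real^'n \<Rightarrow> real) w j K.
      0 < \<epsilon> \<Longrightarrow> \<epsilon> < 1 \<Longrightarrow> 0 < \<tau> \<Longrightarrow> real J * \<tau> = T \<Longrightarrow> CH_scheme \<epsilon> \<gamma> \<tau> J dW u0 X w \<Longrightarrow> u0 \<in> H2_space \<Longrightarrow>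
      (\<And>i. 1 \<le> i \<Longrightarrow> i \<le> J \<Longrightarrow> energy \<epsilon> (X i) \<le> ennreal (C\<^sub>E * \<epsilon> powr (- \<theta>))) \<Longrightarrow>
      1 \<le> j \<Longrightarrow> j \<le> J \<Longrightarrow> finite K \<Longrightarrow>
      (\<Sum>k\<in>K. \<bar>cosine_coeff (X j) k\<bar>) \<le> C * (H2_norm u0 + \<epsilon> powr (- (7 / 2) - \<theta>))
        + (\<Sum>k\<in>K - {\<lambda>_. 0}. \<bar>damped_sum (mode_damping \<epsilon> \<tau> k) (\<lambda>i. \<epsilon> powr \<gamma> * L2_inner (dW i) (cos_mode k)) j\<bar>)"
proof -
  have card3: "CARD('n) \<le> 3" using card by auto
  obtain C0 where C0: "C0 > 0"
    "\<And>(u :: real^'n \<Rightarrow> real) K. u \<in> H2_space \<Longrightarrow> finite K \<Longrightarrow> (\<Sum>k\<in>K. \<bar>cosine_coeff u k\<bar>) \<le> C0 * H2_norm u"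
    using sum_abs_cos_coeff_H2_le[OF card] by metis
  define \<delta> where "\<delta> = 1 / (3 + \<theta>)"
  have \<delta>: "0 < \<delta>" "\<delta> \<le> 1 / 3" using \<theta> by (auto simp: \<delta>_def field_simps)
  \<comment> \<open>Chosen so that 2 s - 1 = 1 - \<delta>/4, the weight exponent with which the
    coefficients of the nonlinearity were summed.\<close>
  define s where "s = 1 - \<delta> / 8"
  have s: "1 / 2 \<le> s" "s < 1" "0 < s" using \<delta> by (auto simp: s_def)
  \<comment> \<open>Constants, with the powers of \<epsilon> split off, for the fourth moment (e0),
    for the squared H^1 norm (g0 = 2 e0 + 2 C_E), and for the combination of sixth and fourth
    moments that bounds the square of f(X) (d0).\<close>
  define e0 where "e0 = 8 * C\<^sub>E + 2"
  define g0 where "g0 = 18 * C\<^sub>E + 4"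
  define d0 where "d0 = 2 * (10 ^ 17 * g0 ^ 3) + 4 * e0"
  have pos0: "0 < e0" "0 < g0" "0 < d0" "1 \<le> e0" using CE by (auto simp: e0_def g0_def d0_def intro!: add_pos_pos)
  define c2 where "c2 = 8 powr (2 / 3 - \<delta> / 4) / (1 - 2 powr (- (\<delta> / 4))) * ((5 * e0 powr (3 / 4)) powr (2 / 3 - \<delta>) * sqrt d0 powr (1 / 3 + \<delta>))"
  have "2 powr (- (\<delta> / 4)) < (1::real)" using \<delta> by (intro powr_less_one) auto
  then have c2: "0 \<le> c2" unfolding c2_def using pos0 by (intro mult_nonneg_nonneg divide_nonneg_nonneg) auto
  define C where "C = C0 + sqrt (2 * e0) + c2 * (T powr (1 - s) / (1 - s))"
  have Cparts: "0 < C0" "0 \<le> sqrt (2 * e0)" "0 \<le> c2 * (T powr (1 - s) / (1 - s))" using C0 pos0 c2 s T by auto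
  then have C: "0 < C" unfolding C_def by linarith
  show ?thesis
  proof (rule that[OF C])
    fix \<epsilon> \<gamma> \<tau> :: real and J dW u0 and X :: "nat \<Rightarrow> real^'n \<Rightarrow> real" and w j and K :: "('n \<Rightarrow> nat) set"
    assume \<epsilon>: "0 < \<epsilon>" "\<epsilon> < 1" and \<tau>: "0 < \<tau>" "real J * \<tau> = T" and scheme: "CH_scheme \<epsilon> \<gamma> \<tau> J dW u0 X w"
      and u0: "u0 \<in> H2_space" and en: "\<And>i. 1 \<le> i \<Longrightarrow> i \<le> J \<Longrightarrow> energy \<epsilon> (X i) \<le> ennreal (C\<^sub>E * \<epsilon> powr (- \<theta>))"
      and j: "1 \<le> j" "j \<le> J" and K: "finite K"
    define E where "E = e0 * \<epsilon> powr (- \<theta>)"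
    define G where "G = g0 * \<epsilon> powr (- 1 - \<theta>)"
    define S where "S = 10 ^ 17 * G ^ 3"
    have u01: "u0 \<in> H1_space" using u0 by (simp add: H2_space_def)
    have eps1: "1 \<le> \<epsilon> powr (- \<theta>)" using powr_mono'[of "- \<theta>" 0 \<epsilon>] \<epsilon> \<theta> by simp
    have eps2: "\<epsilon> powr (- \<theta>) \<le> \<epsilon> powr (- 1 - \<theta>)" using \<epsilon> by (intro powr_mono') auto
    have E1: "1 \<le> E" unfolding E_def using mult_mono[OF pos0(4) eps1] pos0 by simp
    have S0: "0 \<le> S" using pos0 \<epsilon> by (simp add: S_def G_def)
    have XH: "X i \<in> H1_space" if "1 \<le> i" "i \<le> J" for i using scheme that by (auto simp: CH_scheme_def)
    have X4: "(\<integral>\<^sup>+x. ennreal (X i x ^ 4) \<partial>cube_measure) \<le> ennreal E" if i: "1 \<le> i" "i \<le> J" for i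
    proof (rule order_trans[OF energy_bounds(2)[OF H1_L2[OF XH[OF i]] en[OF i]]])
      have "\<epsilon> * (C\<^sub>E * \<epsilon> powr (- \<theta>)) \<le> 1 * (C\<^sub>E * \<epsilon> powr (- \<theta>))" using \<epsilon> CE by (intro mult_right_mono) auto
      then have "8 * (\<epsilon> * (C\<^sub>E * \<epsilon> powr (- \<theta>))) + 2 \<le> E" using eps1 by (simp add: E_def e0_def algebra_simps)
      then show "ennreal (8 * (\<epsilon> * (C\<^sub>E * \<epsilon> powr (- \<theta>))) + 2) \<le> ennreal E" by (rule ennreal_leI)
    qed (use CE \<epsilon> in auto)
    have X6: "(\<integral>\<^sup>+x. ennreal (X i x ^ 6) \<partial>cube_measure) \<le> ennreal S" if i: "1 \<le> i" "i \<le> J" for i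
      unfolding S_def
    proof (rule Sobolev_L6[OF card3 H1_L2[OF XH[OF i]]])
      show "0 < G" using pos0 \<epsilon> by (simp add: G_def)
      fix L :: "('n \<Rightarrow> nat) set" assume L: "finite L"
      have "L2_inner_vec (weak_grad (X i)) (weak_grad (X i)) \<le> 2 * (C\<^sub>E * \<epsilon> powr (- \<theta>)) / \<epsilon>"
        using CE by (intro energy_bounds(1)[OF H1_L2[OF XH[OF i]] en[OF i]] \<epsilon>) auto
      also have "\<dots> = 2 * C\<^sub>E * \<epsilon> powr (- 1 - \<theta>)" using \<epsilon> by (simp add: powr_diff powr_minus_divide)
      finally have "L2_inner_vec (weak_grad (X i)) (weak_grad (X i)) \<le> 2 * C\<^sub>E * \<epsilon> powr (- 1 - \<theta>)" .
      moreover have "L2_inner (X i) (X i) \<le> 2 * E" by (rule L2_inner_self_le_L4[OF H1_L2[OF XH[OF i]] E1 X4[OF i]])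
      moreover have "2 * E \<le> 2 * e0 * \<epsilon> powr (- 1 - \<theta>)" using eps2 pos0 by (simp add: E_def)
      ultimately have "L2_inner (X i) (X i) + L2_inner_vec (weak_grad (X i)) (weak_grad (X i)) \<le> G"
        by (simp add: G_def g0_def e0_def algebra_simps)
      then show "(\<Sum>k\<in>L. mode_weight k * (cosine_coeff (X i) k)\<^sup>2) \<le> G" using cos_coeff_H1_le[OF XH[OF i] L] by linarith
    qed
    show "(\<Sum>k\<in>K. \<bar>cosine_coeff (X j) k\<bar>) \<le> C * (H2_norm u0 + \<epsilon> powr (- (7 / 2) - \<theta>))
        + (\<Sum>k\<in>K - {\<lambda>_. 0}. \<bar>damped_sum (mode_damping \<epsilon> \<tau> k) (\<lambda>i. \<epsilon> powr \<gamma> * L2_inner (dW i) (cos_mode k)) j\<bar>)"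
    proof -
      define p where "p = 2 * s - 1"
      have p: "p = 1 - \<delta> / 4" by (simp add: p_def s_def)
      define B where "B = c2 * (\<epsilon> powr (- (\<theta> * (3 / 4) * (2 / 3 - \<delta>))) * \<epsilon> powr ((- 3 - 3 * \<theta>) / 2 * (1 / 3 + \<delta>)))"
      define F where "F i k = \<bar>cosine_coeff (\<lambda>x. f_pot (X i x)) k\<bar>" for i k
      define L where "L = K - {\<lambda>_. 0}"
      have L: "finite L" "k \<in> L \<Longrightarrow> k \<noteq> (\<lambda>_. 0)" for k using K by (auto simp: L_def)
      have FB: "(\<Sum>k\<in>L. mode_weight k powr (- p) * F i k) \<le> B" if i: "1 \<le> i" "i \<le> J" for i
      proof -
        have E34: "(5 * E powr (3 / 4)) powr (2 / 3 - \<delta>) = (5 * e0 powr (3 / 4)) powr (2 / 3 - \<delta>) * \<epsilon> powr (- (\<theta> * (3 / 4) * (2 / 3 - \<delta>)))"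
          using pos0 \<epsilon> by (simp add: E_def powr_mult powr_powr mult_ac)
        have "2 * S + 4 * E \<le> d0 * \<epsilon> powr (- 3 - 3 * \<theta>)"
        proof -
          have "(\<epsilon> powr (- 1 - \<theta>)) ^ 3 = \<epsilon> powr (- 3 - 3 * \<theta>)" using \<epsilon> by (simp add: powr_power algebra_simps)
          then have "S = 10 ^ 17 * g0 ^ 3 * \<epsilon> powr (- 3 - 3 * \<theta>)" by (simp add: S_def G_def power_mult_distrib)
          moreover have "\<epsilon> powr (- \<theta>) \<le> \<epsilon> powr (- 3 - 3 * \<theta>)" using \<epsilon> \<theta> by (intro powr_mono') auto
          then have "E \<le> e0 * \<epsilon> powr (- 3 - 3 * \<theta>)" using pos0 by (simp add: E_def)
          ultimately show ?thesis by (simp add: d0_def algebra_simps)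
        qed
        then have "sqrt (2 * S + 4 * E) \<le> sqrt d0 * \<epsilon> powr ((- 3 - 3 * \<theta>) / 2)"
        proof -
          assume "2 * S + 4 * E \<le> d0 * \<epsilon> powr (- 3 - 3 * \<theta>)"
          then have "sqrt (2 * S + 4 * E) \<le> sqrt (d0 * \<epsilon> powr (- 3 - 3 * \<theta>))" by (rule real_sqrt_le_mono)
          also have "\<dots> = sqrt d0 * \<epsilon> powr ((- 3 - 3 * \<theta>) / 2)"
            unfolding real_sqrt_mult by (subst (2) powr_half_sqrt[symmetric]) (simp_all add: powr_powr)
          finally show ?thesis .
        qed
        then have "sqrt (2 * S + 4 * E) powr (1 / 3 + \<delta>) \<le> (sqrt d0 * \<epsilon> powr ((- 3 - 3 * \<theta>) / 2)) powr (1 / 3 + \<delta>)"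
          using S0 E1 \<delta> by (intro powr_mono2) auto
        also have "\<dots> = sqrt d0 powr (1 / 3 + \<delta>) * \<epsilon> powr ((- 3 - 3 * \<theta>) / 2 * (1 / 3 + \<delta>))"
          using pos0 by (simp add: powr_mult powr_powr)
        finally have D: "sqrt (2 * S + 4 * E) powr (1 / 3 + \<delta>) \<le> sqrt d0 powr (1 / 3 + \<delta>) * \<epsilon> powr ((- 3 - 3 * \<theta>) / 2 * (1 / 3 + \<delta>))" .
        have "(\<Sum>k\<in>L. mode_weight k powr (- p) * F i k) \<le> 8 powr (2 / 3 - \<delta> / 4) / (1 - 2 powr (- (\<delta> / 4))) *
          ((5 * E powr (3 / 4)) powr (2 / 3 - \<delta>) * (sqrt (2 * S + 4 * E)) powr (1 / 3 + \<delta>))"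
          unfolding F_def p by (rule sum_weighted_f_pot_coeff_le[OF card3 H1_L2[OF XH[OF i]] E1 X4[OF i] S0 X6[OF i] \<delta> L(1)])
        also have "\<dots> \<le> 8 powr (2 / 3 - \<delta> / 4) / (1 - 2 powr (- (\<delta> / 4))) *
          (((5 * e0 powr (3 / 4)) powr (2 / 3 - \<delta>) * \<epsilon> powr (- (\<theta> * (3 / 4) * (2 / 3 - \<delta>)))) *
           (sqrt d0 powr (1 / 3 + \<delta>) * \<epsilon> powr ((- 3 - 3 * \<theta>) / 2 * (1 / 3 + \<delta>))))"
          unfolding E34 using D \<open>2 powr (- (\<delta> / 4)) < (1::real)\<close> by (intro mult_left_mono) auto
        also have "\<dots> = B" by (simp add: B_def c2_def mult_ac)
        finally show ?thesis .
      qed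
      have B0: "0 \<le> B" unfolding B_def using c2 by simp
      define q where "q n = \<epsilon> powr (- 1 - s) * (\<tau> powr (1 - s) * real n powr (- s))" for n
      have q0: "0 \<le> q n" for n by (simp add: q_def)
      have modes: "\<bar>cosine_coeff (X j) k\<bar> \<le> \<bar>cosine_coeff u0 k\<bar> + (\<Sum>i=1..j. q (j + 1 - i) * (mode_weight k powr (- p) * F i k))
          + \<bar>damped_sum (mode_damping \<epsilon> \<tau> k) (\<lambda>i. \<epsilon> powr \<gamma> * L2_inner (dW i) (cos_mode k)) j\<bar>"
        if k: "k \<noteq> (\<lambda>_. 0)" for k
      proof -
        let ?b = "\<tau> / \<epsilon> * mode_eigenvalue k"
        have b0: "0 \<le> ?b" using \<tau> \<epsilon> by (simp add: mode_eigenvalue_def sum_nonneg)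
        have "\<bar>cosine_coeff (X j) k\<bar> \<le> \<bar>cosine_coeff (X 0) k\<bar> + ?b * (\<Sum>i=1..j. mode_damping \<epsilon> \<tau> k ^ (j - i + 1) * \<bar>cosine_coeff (\<lambda>x. f_pot (X i x)) k\<bar>)
          + \<bar>damped_sum (mode_damping \<epsilon> \<tau> k) (\<lambda>i. \<epsilon> powr \<gamma> * L2_inner (dW i) (cos_mode k)) j\<bar>"
        proof (rule linear_recursion_bound[OF _ _ b0])
          show "cosine_coeff (X i) k = mode_damping \<epsilon> \<tau> k * (cosine_coeff (X (i - 1)) k - ?b * cosine_coeff (\<lambda>x. f_pot (X i x)) k
              + \<epsilon> powr \<gamma> * L2_inner (dW i) (cos_mode k))" if "1 \<le> i" "i \<le> j" for i
            using that j by (intro CH_scheme_mode[OF scheme \<epsilon>(1) \<tau>(1) u01]) auto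
        qed (use mode_damping_bounds[OF \<epsilon>(1) \<tau>(1), of k] in auto)
        also have "X 0 = u0" using scheme by (simp add: CH_scheme_def)
        also have "?b * (\<Sum>i=1..j. mode_damping \<epsilon> \<tau> k ^ (j - i + 1) * \<bar>cosine_coeff (\<lambda>x. f_pot (X i x)) k\<bar>)
          \<le> (\<Sum>i=1..j. q (j + 1 - i) * (mode_weight k powr (- p) * F i k))"
          unfolding sum_distrib_left
        proof (rule sum_mono)
          fix i assume i: "i \<in> {1..j}"
          have "?b * mode_damping \<epsilon> \<tau> k ^ (j + 1 - i) \<le> q (j + 1 - i) * mode_weight k powr (- p)"
            unfolding q_def p_def using i s by (intro mode_forcing_le \<epsilon> \<tau> k) auto
          moreover have "j - i + 1 = j + 1 - i" using i by auto
          ultimately show "?b * (mode_damping \<epsilon> \<tau> k ^ (j - i + 1) * \<bar>cosine_coeff (\<lambda>x. f_pot (X i x)) k\<bar>) \<le> q (j + 1 - i) * (mode_weight k powr (- p) * F i k)"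
            using mult_right_mono[of "?b * mode_damping \<epsilon> \<tau> k ^ (j + 1 - i)" "q (j + 1 - i) * mode_weight k powr (- p)" "F i k"]
            by (simp add: F_def mult.assoc)
        qed
        finally show ?thesis by simp
      qed
      have "(\<Sum>k\<in>K. \<bar>cosine_coeff (X j) k\<bar>) \<le> \<bar>cosine_coeff (X j) (\<lambda>_. 0)\<bar> + (\<Sum>k\<in>L. \<bar>cosine_coeff (X j) k\<bar>)"
        using K by (cases "(\<lambda>_. 0) \<in> K") (auto simp: L_def sum.remove)
      \<comment> \<open>The constant mode is bounded by the L^2 norm of X j, which costs only
        \<epsilon> powr (- \<theta>/2).\<close>
      also have "\<bar>cosine_coeff (X j) (\<lambda>_. 0)\<bar> \<le> sqrt (2 * e0) * \<epsilon> powr (- (7 / 2) - \<theta>)"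
      proof -
        have "\<bar>cosine_coeff (X j) (\<lambda>_. 0)\<bar> \<le> sqrt (L2_inner (X j) (X j))"
          using sum_abs_cos_coeff_le[OF H1_L2[OF XH[OF j]], of "{\<lambda>_. 0}"] by simp
        also have "\<dots> \<le> sqrt (2 * E)" by (intro real_sqrt_le_mono L2_inner_self_le_L4[OF H1_L2[OF XH[OF j]] E1 X4[OF j]])
        also have "\<dots> = sqrt (2 * e0) * sqrt (\<epsilon> powr (- \<theta>))" by (simp add: E_def real_sqrt_mult)
        also have "sqrt (\<epsilon> powr (- \<theta>)) = \<epsilon> powr (- \<theta> / 2)" by (subst powr_half_sqrt[symmetric]) (simp_all add: powr_powr)
        also have "\<dots> \<le> \<epsilon> powr (- (7 / 2) - \<theta>)" using \<epsilon> \<theta> by (intro powr_mono') auto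
        finally show ?thesis using pos0 by (simp add: mult_left_mono)
      qed
      also have "(\<Sum>k\<in>L. \<bar>cosine_coeff (X j) k\<bar>) \<le> (\<Sum>k\<in>L. \<bar>cosine_coeff u0 k\<bar> + (\<Sum>i=1..j. q (j + 1 - i) * (mode_weight k powr (- p) * F i k))
          + \<bar>damped_sum (mode_damping \<epsilon> \<tau> k) (\<lambda>i. \<epsilon> powr \<gamma> * L2_inner (dW i) (cos_mode k)) j\<bar>)"
        by (intro sum_mono modes L)
      also have "\<dots> = (\<Sum>k\<in>L. \<bar>cosine_coeff u0 k\<bar>) + (\<Sum>i=1..j. q (j + 1 - i) * (\<Sum>k\<in>L. mode_weight k powr (- p) * F i k))
          + (\<Sum>k\<in>L. \<bar>damped_sum (mode_damping \<epsilon> \<tau> k) (\<lambda>i. \<epsilon> powr \<gamma> * L2_inner (dW i) (cos_mode k)) j\<bar>)"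
        unfolding sum.distrib sum_distrib_left by (subst (2) sum.swap) simp
      also have "(\<Sum>k\<in>L. \<bar>cosine_coeff u0 k\<bar>) \<le> C0 * H2_norm u0" by (rule C0(2)[OF u0 L(1)])
      also have "(\<Sum>i=1..j. q (j + 1 - i) * (\<Sum>k\<in>L. mode_weight k powr (- p) * F i k)) \<le> c2 * (T powr (1 - s) / (1 - s)) * \<epsilon> powr (- (7 / 2) - \<theta>)"
      proof -
        have "(\<Sum>i=1..j. q (j + 1 - i) * (\<Sum>k\<in>L. mode_weight k powr (- p) * F i k)) \<le> (\<Sum>i=1..j. q (j + 1 - i) * B)"
          using j by (intro sum_mono mult_left_mono FB q0) auto
        \<comment> \<open>Time is counted backwards from j. The sum of n powr (- s) is then of order
          j powr (1 - s) and combines with \<tau> powr (1 - s) to a power of j \<tau> <= T, so the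
          bound does not see the step size.\<close>
        also have "\<dots> = (\<Sum>n=1..j. q n * B)" by (rule sum.atLeastAtMost_rev[of "\<lambda>n. q n * B" 1 j, symmetric, simplified add.commute[of 1]])
        also have "\<dots> = B * \<epsilon> powr (- 1 - s) * \<tau> powr (1 - s) * (\<Sum>n=1..j. real n powr (- s))"
          by (simp add: q_def sum_distrib_left mult_ac)
        also have "\<dots> \<le> B * \<epsilon> powr (- 1 - s) * \<tau> powr (1 - s) * (real j powr (1 - s) / (1 - s))"
          using B0 s by (intro mult_left_mono sum_powr_le) auto
        also have "\<dots> = B * \<epsilon> powr (- 1 - s) * ((real j * \<tau>) powr (1 - s) / (1 - s))"
          using \<tau> by (simp add: powr_mult)
        also have "\<dots> \<le> B * \<epsilon> powr (- 1 - s) * (T powr (1 - s) / (1 - s))"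
          using j \<tau> s B0 by (intro mult_left_mono divide_right_mono powr_mono2) (auto intro!: mult_right_mono)
        also have "B * \<epsilon> powr (- 1 - s) = c2 * (\<epsilon> powr (- 1 - (1 - \<delta> / 8)) * (\<epsilon> powr (- (\<theta> * (3 / 4) * (2 / 3 - \<delta>))) * \<epsilon> powr ((- 3 - 3 * \<theta>) / 2 * (1 / 3 + \<delta>))))"
          by (simp add: B_def s_def)
        also have "\<dots> * (T powr (1 - s) / (1 - s)) \<le> c2 * \<epsilon> powr (- (7 / 2) - \<theta>) * (T powr (1 - s) / (1 - s))"
          using c2 s by (intro mult_right_mono mult_left_mono exponent_bookkeeping \<epsilon> \<theta> \<delta>_def) auto
        finally show ?thesis by (simp add: mult_ac)
      qed
      finally have "(\<Sum>k\<in>K. \<bar>cosine_coeff (X j) k\<bar>) \<le> sqrt (2 * e0) * \<epsilon> powr (- (7 / 2) - \<theta>) + (C0 * H2_norm u0 + c2 * (T powr (1 - s) / (1 - s)) * \<epsilon> powr (- (7 / 2) - \<theta>)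
         + (\<Sum>k\<in>L. \<bar>damped_sum (mode_damping \<epsilon> \<tau> k) (\<lambda>i. \<epsilon> powr \<gamma> * L2_inner (dW i) (cos_mode k)) j\<bar>))" by simp
      moreover have "sqrt (2 * e0) * \<epsilon> powr (- (7 / 2) - \<theta>) + C0 * H2_norm u0 + c2 * (T powr (1 - s) / (1 - s)) * \<epsilon> powr (- (7 / 2) - \<theta>)
          \<le> C * (H2_norm u0 + \<epsilon> powr (- (7 / 2) - \<theta>))"
      proof -
        have h: "0 \<le> H2_norm u0" unfolding H2_norm_def by (auto intro!: add_nonneg_nonneg sum_nonneg L2_inner_self_nonneg)
        have "(sqrt (2 * e0) + c2 * (T powr (1 - s) / (1 - s))) * \<epsilon> powr (- (7 / 2) - \<theta>) \<le> C * \<epsilon> powr (- (7 / 2) - \<theta>)"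
          using Cparts by (intro mult_right_mono) (auto simp: C_def)
        moreover have "C0 * H2_norm u0 \<le> C * H2_norm u0" using Cparts h by (intro mult_right_mono) (auto simp: C_def)
        ultimately show ?thesis by (simp only: distrib_left distrib_right)
      qed
      ultimately show ?thesis unfolding L_def by linarith
    qed
  qed
qed

section \<open>The damped noise\<close>

text \<open>The last binary digits of i are set to 0 one at a time. A digit 0 changes nothing, and a
  digit 1 at place r moves by one dyadic interval of length 2^r; the bounds form a geometric
  series.\<close>

lemma dyadic_truncation_bound:
  fixes B :: "nat \<Rightarrow> real"
  assumes \<rho>: "1 < \<rho>" and H: "0 \<le> H"
    and B: "\<And>r b. Suc b * 2 ^ r < 2 ^ m \<Longrightarrow> \<bar>B (Suc b * 2 ^ r) - B (b * 2 ^ r)\<bar> \<le> H * \<rho> ^ r"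
    and i: "i < 2 ^ m"
  shows "\<bar>B i - B (i div 2 ^ r * 2 ^ r)\<bar> \<le> H * \<rho> ^ r / (\<rho> - 1)"
proof -
  have "\<bar>B i - B (i div 2 ^ r * 2 ^ r)\<bar> \<le> H * (\<Sum>s<r. \<rho> ^ s)"
  proof (induction r)
    case (Suc r)
    define b where "b = i div 2 ^ r"
    have b: "i div 2 ^ Suc r = b div 2" by (simp add: b_def power_Suc2 div_mult2_eq del: power_Suc)
    have le: "b * 2 ^ r \<le> i" by (simp add: b_def)
    have "\<bar>B (b * 2 ^ r) - B (b div 2 * 2 ^ Suc r)\<bar> \<le> H * \<rho> ^ r"
    proof (cases "even b")
      case True
      then have "b div 2 * 2 * 2 ^ r = b * 2 ^ r" by simp
      then have "b div 2 * 2 ^ Suc r = b * 2 ^ r" by (simp only: power_Suc mult.assoc)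
      then show ?thesis using H \<rho> by (simp only: diff_self abs_zero) simp
    next
      case False
      then obtain c where c: "b = Suc (2 * c)" by (auto elim!: oddE)
      have "\<bar>B (Suc (2 * c) * 2 ^ r) - B (2 * c * 2 ^ r)\<bar> \<le> H * \<rho> ^ r"
        by (rule B) (use le_less_trans[OF le i] in \<open>simp only: c\<close>)
      then show ?thesis by (simp add: c mult_ac)
    qed
    then have "\<bar>B i - B (i div 2 ^ Suc r * 2 ^ Suc r)\<bar> \<le> H * (\<Sum>s<r. \<rho> ^ s) + H * \<rho> ^ r"
      using Suc unfolding b b_def[symmetric] by linarith
    then show ?case by (simp only: sum.lessThan_Suc distrib_left)
  qed simp
  also have "(\<Sum>s<r. \<rho> ^ s) \<le> \<rho> ^ r / (\<rho> - 1)"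
    using \<rho> by (simp add: geometric_sum divide_right_mono)
  finally show ?thesis using H by (simp add: mult_left_mono)
qed

text \<open>Kolmogorov-Chentsov chaining on a finite grid. Both indices are truncated at a level R
  with 2^R larger than their distance, so that they land on equal or neighbouring dyadic
  points.\<close>

lemma dyadic_chaining:
  fixes B :: "nat \<Rightarrow> real"
  assumes \<alpha>: "0 < \<alpha>" and H: "0 \<le> H"
    and B: "\<And>r b. Suc b * 2 ^ r < 2 ^ m \<Longrightarrow> \<bar>B (Suc b * 2 ^ r) - B (b * 2 ^ r)\<bar> \<le> H * (2 ^ r) powr \<alpha>"
    and i: "i < i'" "i' < 2 ^ m"
  shows "\<bar>B i' - B i\<bar> \<le> 2 powr \<alpha> * (1 + 2 / (2 powr \<alpha> - 1)) * H * real (i' - i) powr \<alpha>"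
proof -
  define \<rho> :: real where "\<rho> = 2 powr \<alpha>"
  have \<rho>: "1 < \<rho>" using \<alpha> by (simp add: \<rho>_def)
  have pw: "(2 ^ r) powr \<alpha> = \<rho> ^ r" for r by (simp add: \<rho>_def power_powr powr_power mult.commute)
  have "\<exists>r. 2 ^ r \<le> i' - i \<and> i' - i < 2 ^ Suc r" using ex_power_ivl1[of 2 "i' - i"] i by simp
  then obtain r where r: "2 ^ r \<le> i' - i" "i' - i < 2 ^ Suc r" by blast
  define R where "R = Suc r"
  define b where "b = i div 2 ^ R"
  define b' where "b' = i' div 2 ^ R"
  note Bp = B[unfolded pw]
  have t: "\<bar>B i - B (b * 2 ^ R)\<bar> \<le> H * \<rho> ^ R / (\<rho> - 1)" "\<bar>B i' - B (b' * 2 ^ R)\<bar> \<le> H * \<rho> ^ R / (\<rho> - 1)"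
    unfolding b_def b'_def using i by (auto intro!: dyadic_truncation_bound[OF \<rho> H Bp])
  have "b' = b \<or> b' = Suc b"
  proof -
    have "b \<le> b'" unfolding b_def b'_def using i by (intro div_le_mono) auto
    moreover have "b' \<le> (i + 2 ^ R) div 2 ^ R" unfolding b'_def using r i by (intro div_le_mono) (auto simp: R_def)
    ultimately show ?thesis by (auto simp: b_def)
  qed
  then have "\<bar>B (b' * 2 ^ R) - B (b * 2 ^ R)\<bar> \<le> H * \<rho> ^ R"
  proof
    assume "b' = Suc b"
    moreover have "b' * 2 ^ R \<le> i'" by (simp add: b'_def)
    ultimately show ?thesis using Bp[of b R] i by simp
  qed (use H \<rho> in simp)
  with t have "\<bar>B i' - B i\<bar> \<le> H * \<rho> ^ R + 2 * (H * \<rho> ^ R / (\<rho> - 1))" by linarith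
  also have "\<dots> = (1 + 2 / (\<rho> - 1)) * H * \<rho> * \<rho> ^ r" by (simp add: R_def field_simps)
  also have "\<dots> \<le> (1 + 2 / (\<rho> - 1)) * H * \<rho> * real (i' - i) powr \<alpha>"
  proof (intro mult_left_mono)
    have "\<rho> ^ r = (2 ^ r) powr \<alpha>" by (rule pw[symmetric])
    also have "\<dots> \<le> real (i' - i) powr \<alpha>" using r(1) \<alpha> by (intro powr_mono2) (auto simp flip: of_nat_le_iff)
    finally show "\<rho> ^ r \<le> real (i' - i) powr \<alpha>" .
  qed (use \<rho> H in auto)
  finally show ?thesis by (simp add: \<rho>_def mult_ac)
qed

text \<open>The recursion with damping 1 / (1 + x) remembers about 1/x steps. The majorant has the
  right size at that distance, and affine functions, unlike powers, are reproduced by the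
  recursion.\<close>

lemma powr_le_affine:
  fixes n x \<alpha> :: real
  assumes "0 \<le> n" "0 < x" "0 < \<alpha>" "\<alpha> < 1"
  shows "n powr \<alpha> \<le> x powr (- \<alpha>) * (1 + n * x)"
proof (cases "n = 0")
  case False
  then have n: "0 < n * x" using assms by simp
  have "(n * x) powr \<alpha> \<le> 1 + n * x"
  proof (cases "n * x \<le> 1")
    case True
    then have "(n * x) powr \<alpha> \<le> 1" using n assms by (intro powr_le1) auto
    then show ?thesis using n by linarith
  next
    case False
    then have "(n * x) powr \<alpha> \<le> (n * x) powr 1" using assms by (intro powr_mono) auto
    then show ?thesis using n by simp
  qed
  then have "x powr (- \<alpha>) * (n * x) powr \<alpha> \<le> x powr (- \<alpha>) * (1 + n * x)" by (intro mult_left_mono) auto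
  moreover have "x powr (- \<alpha>) * (n * x) powr \<alpha> = n powr \<alpha>"
    using assms by (simp add: powr_mult powr_minus_divide)
  ultimately show ?thesis by simp
qed (use assms in simp)

text \<open>Summation by parts around the final value \<open>B j\<close>; an affine majorant of the Hoelder modulus
  gives a majorant of the recursion that is again affine.\<close>

lemma damped_sum_Hoelder:
  fixes B :: "nat \<Rightarrow> real"
  assumes x: "0 < x" and \<alpha>: "0 < \<alpha>" "\<alpha> < 1" and M: "0 \<le> M"
    and B: "\<And>i. i < j \<Longrightarrow> \<bar>B j - B i\<bar> \<le> M * real (j - i) powr \<alpha>"
  shows "\<bar>damped_sum (1 / (1 + x)) (\<lambda>i. B i - B (i - 1)) j\<bar> \<le> 2 * M * x powr (- \<alpha>)"
proof -
  define a where "a = 1 / (1 + x)"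
  define c where "c = M * x powr (- \<alpha>)"
  define e where "e i = B i - B j" for i
  define Y where "Y = damped_sum a (\<lambda>i. B i - B (i - 1))"
  have a: "0 < a" "a \<le> 1" "1 - a = a * x" using x by (auto simp: a_def field_simps)
  have c: "0 \<le> c" using M by (simp add: c_def)
  have e: "\<bar>e i\<bar> \<le> c * (1 + real (j - i) * x)" if "i \<le> j" for i
  proof (cases "i = j")
    case False
    then have "\<bar>e i\<bar> \<le> M * real (j - i) powr \<alpha>" using B[of i] that by (simp add: e_def abs_minus_commute)
    also have "\<dots> \<le> M * (x powr (- \<alpha>) * (1 + real (j - i) * x))" using M x \<alpha> by (intro mult_left_mono powr_le_affine) auto
    finally show ?thesis by (simp add: c_def)
  qed (use c in \<open>simp add: e_def\<close>)
  \<comment> \<open>The majorant is reproduced from one step to the next because a (1 + x) = 1. At i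
    = j the term e j vanishes, and what remains is a bound on Y j itself.\<close>
  have "\<bar>Y i - a * e i\<bar> \<le> a * c * (2 + x + real (j - i) * x)" if "i \<le> j" for i
    using that
  proof (induction i)
    case 0
    have "\<bar>Y 0 - a * e 0\<bar> = a * \<bar>e 0\<bar>" using a by (simp add: Y_def abs_mult)
    also have "\<dots> \<le> a * (c * (1 + real j * x))" using a e[of 0] by (intro mult_left_mono) auto
    also have "\<dots> \<le> a * (c * (2 + x + real j * x))" using a c x by (intro mult_left_mono) auto
    finally show ?case by (simp add: mult.assoc)
  next
    case (Suc i)
    define n where "n = real (j - Suc i)"
    have n: "real (j - i) = n + 1" using Suc.prems by (simp add: n_def)
    have "Y (Suc i) - a * e (Suc i) = a * (Y i - a * e i) - a * (1 - a) * e i"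
      by (simp add: Y_def e_def algebra_simps)
    then have "\<bar>Y (Suc i) - a * e (Suc i)\<bar> \<le> a * \<bar>Y i - a * e i\<bar> + a * (1 - a) * \<bar>e i\<bar>"
    proof -
      have "\<bar>1 - a\<bar> = 1 - a" "\<bar>a\<bar> = a" using a by auto
      then show ?thesis using abs_triangle_ineq4[of "a * (Y i - a * e i)" "a * (1 - a) * e i"]
        \<open>Y (Suc i) - a * e (Suc i) = a * (Y i - a * e i) - a * (1 - a) * e i\<close> by (simp only: abs_mult)
    qed
    also have "\<dots> \<le> a * (a * c * (2 + x + (n + 1) * x)) + a * (1 - a) * (c * (1 + (n + 1) * x))"
      using Suc e[of i] a n by (intro add_mono mult_left_mono) auto
    also have "\<dots> = a * c * (a * (2 + x) + (1 - a) + (n + 1) * x)" by (simp add: algebra_simps)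
    also have "a * (2 + x) + (1 - a) + (n + 1) * x = 2 + x + n * x"
    proof -
      have "a * (1 + x) = 1" using x by (simp add: a_def)
      then show ?thesis by (simp add: algebra_simps)
    qed
    finally show ?case by (simp add: n_def)
  qed
  from this[of j] have "\<bar>Y j\<bar> \<le> a * c * (2 + x)" by (simp add: e_def)
  also have "\<dots> = c * ((2 + x) / (1 + x))" by (simp add: a_def)
  also have "\<dots> \<le> c * 2" using c x by (intro mult_left_mono) (auto simp: divide_le_eq)
  finally show ?thesis by (simp add: Y_def a_def c_def mult_ac)
qed

lemma damped_sum_linear:
  "damped_sum a (\<lambda>i. c * (\<Sum>z\<in>Z. d z * N z i)) j = c * (\<Sum>z\<in>Z. d z * damped_sum a (N z) j)"
  by (induction j) (simp_all add: sum.distrib sum_distrib_left algebra_simps)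

section \<open>Moments of the discrete Hoelder modulus of a Brownian motion\<close>

lemma brownian_increment_moment:
  assumes "brownian_motion M B" and st: "0 \<le> s" "s < t"
  shows "(\<integral>\<^sup>+\<omega>. ennreal ((B t \<omega> - B s \<omega>) ^ 20) \<partial>M) = ennreal (fact 20 / (2 ^ 10 * fact 10) * (t - s) ^ 10)"
proof -
  define \<sigma> where "\<sigma> = sqrt (t - s)"
  have \<sigma>: "0 < \<sigma>" "\<sigma>\<^sup>2 = t - s" using st by (auto simp: \<sigma>_def)
  have d: "distributed M lborel (\<lambda>\<omega>. B t \<omega> - B s \<omega>) (\<lambda>x. ennreal (normal_density 0 \<sigma> x))"
    using assms by (auto simp: brownian_motion_def \<sigma>_def)
  have hb: "has_bochner_integral lborel (\<lambda>x. normal_density 0 \<sigma> x * x ^ 20) (fact 20 / ((2 / \<sigma>\<^sup>2) ^ 10 * fact 10))"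
    using normal_moment_even[OF \<sigma>(1), of 0 10] by simp
  have "(\<integral>\<^sup>+\<omega>. ennreal ((B t \<omega> - B s \<omega>) ^ 20) \<partial>M) = (\<integral>\<^sup>+x. ennreal (normal_density 0 \<sigma> x) * ennreal (x ^ 20) \<partial>lborel)"
    by (rule distributed_nn_integral[OF d, symmetric]) measurable
  also have "\<dots> = (\<integral>\<^sup>+x. ennreal (normal_density 0 \<sigma> x * x ^ 20) \<partial>lborel)"
    by (intro nn_integral_cong) (simp add: ennreal_mult)
  also have "\<dots> = ennreal (fact 20 / ((2 / \<sigma>\<^sup>2) ^ 10 * fact 10))"
    using hb by (subst nn_integral_eq_integral) (auto simp: has_bochner_integral_iff zero_le_even_power intro!: AE_I2 mult_nonneg_nonneg)
  also have "fact 20 / ((2 / \<sigma>\<^sup>2) ^ 10 * fact 10) = fact 20 / (2 ^ 10 * fact 10) * (t - s) ^ 10"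
    unfolding \<sigma>(2) using st by (simp add: power_divide)
  finally show ?thesis .
qed

text \<open>The exponents give the Hoelder order 8/20 = 2/5, while the expectation of each term is a
  multiple of the squared length of its interval, which makes the double sum bounded. The summand 1
  allows first powers to be replaced by higher ones.\<close>

definition grid_modulus :: "real \<Rightarrow> nat \<Rightarrow> (real \<Rightarrow> 'w \<Rightarrow> real) \<Rightarrow> 'w \<Rightarrow> real" where
  "grid_modulus \<tau> m B \<omega> = 1 + (\<Sum>r\<le>m. \<Sum>b<(2::nat) ^ (m - r).
     (B (real (Suc b * 2 ^ r) * \<tau>) \<omega> - B (real (b * 2 ^ r) * \<tau>) \<omega>) ^ 20 / (2 ^ r * \<tau>) ^ 8)"

lemma grid_modulus_ge_1: "0 < \<tau> \<Longrightarrow> 1 \<le> grid_modulus \<tau> m B \<omega>"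
  unfolding grid_modulus_def by (auto intro!: sum_nonneg divide_nonneg_nonneg)

text \<open>Level r has 2^(m-r) intervals of length 2^r \<tau> and contributes a multiple of 2^(m+r)
  \<tau>^2, so the coarsest levels dominate. The total is of order (2^m \<tau>)^2 <= 4 T^2,
  independently of the grid.\<close>

lemma grid_modulus_moment:
  assumes B: "brownian_motion M B" and M: "prob_space M" and \<tau>: "0 < \<tau>" and m: "2 ^ m \<le> 2 * J" "real J * \<tau> = T"
  shows "(\<integral>\<^sup>+\<omega>. ennreal (grid_modulus \<tau> m B \<omega>) \<partial>M) \<le> ennreal (1 + 8 * (fact 20 / (2 ^ 10 * fact 10)) * T\<^sup>2)"
    and "(\<lambda>\<omega>. ennreal (grid_modulus \<tau> m B \<omega>)) \<in> borel_measurable M"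
proof -
  interpret prob_space M by (rule M)
  define C :: real where "C = fact 20 / (2 ^ 10 * fact 10)"
  have C: "0 \<le> C" by (simp add: C_def)
  have Bm [measurable]: "B (real n * \<tau>) \<in> borel_measurable M" for n using B \<tau> by (auto simp: brownian_motion_def)
  show "(\<lambda>\<omega>. ennreal (grid_modulus \<tau> m B \<omega>)) \<in> borel_measurable M"
    unfolding grid_modulus_def by measurable
  define f where "f r b \<omega> = (B (real (Suc b * 2 ^ r) * \<tau>) \<omega> - B (real (b * 2 ^ r) * \<tau>) \<omega>) ^ 20 / (2 ^ r * \<tau>) ^ 8" for r b \<omega>
  have f0: "0 \<le> f r b \<omega>" for r b \<omega> unfolding f_def by (intro divide_nonneg_nonneg) (auto simp: zero_le_even_power)
  have fm [measurable]: "f r b \<in> borel_measurable M" for r b unfolding f_def[abs_def] by measurable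
  have fi: "(\<integral>\<^sup>+\<omega>. ennreal (f r b \<omega>) \<partial>M) = ennreal (C * (2 ^ r * \<tau>)\<^sup>2)" for r b
  proof -
    have l: "real (Suc b * 2 ^ r) * \<tau> - real (b * 2 ^ r) * \<tau> = 2 ^ r * \<tau>" by (simp add: algebra_simps)
    have "(\<integral>\<^sup>+\<omega>. ennreal (f r b \<omega>) \<partial>M) = (\<integral>\<^sup>+\<omega>. ennreal (1 / (2 ^ r * \<tau>) ^ 8) * ennreal ((B (real (Suc b * 2 ^ r) * \<tau>) \<omega> - B (real (b * 2 ^ r) * \<tau>) \<omega>) ^ 20) \<partial>M)"
      unfolding f_def by (intro nn_integral_cong) (subst ennreal_mult[symmetric], auto simp: zero_le_even_power \<tau> less_imp_le)
    also have "\<dots> = ennreal (1 / (2 ^ r * \<tau>) ^ 8) * (\<integral>\<^sup>+\<omega>. ennreal ((B (real (Suc b * 2 ^ r) * \<tau>) \<omega> - B (real (b * 2 ^ r) * \<tau>) \<omega>) ^ 20) \<partial>M)"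
      by (rule nn_integral_cmult) measurable
    also have "(\<integral>\<^sup>+\<omega>. ennreal ((B (real (Suc b * 2 ^ r) * \<tau>) \<omega> - B (real (b * 2 ^ r) * \<tau>) \<omega>) ^ 20) \<partial>M) = ennreal (C * (2 ^ r * \<tau>) ^ 10)"
      unfolding C_def l[symmetric] using \<tau> by (intro brownian_increment_moment[OF B]) (auto simp: mult_strict_right_mono)
    also have "ennreal (1 / (2 ^ r * \<tau>) ^ 8) * ennreal (C * (2 ^ r * \<tau>) ^ 10) = ennreal (C * (2 ^ r * \<tau>)\<^sup>2)"
    proof -
      have "1 / y ^ 8 * (C * y ^ 10) = C * y\<^sup>2" if "0 < y" for y :: real
        using that by (simp add: field_simps eval_nat_numeral)
      then show ?thesis using \<tau> C by (subst ennreal_mult[symmetric]) auto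
    qed
    finally show ?thesis .
  qed
  have "(\<integral>\<^sup>+\<omega>. ennreal (grid_modulus \<tau> m B \<omega>) \<partial>M) = (\<integral>\<^sup>+\<omega>. 1 + (\<Sum>r\<le>m. \<Sum>b<(2::nat) ^ (m - r). ennreal (f r b \<omega>)) \<partial>M)"
    unfolding grid_modulus_def f_def[symmetric] using f0
    by (intro nn_integral_cong) (simp add: sum_nonneg sum_ennreal)
  also have "\<dots> = 1 + (\<Sum>r\<le>m. \<Sum>b<(2::nat) ^ (m - r). ennreal (C * (2 ^ r * \<tau>)\<^sup>2))"
    using emeasure_space_1 by (simp add: nn_integral_add nn_integral_sum fi)
  also have "\<dots> = ennreal (1 + (\<Sum>r\<le>m. \<Sum>b<(2::nat) ^ (m - r). C * (2 ^ r * \<tau>)\<^sup>2))"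
  proof -
    have "(\<Sum>b<(2::nat) ^ (m - r). ennreal (C * (2 ^ r * \<tau>)\<^sup>2)) = ennreal (\<Sum>b<(2::nat) ^ (m - r). C * (2 ^ r * \<tau>)\<^sup>2)" for r
      using C by (intro sum_ennreal) simp
    moreover have "(\<Sum>r\<le>m. ennreal (\<Sum>b<(2::nat) ^ (m - r). C * (2 ^ r * \<tau>)\<^sup>2)) = ennreal (\<Sum>r\<le>m. \<Sum>b<(2::nat) ^ (m - r). C * (2 ^ r * \<tau>)\<^sup>2)"
      using C by (intro sum_ennreal) (simp add: sum_nonneg)
    ultimately show ?thesis using C by (simp only: ennreal_plus[OF zero_le_one sum_nonneg] sum_nonneg ennreal_1 mult_nonneg_nonneg zero_le_power2)
  qed
  also have "\<dots> \<le> ennreal (1 + 8 * C * T\<^sup>2)"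
  proof (intro ennreal_leI add_left_mono)
    have "(\<Sum>r\<le>m. \<Sum>b<(2::nat) ^ (m - r). C * (2 ^ r * \<tau>)\<^sup>2) = (\<Sum>r\<le>m. C * \<tau>\<^sup>2 * 2 ^ m * 2 ^ r)"
    proof (intro sum.cong refl)
      fix r assume "r \<in> {..m}"
      then have "(2::real) ^ m = 2 ^ (m - r) * 2 ^ r" by (simp add: power_add[symmetric])
      then show "(\<Sum>b<(2::nat) ^ (m - r). C * (2 ^ r * \<tau>)\<^sup>2) = C * \<tau>\<^sup>2 * 2 ^ m * 2 ^ r"
        by (simp add: power_mult_distrib power2_eq_square)
    qed
    also have "\<dots> = C * \<tau>\<^sup>2 * 2 ^ m * (\<Sum>r\<le>m. 2 ^ r)" by (simp add: sum_distrib_left)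
    also have "(\<Sum>r\<le>m. (2::real) ^ r) \<le> 2 * 2 ^ m" by (induction m) auto
    then have "C * \<tau>\<^sup>2 * 2 ^ m * (\<Sum>r\<le>m. 2 ^ r) \<le> C * \<tau>\<^sup>2 * 2 ^ m * (2 * 2 ^ m)" using C by (intro mult_left_mono) auto
    also have "\<dots> = 2 * C * (2 ^ m * \<tau>)\<^sup>2" by (simp add: power2_eq_square)
    also have "\<dots> \<le> 2 * C * (2 * T)\<^sup>2"
    proof (intro mult_left_mono power_mono)
      have "real (2 ^ m) \<le> real (2 * J)" using m(1) by (simp only: of_nat_le_iff)
      then have "2 ^ m * \<tau> \<le> 2 * real J * \<tau>" using \<tau> by (intro mult_right_mono) auto
      then show "2 ^ m * \<tau> \<le> 2 * T" using m(2) by simp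
    qed (use C \<tau> in auto)
    finally show "(\<Sum>r\<le>m. \<Sum>b<(2::nat) ^ (m - r). C * (2 ^ r * \<tau>)\<^sup>2) \<le> 8 * C * T\<^sup>2" by (simp add: power_mult_distrib)
  qed
  finally show "(\<integral>\<^sup>+\<omega>. ennreal (grid_modulus \<tau> m B \<omega>) \<partial>M) \<le> ennreal (1 + 8 * (fact 20 / (2 ^ 10 * fact 10)) * T\<^sup>2)"
    by (simp add: C_def)
qed

lemma grid_modulus_Hoelder:
  assumes \<tau>: "0 < \<tau>" and i: "i < i'" "i' < 2 ^ m"
  shows "\<bar>B (real i' * \<tau>) \<omega> - B (real i * \<tau>) \<omega>\<bar> \<le>
    2 powr (2 / 5) * (1 + 2 / (2 powr (2 / 5) - 1)) * (\<tau> powr (2 / 5) * sqrt (grid_modulus \<tau> m B \<omega>)) * real (i' - i) powr (2 / 5)"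
proof (rule dyadic_chaining[of "2 / 5" _ m "\<lambda>i. B (real i * \<tau>) \<omega>", OF _ _ _ i])
  note G1 = grid_modulus_ge_1[OF \<tau>, of m B \<omega>]
  define G where "G = grid_modulus \<tau> m B \<omega>"
  fix r b :: nat assume rb: "Suc b * 2 ^ r < 2 ^ m"
  have "(2::nat) ^ r \<le> Suc b * 2 ^ r" by simp
  then have "(2::nat) ^ r < 2 ^ m" using rb by linarith
  then have r: "r < m" by (simp add: power_less_imp_less_exp)
  then have "Suc b * 2 ^ r < 2 ^ (m - r) * 2 ^ r" using rb by (simp add: power_add[symmetric])
  then have "Suc b < 2 ^ (m - r)" by (simp only: mult_less_cancel2)
  then have b: "b < 2 ^ (m - r)" by simp
  define D where "D = B (real (Suc b * 2 ^ r) * \<tau>) \<omega> - B (real (b * 2 ^ r) * \<tau>) \<omega>"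
  define y where "y = 2 ^ r * \<tau>"
  have y: "0 < y" using \<tau> by (simp add: y_def)
  have "D ^ 20 / y ^ 8 \<le> (\<Sum>b<(2::nat) ^ (m - r). (B (real (Suc b * 2 ^ r) * \<tau>) \<omega> - B (real (b * 2 ^ r) * \<tau>) \<omega>) ^ 20 / (2 ^ r * \<tau>) ^ 8)"
    unfolding D_def y_def using b \<tau> by (intro member_le_sum) (auto intro!: divide_nonneg_nonneg)
  also have "\<dots> \<le> (\<Sum>r\<le>m. \<Sum>b<(2::nat) ^ (m - r). (B (real (Suc b * 2 ^ r) * \<tau>) \<omega> - B (real (b * 2 ^ r) * \<tau>) \<omega>) ^ 20 / (2 ^ r * \<tau>) ^ 8)"
    using r \<tau> by (intro member_le_sum[of r "{..m}" "\<lambda>r. \<Sum>b<(2::nat) ^ (m - r). (B (real (Suc b * 2 ^ r) * \<tau>) \<omega> - B (real (b * 2 ^ r) * \<tau>) \<omega>) ^ 20 / (2 ^ r * \<tau>) ^ 8"])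
       (auto intro!: divide_nonneg_nonneg sum_nonneg)
  also have "\<dots> \<le> G" by (simp add: G_def grid_modulus_def)
  finally have "D ^ 20 \<le> y ^ 8 * G" using y by (simp add: pos_divide_le_eq mult.commute)
  \<comment> \<open>A twentieth root of G would do. Enlarging it to a square root, possible since G
    >= 1, makes the square of the final noise bound linear in the moduli, whose expectations are
    known.\<close>
  also have "\<dots> \<le> y ^ 8 * G ^ 10"
    using y G1 power_increasing[of 1 10 G] by (intro mult_left_mono) (auto simp: G_def)
  also have "\<dots> = (y powr (2 / 5) * sqrt G) ^ 20"
  proof -
    have "(y powr (2 / 5)) ^ 20 = y ^ 8" using y powr_realpow[of y 8] by (simp add: powr_power)
    moreover have "sqrt G ^ 20 = ((sqrt G)\<^sup>2) ^ 10" by (simp flip: power_mult)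
    then have "sqrt G ^ 20 = G ^ 10" using G1 by (simp add: G_def)
    ultimately show ?thesis by (simp add: power_mult_distrib)
  qed
  finally have "\<bar>D\<bar> ^ 20 \<le> (y powr (2 / 5) * sqrt G) ^ 20" by (simp add: power_even_abs)
  then have "\<bar>D\<bar> \<le> y powr (2 / 5) * sqrt G"
    by (rule power_mono_iff[THEN iffD1, rotated 3]) (use G1 in \<open>auto simp: G_def\<close>)
  also have "\<dots> = \<tau> powr (2 / 5) * sqrt G * (2 ^ r) powr (2 / 5)"
    using \<tau> by (simp add: y_def powr_mult)
  finally show "\<bar>B (real (Suc b * 2 ^ r) * \<tau>) \<omega> - B (real (b * 2 ^ r) * \<tau>) \<omega>\<bar> \<le> \<tau> powr (2 / 5) * sqrt (grid_modulus \<tau> m B \<omega>) * (2 ^ r) powr (2 / 5)"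
    by (simp add: D_def G_def)
qed (use grid_modulus_ge_1[OF \<tau>, of m B \<omega>] in auto)

section \<open>Nodal bases\<close>

text \<open>After moving one vertex to the origin, affine independence becomes linear independence
  and the values extend to a linear functional, represented by a vector b.\<close>

lemma affine_interpolation:
  fixes C :: "'a::euclidean_space set" and a :: "'a \<Rightarrow> real"
  assumes "\<not> affine_dependent C"
  shows "\<exists>\<alpha> b. \<forall>c\<in>C. \<alpha> + b \<bullet> c = a c"
proof (cases "C = {}")
  case False
  then obtain c0 where c0: "c0 \<in> C" by auto
  define D where "D = (\<lambda>x. - c0 + x) ` (C - {c0})"
  have "independent D" using assms affine_dependent_iff_dependent2[OF c0] by (simp add: D_def)
  then obtain g where g: "linear g" "\<forall>x\<in>D. g x = a (c0 + x) - a c0"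
    using linear_independent_extend[of D "\<lambda>x. a (c0 + x) - a c0"] by blast
  define b where "b = (\<Sum>i\<in>Basis. g i *\<^sub>R i)"
  have gb: "g x = b \<bullet> x" for x
  proof -
    have "g x = g (\<Sum>i\<in>Basis. (x \<bullet> i) *\<^sub>R i)" by (simp add: euclidean_representation)
    also have "\<dots> = (\<Sum>i\<in>Basis. (x \<bullet> i) * g i)"
      using g(1) by (simp add: linear_sum linear_scale)
    also have "\<dots> = b \<bullet> x" by (simp add: b_def inner_sum_left inner_commute[of x] mult.commute)
    finally show ?thesis .
  qed
  have "(a c0 - b \<bullet> c0) + b \<bullet> c = a c" if "c \<in> C" for c
  proof (cases "c = c0")
    case False
    then have "- c0 + c \<in> D" using that by (auto simp: D_def)
    then have "g (- c0 + c) = a c - a c0" using g(2) by fastforce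
    then show ?thesis by (simp add: gb inner_diff_right inner_add_right)
  qed auto
  then show ?thesis by blast
qed auto

lemma affine_eq_on_hull:
  fixes b b' :: "'a::real_inner"
  assumes "\<And>c. c \<in> C \<Longrightarrow> \<alpha> + b \<bullet> c = \<alpha>' + b' \<bullet> c" and "x \<in> convex hull C"
  shows "\<alpha> + b \<bullet> x = \<alpha>' + b' \<bullet> x"
proof -
  have "convex hull C \<subseteq> {x. (b - b') \<bullet> x = \<alpha>' - \<alpha>}"
  proof (rule hull_minimal)
    show "C \<subseteq> {x. (b - b') \<bullet> x = \<alpha>' - \<alpha>}" using assms(1) by (force simp: inner_diff_left)
  qed (rule convex_hyperplane)
  then show ?thesis using assms(2) by (auto simp: inner_diff_left)
qed

lemma affine_bounds_on_hull:
  fixes b :: "'a::real_inner"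
  assumes "\<And>c. c \<in> C \<Longrightarrow> l \<le> \<alpha> + b \<bullet> c \<and> \<alpha> + b \<bullet> c \<le> u" and "x \<in> convex hull C"
  shows "l \<le> \<alpha> + b \<bullet> x \<and> \<alpha> + b \<bullet> x \<le> u"
proof -
  have "convex hull C \<subseteq> {x. b \<bullet> x \<ge> l - \<alpha>} \<inter> {x. b \<bullet> x \<le> u - \<alpha>}"
    by (rule hull_minimal)
      (use assms(1) in \<open>force intro!: convex_Int simp: convex_halfspace_ge convex_halfspace_le\<close>)+
  then show ?thesis using assms(2) by auto
qed

lemma simplex_vertices:
  fixes K :: "'a::euclidean_space set"
  assumes "n simplex K" and C: "C = {z. z extreme_point_of K}"
  shows "finite C" "\<not> affine_dependent C" "K = convex hull C" "int (card C) = n + 1"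
proof -
  obtain D where D: "finite D" "\<not> affine_dependent D" "int (card D) = n + 1" "K = convex hull D"
    using assms(1) unfolding simplex by blast
  have "C = D" using extreme_point_of_convex_hull_affine_independent[OF D(2)] by (auto simp: C D(4))
  then show "finite C" "\<not> affine_dependent C" "K = convex hull C" "int (card C) = n + 1" using D by auto
qed

lemma face_eq_hull_extreme_points:
  fixes K :: "'a::euclidean_space set"
  assumes "n simplex K" "F face_of K"
  shows "F = convex hull {z. z extreme_point_of F}"
  using assms Krein_Milman_Minkowski[of F] face_of_imp_compact face_of_imp_convex
    compact_simplex convex_simplex by metis

context
  fixes \<T> :: "(real^'n) set set"
  assumes \<T>: "cube_triangulation \<T>"
begin

lemma triangulation_finite: "finite \<T>"
  and triangulation_simplex: "K \<in> \<T> \<Longrightarrow> int CARD('n) simplex K"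
  and triangulation_face: "K \<in> \<T> \<Longrightarrow> K' \<in> \<T> \<Longrightarrow> K \<inter> K' face_of K"
  and triangulation_Union: "\<Union>\<T> = unit_cube"
  using \<T> by (auto simp: cube_triangulation_def triangulation_def)

lemma card_mesh_nodes_le: "card (mesh_nodes \<T>) \<le> (CARD('n) + 1) * card \<T>"
proof -
  have eq: "mesh_nodes \<T> = (\<Union>K\<in>\<T>. {z. z extreme_point_of K})" by (auto simp: mesh_nodes_def)
  have card: "card {z. z extreme_point_of K} = CARD('n) + 1" if "K \<in> \<T>" for K
    using simplex_vertices(4)[OF triangulation_simplex[OF that] refl] by linarith
  have "card (mesh_nodes \<T>) \<le> (\<Sum>K\<in>\<T>. card {z. z extreme_point_of K})"
    unfolding eq by (rule card_UN_le[OF triangulation_finite])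
  also have "\<dots> = (CARD('n) + 1) * card \<T>" using card by simp
  finally show "card (mesh_nodes \<T>) \<le> (CARD('n) + 1) * card \<T>" .
qed

lemma continuous_on_unit_cube_piecewise:
  assumes "\<And>K. K \<in> \<T> \<Longrightarrow> continuous_on K v"
  shows "continuous_on unit_cube v"
proof -
  have "continuous_on (\<Union>K\<in>\<T>. K) v"
    using triangulation_finite assms closed_simplex[OF triangulation_simplex]
    by (intro continuous_on_closed_Union) auto
  then show ?thesis using triangulation_Union by simp
qed

text \<open>\<open>nodal_basis\<close> is a choice, so existence has to be shown before anything is
  known about it. The affine pieces fit together because simplices meet in common faces.\<close>

lemma nodal_function_exists:
  "\<exists>\<phi>. \<phi> \<in> P1_space \<T> \<and> (\<forall>y\<in>mesh_nodes \<T>. \<phi> y = a y)"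
proof -
  have "\<forall>K\<in>\<T>. \<exists>\<alpha> b. \<forall>c\<in>{z. z extreme_point_of K}. \<alpha> + b \<bullet> c = a c"
    using simplex_vertices(2)[OF triangulation_simplex refl] affine_interpolation by blast
  then obtain \<alpha> b where ab: "\<And>K c. K \<in> \<T> \<Longrightarrow> c extreme_point_of K \<Longrightarrow> \<alpha> K + b K \<bullet> c = a c"
    by (simp add: bchoice_iff) metis
  have agree: "\<alpha> K + b K \<bullet> x = \<alpha> K' + b K' \<bullet> x" if K: "K \<in> \<T>" "K' \<in> \<T>" and x: "x \<in> K" "x \<in> K'" for K K' x
  proof (rule affine_eq_on_hull)
    \<comment> \<open>The common face is the hull of its extreme points, and these are vertices of
      both simplices, where both affine functions take the prescribed values.\<close>
    show "x \<in> convex hull {z. z extreme_point_of (K \<inter> K')}"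
      using face_eq_hull_extreme_points[OF triangulation_simplex triangulation_face] K x by blast
    fix c assume c: "c \<in> {z. z extreme_point_of (K \<inter> K')}"
    have "c extreme_point_of K" using extreme_point_of_face[OF triangulation_face[OF K]] c by auto
    moreover have "c extreme_point_of K'"
      using extreme_point_of_face[OF triangulation_face[OF K(2,1)]] c by (auto simp: Int_commute)
    ultimately show "\<alpha> K + b K \<bullet> c = \<alpha> K' + b K' \<bullet> c" using ab K by metis
  qed
  define \<phi> where "\<phi> x = (let K = (SOME K. K \<in> \<T> \<and> x \<in> K) in \<alpha> K + b K \<bullet> x)" for x
  have \<phi>: "\<phi> x = \<alpha> K + b K \<bullet> x" if K: "K \<in> \<T>" "x \<in> K" for K x
  proof -
    have "(SOME K. K \<in> \<T> \<and> x \<in> K) \<in> \<T> \<and> x \<in> (SOME K. K \<in> \<T> \<and> x \<in> K)"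
      by (rule someI[of _ K]) (use K in auto)
    then show ?thesis unfolding \<phi>_def Let_def using agree K by blast
  qed
  have "continuous_on K \<phi>" if "K \<in> \<T>" for K
  proof -
    have "continuous_on K (\<lambda>x. \<alpha> K + b K \<bullet> x)" by (intro continuous_intros)
    then show ?thesis using \<phi>[OF that] by (simp cong: continuous_on_cong)
  qed
  then have "\<phi> \<in> P1_space \<T>"
    unfolding P1_space_def using continuous_on_unit_cube_piecewise \<phi> by blast
  moreover have "\<phi> y = a y" if "y \<in> mesh_nodes \<T>" for y
    using that ab \<phi> by (auto simp: mesh_nodes_def extreme_point_of_def)
  ultimately show ?thesis by blast
qed

text \<open>On a simplex the function is affine and the simplex is the hull of its vertices, so the
  bounds 0 and 1 at the nodes carry over.\<close>

lemma continuous_nodal_basis: "continuous_on unit_cube (nodal_basis \<T> z)"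
  and nodal_basis_bounds: "x \<in> unit_cube \<Longrightarrow> 0 \<le> nodal_basis \<T> z x \<and> nodal_basis \<T> z x \<le> 1"
proof -
  have "nodal_basis \<T> z \<in> P1_space \<T> \<and> (\<forall>y\<in>mesh_nodes \<T>. nodal_basis \<T> z y = (if y = z then 1 else 0))"
    unfolding nodal_basis_def using someI_ex[OF nodal_function_exists[of "\<lambda>y. if y = z then 1 else 0"]] .
  then have P1: "nodal_basis \<T> z \<in> P1_space \<T>"
    and val: "\<And>y. y \<in> mesh_nodes \<T> \<Longrightarrow> nodal_basis \<T> z y = (if y = z then 1 else 0)" by auto
  show "continuous_on unit_cube (nodal_basis \<T> z)" using P1 by (simp add: P1_space_def)
  assume "x \<in> unit_cube"
  then obtain K where K: "K \<in> \<T>" "x \<in> K" using triangulation_Union by blast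
  obtain \<alpha> b where ab: "\<And>x. x \<in> K \<Longrightarrow> nodal_basis \<T> z x = \<alpha> + b \<bullet> x" using P1 K by (auto simp: P1_space_def)
  have "0 \<le> \<alpha> + b \<bullet> x \<and> \<alpha> + b \<bullet> x \<le> 1"
  proof (rule affine_bounds_on_hull)
    show "x \<in> convex hull {z. z extreme_point_of K}"
      using simplex_vertices(3)[OF triangulation_simplex[OF K(1)] refl] K by simp
    fix c assume "c \<in> {z. z extreme_point_of K}"
    then have "c \<in> mesh_nodes \<T>" "c \<in> K" using K by (auto simp: mesh_nodes_def extreme_point_of_def)
    then show "0 \<le> \<alpha> + b \<bullet> c \<and> \<alpha> + b \<bullet> c \<le> 1" using ab[of c] val[of c] by (auto split: if_splits)
  qed
  then show "0 \<le> nodal_basis \<T> z x \<and> nodal_basis \<T> z x \<le> 1" using ab K by simp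
qed

text \<open>A volume count: distinct simplices have disjoint interiors, each contains a ball of
  radius \<kappa> times the mesh size, and the cube has volume 1.\<close>

lemma card_triangulation_le:
  assumes "quasi_uniform \<kappa> \<T>" and r: "0 < \<kappa> * mesh_size \<T>"
  shows "real (card \<T>) * ((\<kappa> * mesh_size \<T>) ^ CARD('n) * measure lborel (ball (0::real^'n) 1)) \<le> 1"
proof -
  define r where "r = \<kappa> * mesh_size \<T>"
  have r: "0 < r" using assms by (simp add: r_def)
  obtain c where c: "\<And>K. K \<in> \<T> \<Longrightarrow> cball (c K) r \<subseteq> K"
    using assms(1) unfolding quasi_uniform_def r_def by metis
  have int: "ball (c K) r \<subseteq> interior K" if "K \<in> \<T>" for K
    using c[OF that] ball_subset_cball by (intro interior_maximal) blast+
  have disj: "ball (c K) r \<inter> ball (c K') r = {}" if K: "K \<in> \<T>" "K' \<in> \<T>" "K \<noteq> K'" for K K'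
  proof -
    have sub: "interior K \<subseteq> K" "interior K' \<subseteq> K'" by (rule interior_subset)+
    have "interior K \<inter> interior K' = {}"
    \<comment> \<open>The common face is proper in at least one of two different simplices, and a
      proper face misses the interior of that simplex.\<close>
    proof (cases "K \<inter> K' = K")
      case False
      then show ?thesis using face_of_disjoint_interior[OF triangulation_face[OF K(1,2)]] sub by blast
    next
      case True
      then have "K \<inter> interior K' = {}"
        using face_of_disjoint_interior[OF triangulation_face[OF K(2,1)]] K(3) by (auto simp: Int_commute)
      then show ?thesis using sub by blast
    qed
    then show ?thesis using int K by blast
  qed
  have fin: "emeasure lborel (ball (c K) r) \<noteq> \<top>" for K
    using emeasure_lborel_ball_finite[of "c K" r] by auto
  have "real (card \<T>) * (r ^ CARD('n) * measure lborel (ball (0::real^'n) 1)) = (\<Sum>K\<in>\<T>. measure lborel (ball (c K) r))"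
    using r by (subst content_ball_conv_unit_ball) auto
  also have "\<dots> = measure lebesgue (\<Union>K\<in>\<T>. ball (c K) r)"
    using triangulation_finite disj fin
    by (subst measure_finite_Union) (auto simp: disjoint_family_on_def)
  also have "\<dots> \<le> measure lebesgue (unit_cube :: (real^'n) set)"
  proof (rule measure_mono_fmeasurable)
    show "(\<Union>K\<in>\<T>. ball (c K) r) \<subseteq> unit_cube" using c triangulation_Union ball_subset_cball by blast
    show "(\<Union>K\<in>\<T>. ball (c K) r) \<in> sets lebesgue" using triangulation_finite by auto
    show "unit_cube \<in> fmeasurable (lebesgue :: (real^'n) measure)" by (simp add: unit_cube_def)
  qed
  also have "\<dots> = 1" by (rule measure_unit_cube)
  finally show ?thesis by (simp add: r_def)
qed

end

section \<open>Cosine coefficients of the discrete noise\<close>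

definition scaled_nodal :: "(real^'n) set set \<Rightarrow> real^'n \<Rightarrow> real^'n \<Rightarrow> real" where
  "scaled_nodal \<T> z x =
     nodal_basis \<T> z x / sqrt (\<bar>L2_inner (nodal_basis \<T> z) (\<lambda>_. 1)\<bar> / (real CARD('n) + 1))"

lemma scaled_nodal_L2:
  assumes "cube_triangulation \<T>" shows "scaled_nodal \<T> z \<in> L2_space"
proof -
  have "nodal_basis \<T> z \<in> L2_space" by (rule continuous_cube_L2[OF continuous_nodal_basis[OF assms]])
  from L2_cmult[OF this, of "1 / sqrt (\<bar>L2_inner (nodal_basis \<T> z) (\<lambda>_. 1)\<bar> / (real CARD('n) + 1))"]
  show ?thesis by (simp add: scaled_nodal_def[abs_def])
qed

text \<open>The noise is normalised by the integral of the nodal function, and for values in [0, 1]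
  the integral of the square is at most that integral. Were the integral 0, division by 0 would
  return 0 and the bound would still hold.\<close>

lemma scaled_nodal_norm_le:
  fixes \<T> :: "(real^'n) set set"
  assumes \<T>: "cube_triangulation \<T>"
  shows "L2_inner (scaled_nodal \<T> z) (scaled_nodal \<T> z) \<le> real CARD('n) + 1"
proof -
  define \<phi> where "\<phi> = nodal_basis \<T> z"
  define I where "I = L2_inner \<phi> (\<lambda>_. 1)"
  define s where "s = sqrt (\<bar>I\<bar> / (real CARD('n) + 1))"
  have L2: "\<phi> \<in> L2_space" unfolding \<phi>_def by (rule continuous_cube_L2[OF continuous_nodal_basis[OF \<T>]])
  have bounds: "0 \<le> \<phi> x \<and> \<phi> x \<le> 1" if "x \<in> unit_cube" for x
    using nodal_basis_bounds[OF \<T> that] by (simp add: \<phi>_def)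
  have "L2_inner \<phi> \<phi> \<le> I" unfolding I_def L2_inner_def
  proof (rule integral_mono)
    show "integrable cube_measure (\<lambda>x. \<phi> x * \<phi> x)" by (rule L2_mult_integrable[OF L2 L2])
    show "integrable cube_measure (\<lambda>x. \<phi> x * 1)" using L2_integrable[OF L2] by simp
    fix x :: "real^'n" assume "x \<in> space cube_measure"
    then show "\<phi> x * \<phi> x \<le> \<phi> x * 1" using bounds by (intro mult_left_mono) (auto simp: space_restrict_space)
  qed
  moreover have "0 \<le> L2_inner \<phi> \<phi>" by (rule L2_inner_self_nonneg)
  ultimately have I: "0 \<le> I" "L2_inner \<phi> \<phi> \<le> I" by auto
  have "L2_inner (scaled_nodal \<T> z) (scaled_nodal \<T> z) = L2_inner (\<lambda>x. (1 / s) * \<phi> x) (\<lambda>x. (1 / s) * \<phi> x)"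
    by (simp add: scaled_nodal_def[abs_def] s_def I_def \<phi>_def)
  also have "\<dots> = (1 / s)\<^sup>2 * L2_inner \<phi> \<phi>"
    by (simp only: L2_inner_cmult_left L2_inner_cmult_right power2_eq_square mult.assoc)
  also have "\<dots> = (real CARD('n) + 1) * (L2_inner \<phi> \<phi> / I)"
    using I by (simp add: s_def power_divide)
  also have "\<dots> \<le> (real CARD('n) + 1) * 1"
    using I by (intro mult_left_mono) (auto simp: divide_le_eq_1)
  finally show ?thesis by simp
qed

text \<open>Subtracting the mean changes the constant mode only, to which all other modes are
  orthogonal.\<close>

lemma noise_cos_coeff:
  fixes \<T> :: "(real^'n) set set"
  assumes \<T>: "cube_triangulation \<T>" and k: "k \<noteq> (\<lambda>_. 0)"
  shows "L2_inner (noise_incr_bar \<T> \<tau> \<beta> i \<omega>) (cos_mode k)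
    = (\<Sum>z\<in>mesh_nodes \<T>. cosine_coeff (scaled_nodal \<T> z) k * (\<beta> z (real i * \<tau>) \<omega> - \<beta> z (real (i - 1) * \<tau>) \<omega>))"
proof -
  define N where "N = noise_incr \<T> \<tau> \<beta> i \<omega>"
  define b where "b z = \<beta> z (real i * \<tau>) \<omega> - \<beta> z (real (i - 1) * \<tau>) \<omega>" for z
  have N: "N = (\<lambda>x. \<Sum>z\<in>mesh_nodes \<T>. b z * scaled_nodal \<T> z x)"
    by (simp add: N_def noise_incr_def[abs_def] b_def scaled_nodal_def mult.commute)
  have NL: "N \<in> L2_space" unfolding N by (intro L2_sum L2_cmult scaled_nodal_L2[OF \<T>])
  have cL: "(\<lambda>_. cube_mean N) \<in> L2_space" by (rule continuous_cube_L2) simp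
  have one: "cos_mode (\<lambda>_. 0) = (\<lambda>x::real^'n. 1)" by (simp add: trig_mode_def tensor_def fun_eq_iff)
  have "L2_inner (\<lambda>_. cube_mean N) (cos_mode k) = cube_mean N * L2_inner (cos_mode (\<lambda>_. 0)) (cos_mode k)"
    using L2_inner_cmult_left[of "cube_mean N" "\<lambda>_. 1" "cos_mode k"] by (simp add: one)
  also have "\<dots> = 0" using trig_mode_orthogonal[of "\<lambda>_. 0" k "{}"] k by auto
  finally have "L2_inner (\<lambda>x. N x - cube_mean N) (cos_mode k) = L2_inner N (cos_mode k)"
    using L2_inner_diff_left[OF NL cL trig_mode_L2] by simp
  also have "\<dots> = (\<Sum>z\<in>mesh_nodes \<T>. L2_inner (\<lambda>x. b z * scaled_nodal \<T> z x) (cos_mode k))"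
    unfolding N by (intro L2_inner_sum_left L2_cmult scaled_nodal_L2[OF \<T>] trig_mode_L2)
  also have "\<dots> = (\<Sum>z\<in>mesh_nodes \<T>. cosine_coeff (scaled_nodal \<T> z) k * b z)"
    by (simp add: L2_inner_cmult_left cosine_coeff_def mult.commute)
  finally show ?thesis by (simp add: noise_incr_bar_def[abs_def] N_def b_def)
qed

text \<open>Cauchy-Schwarz splits the sum into the weights, squared to the power - 8/5, and the
  squared coefficients, which Bessel bounds by the norm alone. So no regularity of the nodal
  functions, and no inverse power of the mesh size, enters.\<close>

lemma sum_weighted_coeff_le:
  assumes v: "v \<in> L2_space" "L2_inner v v \<le> D" and K: "finite K"
    and C: "(\<Sum>k\<in>K. mode_weight k powr (- (8 / 5))) \<le> C"
  shows "(\<Sum>k\<in>K. \<bar>cosine_coeff v k\<bar> * mode_weight k powr (- (4 / 5))) \<le> sqrt (C * D)"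
proof -
  have w: "mode_weight k powr (8 / 5) * (cosine_coeff v k * mode_weight k powr (- (4 / 5)))\<^sup>2 = (cosine_coeff v k)\<^sup>2" for k
    using mode_weight_pos[of k] by (simp add: power_mult_distrib power2_eq_square powr_add[symmetric] mult.left_commute[of "_ powr _"] mult.assoc)
  have "(\<Sum>k\<in>K. \<bar>cosine_coeff v k\<bar> * mode_weight k powr (- (4 / 5)))\<^sup>2
    = (\<Sum>k\<in>K. \<bar>cosine_coeff v k * mode_weight k powr (- (4 / 5))\<bar>)\<^sup>2" by (simp add: abs_mult)
  also have "\<dots> \<le> (\<Sum>k\<in>K. 1 / mode_weight k powr (8 / 5)) * (\<Sum>k\<in>K. mode_weight k powr (8 / 5) * (cosine_coeff v k * mode_weight k powr (- (4 / 5)))\<^sup>2)"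
    by (intro sum_abs_weighted_le) (simp add: mode_weight_pos[THEN less_imp_neq, THEN not_sym])
  also have "\<dots> = (\<Sum>k\<in>K. mode_weight k powr (- (8 / 5))) * (\<Sum>k\<in>K. (cosine_coeff v k)\<^sup>2)"
    unfolding w by (simp only: powr_minus_divide)
  also have "\<dots> \<le> C * D"
  proof (rule mult_mono)
    show "(\<Sum>k\<in>K. (cosine_coeff v k)\<^sup>2) \<le> D" using Bessel_trig[OF v(1) K, of "{}"] v(2) by (simp add: cosine_coeff_def)
    show "0 \<le> C" by (rule order_trans[OF _ C]) (simp add: sum_nonneg)
  qed (use C in \<open>auto intro: sum_nonneg\<close>)
  finally show ?thesis by (rule real_le_rsqrt)
qed

text \<open>The nodes are added up in absolute value, at the cost of one summand per node; the
  exponents leave room for that. The right-hand side does not depend on j, which settles the maximum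
  over time.\<close>

lemma noise_damped_sum_le:
  assumes card: "CARD('n::finite) \<le> 3"
  obtains C where "0 < C"
    "\<And>\<epsilon> \<gamma> \<tau> m j K \<T> (\<beta> :: real^'n \<Rightarrow> real \<Rightarrow> 'w \<Rightarrow> real) \<omega>. cube_triangulation \<T> \<Longrightarrow> 0 < \<epsilon> \<Longrightarrow> 0 < \<tau> \<Longrightarrow> j < 2 ^ m \<Longrightarrow> finite K \<Longrightarrow>
      (\<Sum>k\<in>K - {\<lambda>_. 0}. \<bar>damped_sum (mode_damping \<epsilon> \<tau> k)
          (\<lambda>i. \<epsilon> powr \<gamma> * L2_inner (noise_incr_bar \<T> \<tau> \<beta> i \<omega>) (cos_mode k)) j\<bar>)
        \<le> C * \<epsilon> powr (\<gamma> - 2 / 5) * (\<Sum>z\<in>mesh_nodes \<T>. sqrt (grid_modulus \<tau> m (\<beta> z) \<omega>))"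
proof -
  obtain C8 where C8: "C8 > 0" "\<And>K :: ('n \<Rightarrow> nat) set. finite K \<Longrightarrow> (\<Sum>k\<in>K. mode_weight k powr (- (8 / 5))) \<le> C8"
    using sum_mode_weight_powr_bounded[of "8 / 5", OF card] by (simp; metis)
  define H where "H = (2::real) powr (2 / 5) * (1 + 2 / (2 powr (2 / 5) - 1))"
  have "(1::real) < 2 powr (2 / 5)" by (rule gr_one_powr) auto
  from less_imp_le[OF this] have H: "0 < H" unfolding H_def by (intro mult_pos_pos add_pos_nonneg) auto
  define C where "C = 2 * H * sqrt (C8 * (real CARD('n) + 1))"
  have C: "0 < C" using H C8(1) by (auto simp: C_def intro!: mult_pos_pos)
  show thesis
  proof (rule that[OF C])
    fix \<epsilon> \<gamma> \<tau> :: real and m j :: nat and K :: "('n \<Rightarrow> nat) set" and \<T> :: "(real^'n) set set"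
      and \<beta> :: "real^'n \<Rightarrow> real \<Rightarrow> 'w \<Rightarrow> real" and \<omega>
    assume \<T>: "cube_triangulation \<T>" and \<epsilon>: "0 < \<epsilon>" and \<tau>: "0 < \<tau>" and j: "j < 2 ^ m" and K: "finite K"
    define G where "G z = grid_modulus \<tau> m (\<beta> z) \<omega>" for z
    have G: "1 \<le> G z" for z unfolding G_def by (rule grid_modulus_ge_1[OF \<tau>])
    define D where "D z k = damped_sum (mode_damping \<epsilon> \<tau> k) (\<lambda>i. \<beta> z (real i * \<tau>) \<omega> - \<beta> z (real (i - 1) * \<tau>) \<omega>) j" for z and k :: "'n \<Rightarrow> nat"
    define c where "c z k = cosine_coeff (scaled_nodal \<T> z) k" for z k
    have D: "\<bar>D z k\<bar> \<le> 2 * H * sqrt (G z) * \<epsilon> powr (- (2 / 5)) * mode_weight k powr (- (4 / 5))" if k: "k \<noteq> (\<lambda>_. 0)" for z k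
    proof -
      define \<mu> where "\<mu> = mode_eigenvalue k"
      have \<mu>: "mode_weight k \<le> \<mu>" "0 < \<mu>"
        using mode_weight_le_eigenvalue[OF k] mode_weight_pos[of k] by (auto simp: \<mu>_def)
      define x where "x = \<tau> * \<epsilon> * \<mu>\<^sup>2"
      have x: "0 < x" using \<tau> \<epsilon> \<mu> by (simp add: x_def)
      have "\<bar>D z k\<bar> \<le> 2 * (H * (\<tau> powr (2 / 5) * sqrt (G z))) * x powr (- (2 / 5))"
        unfolding D_def mode_damping_def \<mu>_def[symmetric] x_def[symmetric]
      proof (rule damped_sum_Hoelder[of x "2 / 5" _ j "\<lambda>i. \<beta> z (real i * \<tau>) \<omega>", OF x])
        fix i assume i: "i < j"
        show "\<bar>\<beta> z (real j * \<tau>) \<omega> - \<beta> z (real i * \<tau>) \<omega>\<bar> \<le> H * (\<tau> powr (2 / 5) * sqrt (G z)) * real (j - i) powr (2 / 5)"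
          unfolding H_def G_def by (rule grid_modulus_Hoelder[OF \<tau> i j])
      qed (use H G[of z] in auto)
      also have "x powr (- (2 / 5)) = \<tau> powr (- (2 / 5)) * \<epsilon> powr (- (2 / 5)) * \<mu> powr (- (4 / 5))"
        using \<tau> \<epsilon> \<mu> by (simp add: x_def powr_mult power_powr)
      also have "2 * (H * (\<tau> powr (2 / 5) * sqrt (G z))) * (\<tau> powr (- (2 / 5)) * \<epsilon> powr (- (2 / 5)) * \<mu> powr (- (4 / 5)))
        = 2 * H * sqrt (G z) * \<epsilon> powr (- (2 / 5)) * \<mu> powr (- (4 / 5)) * (\<tau> powr (2 / 5) * \<tau> powr (- (2 / 5)))" by algebra
      \<comment> \<open>The step size from the Hoelder modulus cancels against the one in the
        damping, so the noise bound is uniform in \<tau>.\<close>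
      also have "\<tau> powr (2 / 5) * \<tau> powr (- (2 / 5)) = 1" using \<tau> by (simp flip: powr_add)
      also have "2 * H * sqrt (G z) * \<epsilon> powr (- (2 / 5)) * \<mu> powr (- (4 / 5)) * 1
        \<le> 2 * H * sqrt (G z) * \<epsilon> powr (- (2 / 5)) * mode_weight k powr (- (4 / 5))"
        using \<mu> mode_weight_pos[of k] H G[of z] by (simp, intro mult_left_mono powr_mono2') auto
      finally show ?thesis .
    qed
    have "(\<Sum>k\<in>K - {\<lambda>_. 0}. \<bar>damped_sum (mode_damping \<epsilon> \<tau> k)
          (\<lambda>i. \<epsilon> powr \<gamma> * L2_inner (noise_incr_bar \<T> \<tau> \<beta> i \<omega>) (cos_mode k)) j\<bar>)
      = (\<Sum>k\<in>K - {\<lambda>_. 0}. \<epsilon> powr \<gamma> * \<bar>\<Sum>z\<in>mesh_nodes \<T>. c z k * D z k\<bar>)"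
      by (intro sum.cong refl) (simp add: noise_cos_coeff[OF \<T>] damped_sum_linear D_def c_def abs_mult)
    also have "\<dots> \<le> (\<Sum>k\<in>K - {\<lambda>_. 0}. \<epsilon> powr \<gamma> * (\<Sum>z\<in>mesh_nodes \<T>. \<bar>c z k\<bar> * (2 * H * sqrt (G z) * \<epsilon> powr (- (2 / 5)) * mode_weight k powr (- (4 / 5)))))"
    proof (intro sum_mono mult_left_mono)
      fix k assume "k \<in> K - {\<lambda>_. 0}"
      then have "\<bar>\<Sum>z\<in>mesh_nodes \<T>. c z k * D z k\<bar> \<le> (\<Sum>z\<in>mesh_nodes \<T>. \<bar>c z k * D z k\<bar>)" "k \<noteq> (\<lambda>_. 0)" by auto
      then show "\<bar>\<Sum>z\<in>mesh_nodes \<T>. c z k * D z k\<bar> \<le> (\<Sum>z\<in>mesh_nodes \<T>. \<bar>c z k\<bar> * (2 * H * sqrt (G z) * \<epsilon> powr (- (2 / 5)) * mode_weight k powr (- (4 / 5))))"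
        by (elim order_trans) (auto simp: abs_mult intro!: sum_mono mult_left_mono D)
    qed auto
    also have "\<dots> = 2 * H * (\<epsilon> powr \<gamma> * \<epsilon> powr (- (2 / 5))) * (\<Sum>z\<in>mesh_nodes \<T>. sqrt (G z) * (\<Sum>k\<in>K - {\<lambda>_. 0}. \<bar>c z k\<bar> * mode_weight k powr (- (4 / 5))))"
      unfolding sum_distrib_left by (subst sum.swap) (intro sum.cong refl, simp only: mult_ac)
    also have "\<dots> \<le> 2 * H * (\<epsilon> powr \<gamma> * \<epsilon> powr (- (2 / 5))) * (\<Sum>z\<in>mesh_nodes \<T>. sqrt (G z) * sqrt (C8 * (real CARD('n) + 1)))"
    proof (intro mult_left_mono sum_mono)
      fix z assume "z \<in> mesh_nodes \<T>"
      show "(\<Sum>k\<in>K - {\<lambda>_. 0}. \<bar>c z k\<bar> * mode_weight k powr (- (4 / 5))) \<le> sqrt (C8 * (real CARD('n) + 1))"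
        unfolding c_def using K C8(2)
        by (intro sum_weighted_coeff_le scaled_nodal_L2[OF \<T>] scaled_nodal_norm_le[OF \<T>]) auto
    next
      fix z show "0 \<le> sqrt (G z)" using G[of z] by simp
    qed (use H in auto)
    also have "\<dots> = C * \<epsilon> powr (\<gamma> - 2 / 5) * (\<Sum>z\<in>mesh_nodes \<T>. sqrt (G z))"
      by (simp add: C_def powr_add[symmetric] sum_distrib_right[symmetric])
    finally show "(\<Sum>k\<in>K - {\<lambda>_. 0}. \<bar>damped_sum (mode_damping \<epsilon> \<tau> k)
          (\<lambda>i. \<epsilon> powr \<gamma> * L2_inner (noise_incr_bar \<T> \<tau> \<beta> i \<omega>) (cos_mode k)) j\<bar>)
        \<le> C * \<epsilon> powr (\<gamma> - 2 / 5) * (\<Sum>z\<in>mesh_nodes \<T>. sqrt (grid_modulus \<tau> m (\<beta> z) \<omega>))"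
      by (simp add: G_def)
  qed
qed

lemma card_mesh_nodes_powr_le:
  assumes \<kappa>: "0 < \<kappa>"
  obtains C where "0 < C"
    "\<And>\<T> :: (real^'n) set set. \<And>\<epsilon> \<eta>. cube_triangulation \<T> \<Longrightarrow> quasi_uniform \<kappa> \<T> \<Longrightarrow> 0 < \<epsilon> \<Longrightarrow> mesh_size \<T> = \<epsilon> powr \<eta> \<Longrightarrow>
      real (card (mesh_nodes \<T>)) \<le> C * \<epsilon> powr (- (\<eta> * real CARD('n)))"
proof -
  define v where "v = \<kappa> ^ CARD('n) * measure lborel (ball (0::real^'n) 1)"
  have v: "0 < v" using \<kappa> content_ball_pos[of 1 "0::real^'n"] by (simp add: v_def)
  define C where "C = (real CARD('n) + 1) / v"
  show thesis
  proof (rule that)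
    show "0 < C" using v by (simp add: C_def)
    fix \<T> :: "(real^'n) set set" and \<epsilon> \<eta> :: real
    assume \<T>: "cube_triangulation \<T>" and q: "quasi_uniform \<kappa> \<T>" and \<epsilon>: "0 < \<epsilon>" and h: "mesh_size \<T> = \<epsilon> powr \<eta>"
    define y where "y = \<epsilon> powr (\<eta> * real CARD('n))"
    have y: "0 < y" using \<epsilon> by (simp add: y_def)
    have "(\<epsilon> powr \<eta>) ^ CARD('n) = y" using \<epsilon> by (simp add: y_def powr_power mult.commute)
    then have "real (card \<T>) * (v * y) \<le> 1"
      using card_triangulation_le[OF \<T> q] \<kappa> \<epsilon> by (simp add: h power_mult_distrib v_def mult_ac)
    then have "real (card \<T>) \<le> 1 / (v * y)" using v y by (simp add: pos_le_divide_eq)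
    moreover have "real (card (mesh_nodes \<T>)) \<le> (real CARD('n) + 1) * real (card \<T>)"
      using card_mesh_nodes_le[OF \<T>] by (metis of_nat_mult of_nat_le_iff of_nat_add of_nat_1)
    ultimately have "real (card (mesh_nodes \<T>)) \<le> (real CARD('n) + 1) * (1 / (v * y))"
      by (meson mult_left_mono order_trans of_nat_0_le_iff add_nonneg_nonneg zero_le_one)
    also have "\<dots> = C * \<epsilon> powr (- (\<eta> * real CARD('n)))"
      by (simp add: C_def y_def powr_minus_divide)
    finally show "real (card (mesh_nodes \<T>)) \<le> C * \<epsilon> powr (- (\<eta> * real CARD('n)))" .
  qed
qed

section \<open>The estimate\<close>

theorem lemma5p9:
  fixes T \<gamma> \<theta> p C\<^sub>H C\<^sub>0 C\<^sub>E \<kappa> :: real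
  assumes "CARD('n::finite) \<in> {2, 3}"
    and "T > 0" and "\<gamma> \<ge> 5 / 2" and "\<theta> > 0" and "0 < 2 * p" and "2 * p < 5"
    and "C\<^sub>H > 0" and "C\<^sub>0 > 0" and "C\<^sub>E > 0" and "\<kappa> > 0"
  shows "\<exists>\<epsilon>\<^sub>0 C. 0 < \<epsilon>\<^sub>0 \<and> \<epsilon>\<^sub>0 < 1 \<and> 0 < C \<and>
    (\<forall>\<epsilon> \<eta> \<tau> (J::nat) (\<T> :: (real^'n) set set) (M :: 'w measure) \<beta>
        (u0 :: real^'n \<Rightarrow> real) (X :: nat \<Rightarrow> 'w \<Rightarrow> real^'n \<Rightarrow> real) (w :: nat \<Rightarrow> 'w \<Rightarrow> real^'n \<Rightarrow> real).
      0 < \<epsilon> \<and> \<epsilon> < \<epsilon>\<^sub>0 \<and>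
      J \<ge> 1 \<and> \<tau> = T / real J \<and> \<tau> \<le> \<epsilon> ^ 3 / 2 \<and>
      0 < \<eta> \<and> \<eta> \<le> 2 / (3 * real CARD('n)) * \<gamma> - 3 / (2 * real CARD('n)) \<and>
      cube_triangulation \<T> \<and> quasi_uniform \<kappa> \<T> \<and> mesh_size \<T> = \<epsilon> powr \<eta> \<and>
      prob_space M \<and> indep_brownian_motions M (mesh_nodes \<T>) \<beta> \<and>
      u0 \<in> H2_space \<and> cube_mean u0 = 0 \<and>
      H2_norm u0 \<le> C\<^sub>H * \<epsilon> powr (- p) \<and> energy \<epsilon> u0 \<le> ennreal C\<^sub>0 \<and>
      (AE \<omega> in M. CH_scheme \<epsilon> \<gamma> \<tau> J (\<lambda>j. noise_incr_bar \<T> \<tau> \<beta> j \<omega>) u0 (\<lambda>j. X j \<omega>) (\<lambda>j. w j \<omega>))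
      \<longrightarrow>
      (\<integral>\<^sup>+ \<omega>. (MAX j\<in>{1..J}.
          indicator (Omega_E M \<epsilon> J (C\<^sub>E * \<epsilon> powr (- \<theta>)) X) \<omega> * (Linf_norm (X j \<omega>))\<^sup>2) \<partial>M)
        \<le> ennreal (C * \<epsilon> powr (- 2 * \<theta> - 7)))"
proof -
  have card3: "CARD('n) \<le> 3" using assms(1) by auto
  define d where "d = real CARD('n)"
  have d: "0 < d" "d \<le> 3" using card3 by (auto simp: d_def)
  obtain C1 where C1: "0 < C1"
    "\<And>\<epsilon> \<gamma> \<tau> J dW u0 (X :: nat \<Rightarrow> real^'n \<Rightarrow> real) w j K.
      0 < \<epsilon> \<Longrightarrow> \<epsilon> < 1 \<Longrightarrow> 0 < \<tau> \<Longrightarrow> real J * \<tau> = T \<Longrightarrow> CH_scheme \<epsilon> \<gamma> \<tau> J dW u0 X w \<Longrightarrow> u0 \<in> H2_space \<Longrightarrow>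
      (\<And>i. 1 \<le> i \<Longrightarrow> i \<le> J \<Longrightarrow> energy \<epsilon> (X i) \<le> ennreal (C\<^sub>E * \<epsilon> powr (- \<theta>))) \<Longrightarrow>
      1 \<le> j \<Longrightarrow> j \<le> J \<Longrightarrow> finite K \<Longrightarrow>
      (\<Sum>k\<in>K. \<bar>cosine_coeff (X j) k\<bar>) \<le> C1 * (H2_norm u0 + \<epsilon> powr (- (7 / 2) - \<theta>))
        + (\<Sum>k\<in>K - {\<lambda>_. 0}. \<bar>damped_sum (mode_damping \<epsilon> \<tau> k) (\<lambda>i. \<epsilon> powr \<gamma> * L2_inner (dW i) (cos_mode k)) j\<bar>)"
    by (rule CH_scheme_coeff_bound[OF assms(1,2,4,9)]) blast
  obtain C2 where C2: "0 < C2"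
    "\<And>\<epsilon> \<gamma> \<tau> m j K \<T> (\<beta> :: real^'n \<Rightarrow> real \<Rightarrow> 'w \<Rightarrow> real) \<omega>. cube_triangulation \<T> \<Longrightarrow> 0 < \<epsilon> \<Longrightarrow> 0 < \<tau> \<Longrightarrow> j < 2 ^ m \<Longrightarrow> finite K \<Longrightarrow>
      (\<Sum>k\<in>K - {\<lambda>_. 0}. \<bar>damped_sum (mode_damping \<epsilon> \<tau> k)
          (\<lambda>i. \<epsilon> powr \<gamma> * L2_inner (noise_incr_bar \<T> \<tau> \<beta> i \<omega>) (cos_mode k)) j\<bar>)
        \<le> C2 * \<epsilon> powr (\<gamma> - 2 / 5) * (\<Sum>z\<in>mesh_nodes \<T>. sqrt (grid_modulus \<tau> m (\<beta> z) \<omega>))"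
    by (rule noise_damped_sum_le[OF card3, where ?'w = 'w]) blast
  obtain C3 where C3: "0 < C3"
    "\<And>\<T> :: (real^'n) set set. \<And>\<epsilon> \<eta>. cube_triangulation \<T> \<Longrightarrow> quasi_uniform \<kappa> \<T> \<Longrightarrow> 0 < \<epsilon> \<Longrightarrow> mesh_size \<T> = \<epsilon> powr \<eta> \<Longrightarrow>
      real (card (mesh_nodes \<T>)) \<le> C3 * \<epsilon> powr (- (\<eta> * d))"
    using card_mesh_nodes_powr_le[OF assms(10)] unfolding d_def by metis
  define G0 where "G0 = 1 + 8 * (fact 20 / (2 ^ 10 * fact 10)) * T\<^sup>2"
  have G0: "0 < G0" by (auto simp: G0_def intro!: add_pos_nonneg)
  define A where "A = 2 ^ CARD('n) * (C1 * (C\<^sub>H + 1))"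
  define D where "D = 2 ^ CARD('n) * C2"
  have A: "0 < A" and D: "0 < D" using C1(1) C2(1) assms(7) by (auto simp: A_def D_def intro!: mult_pos_pos)
  \<comment> \<open>The first summand collects initial datum and nonlinearity. C3 is squared because
    the number of nodes enters twice, through Cauchy-Schwarz over the nodes and through the sum of
    the expected moduli.\<close>
  define C where "C = 2 * A\<^sup>2 + 2 * D\<^sup>2 * C3\<^sup>2 * G0"
  have C: "0 < C" using A G0 by (auto simp: C_def intro!: add_pos_nonneg)
  show ?thesis
  proof (rule exI[of _ "1 / 2"], rule exI[of _ C], intro conjI allI impI)
    fix \<epsilon> \<eta> \<tau> :: real and J :: nat and \<T> :: "(real^'n) set set" and M :: "'w measure" and \<beta>
      and u0 :: "real^'n \<Rightarrow> real" and X :: "nat \<Rightarrow> 'w \<Rightarrow> real^'n \<Rightarrow> real" and w :: "nat \<Rightarrow> 'w \<Rightarrow> real^'n \<Rightarrow> real"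
    assume *: "0 < \<epsilon> \<and> \<epsilon> < 1 / 2 \<and>
      J \<ge> 1 \<and> \<tau> = T / real J \<and> \<tau> \<le> \<epsilon> ^ 3 / 2 \<and>
      0 < \<eta> \<and> \<eta> \<le> 2 / (3 * real CARD('n)) * \<gamma> - 3 / (2 * real CARD('n)) \<and>
      cube_triangulation \<T> \<and> quasi_uniform \<kappa> \<T> \<and> mesh_size \<T> = \<epsilon> powr \<eta> \<and>
      prob_space M \<and> indep_brownian_motions M (mesh_nodes \<T>) \<beta> \<and>
      u0 \<in> H2_space \<and> cube_mean u0 = 0 \<and>
      H2_norm u0 \<le> C\<^sub>H * \<epsilon> powr (- p) \<and> energy \<epsilon> u0 \<le> ennreal C\<^sub>0 \<and>
      (AE \<omega> in M. CH_scheme \<epsilon> \<gamma> \<tau> J (\<lambda>j. noise_incr_bar \<T> \<tau> \<beta> j \<omega>) u0 (\<lambda>j. X j \<omega>) (\<lambda>j. w j \<omega>))"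
    then have \<epsilon>: "0 < \<epsilon>" "\<epsilon> < 1" and J: "J \<ge> 1" "\<tau> = T / real J" and \<eta>: "\<eta> \<le> 2 / (3 * d) * \<gamma> - 3 / (2 * d)"
      and \<T>: "cube_triangulation \<T>" "quasi_uniform \<kappa> \<T>" "mesh_size \<T> = \<epsilon> powr \<eta>"
      and M: "prob_space M" and \<beta>: "\<And>z. z \<in> mesh_nodes \<T> \<Longrightarrow> brownian_motion M (\<beta> z)"
      and u0: "u0 \<in> H2_space" "H2_norm u0 \<le> C\<^sub>H * \<epsilon> powr (- p)"
      and scheme: "AE \<omega> in M. CH_scheme \<epsilon> \<gamma> \<tau> J (\<lambda>j. noise_incr_bar \<T> \<tau> \<beta> j \<omega>) u0 (\<lambda>j. X j \<omega>) (\<lambda>j. w j \<omega>)"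
      by (auto simp: indep_brownian_motions_def d_def)
    have \<tau>: "0 < \<tau>" "real J * \<tau> = T" using J assms(2) by auto
    obtain n where "2 ^ n \<le> J" "J < 2 ^ (n + 1)" using ex_power_ivl1[of 2 J] J by auto
    \<comment> \<open>The smallest dyadic grid that contains all time steps; it spans a time of at
      most 2 T, which bounds the expected modulus.\<close>
    then obtain m where m: "J < 2 ^ m" "2 ^ m \<le> 2 * J" by (metis mult_le_mono2 power_Suc Suc_eq_plus1)
    define Z where "Z = mesh_nodes \<T>"
    define L where "L = real (card Z)"
    define G where "G z \<omega> = grid_modulus \<tau> m (\<beta> z) \<omega>" for z \<omega>
    have G: "1 \<le> G z \<omega>" for z \<omega> unfolding G_def by (rule grid_modulus_ge_1[OF \<tau>(1)])
    define a where "a = A * \<epsilon> powr (- (7 / 2) - \<theta>)"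
    define b where "b = D * \<epsilon> powr (\<gamma> - 2 / 5)"
    have ab: "0 \<le> a" "0 \<le> b" using A D by (auto simp: a_def b_def)
    have L: "0 \<le> L" by (simp add: L_def)
    have Linf: "Linf_norm (X j \<omega>) \<le> ennreal (a + b * (\<Sum>z\<in>Z. sqrt (G z \<omega>)))"
      if sch: "CH_scheme \<epsilon> \<gamma> \<tau> J (\<lambda>j. noise_incr_bar \<T> \<tau> \<beta> j \<omega>) u0 (\<lambda>j. X j \<omega>) (\<lambda>j. w j \<omega>)"
        and \<omega>: "\<omega> \<in> Omega_E M \<epsilon> J (C\<^sub>E * \<epsilon> powr (- \<theta>)) X" and j: "j \<in> {1..J}" for \<omega> j
    proof -
      have en: "energy \<epsilon> (X i \<omega>) \<le> ennreal (C\<^sub>E * \<epsilon> powr (- \<theta>))" if "1 \<le> i" "i \<le> J" for i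
      proof -
        have "energy \<epsilon> (X i \<omega>) \<le> (MAX j\<in>{0..J}. energy \<epsilon> (X j \<omega>))" using that by (intro Max_ge) auto
        then show ?thesis using \<omega> by (auto simp: Omega_E_def intro: order_trans)
      qed
      \<comment> \<open>p < 5/2, so the initial datum is of lower order than the nonlinear
        contribution.\<close>
      have H2: "H2_norm u0 + \<epsilon> powr (- (7 / 2) - \<theta>) \<le> (C\<^sub>H + 1) * \<epsilon> powr (- (7 / 2) - \<theta>)"
      proof -
        have "\<epsilon> powr (- p) \<le> \<epsilon> powr (- (7 / 2) - \<theta>)" using \<epsilon> assms(4,6) by (intro powr_mono') auto
        then have "C\<^sub>H * \<epsilon> powr (- p) \<le> C\<^sub>H * \<epsilon> powr (- (7 / 2) - \<theta>)" using assms(7) by (intro mult_left_mono) auto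
        then show ?thesis using u0(2) by (simp add: distrib_right)
      qed
      have X: "X j \<omega> \<in> L2_space" using sch j by (intro H1_L2) (auto simp: CH_scheme_def)
      have "Linf_norm (X j \<omega>) \<le> ennreal (2 ^ CARD('n) * (C1 * ((C\<^sub>H + 1) * \<epsilon> powr (- (7 / 2) - \<theta>))
          + C2 * \<epsilon> powr (\<gamma> - 2 / 5) * (\<Sum>z\<in>Z. sqrt (G z \<omega>))))"
      proof (rule Linf_norm_le_cos_coeff[OF X])
        fix K :: "('n \<Rightarrow> nat) set" assume K: "finite K"
        have "(\<Sum>k\<in>K. \<bar>cosine_coeff (X j \<omega>) k\<bar>) \<le> C1 * (H2_norm u0 + \<epsilon> powr (- (7 / 2) - \<theta>))
            + (\<Sum>k\<in>K - {\<lambda>_. 0}. \<bar>damped_sum (mode_damping \<epsilon> \<tau> k) (\<lambda>i. \<epsilon> powr \<gamma> * L2_inner (noise_incr_bar \<T> \<tau> \<beta> i \<omega>) (cos_mode k)) j\<bar>)"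
          by (rule C1(2)[OF \<epsilon> \<tau> sch u0(1) en]) (use j K in auto)
        also have "\<dots> \<le> C1 * ((C\<^sub>H + 1) * \<epsilon> powr (- (7 / 2) - \<theta>)) + C2 * \<epsilon> powr (\<gamma> - 2 / 5) * (\<Sum>z\<in>Z. sqrt (G z \<omega>))"
        proof (rule add_mono)
          show "C1 * (H2_norm u0 + \<epsilon> powr (- (7 / 2) - \<theta>)) \<le> C1 * ((C\<^sub>H + 1) * \<epsilon> powr (- (7 / 2) - \<theta>))"
            using C1(1) H2 by (intro mult_left_mono) auto
          show "(\<Sum>k\<in>K - {\<lambda>_. 0}. \<bar>damped_sum (mode_damping \<epsilon> \<tau> k) (\<lambda>i. \<epsilon> powr \<gamma> * L2_inner (noise_incr_bar \<T> \<tau> \<beta> i \<omega>) (cos_mode k)) j\<bar>)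
              \<le> C2 * \<epsilon> powr (\<gamma> - 2 / 5) * (\<Sum>z\<in>Z. sqrt (G z \<omega>))"
            unfolding Z_def G_def by (rule C2(2)[OF \<T>(1) \<epsilon>(1) \<tau>(1) _ K]) (use j m in auto)
        qed
        finally show "(\<Sum>k\<in>K. \<bar>cosine_coeff (X j \<omega>) k\<bar>) \<le> C1 * ((C\<^sub>H + 1) * \<epsilon> powr (- (7 / 2) - \<theta>))
            + C2 * \<epsilon> powr (\<gamma> - 2 / 5) * (\<Sum>z\<in>Z. sqrt (G z \<omega>))" .
      qed
      then show ?thesis unfolding a_def b_def A_def D_def by (simp only: distrib_left[of "2 ^ _"] mult.assoc)
    qed
    have sq: "(a + b * (\<Sum>z\<in>Z. sqrt (G z \<omega>)))\<^sup>2 \<le> 2 * a\<^sup>2 + 2 * b\<^sup>2 * L * (\<Sum>z\<in>Z. G z \<omega>)" for \<omega>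
    proof -
      define S where "S = (\<Sum>z\<in>Z. sqrt (G z \<omega>))"
      have G0: "0 \<le> G z \<omega>" for z using G[of z \<omega>] by simp
      have "S\<^sup>2 \<le> L * (\<Sum>z\<in>Z. (sqrt (G z \<omega>))\<^sup>2)"
        unfolding S_def L_def using sum_squared_le_sum_of_squares[of "\<lambda>z. sqrt (G z \<omega>)" Z] by (simp add: mult.commute)
      also have "\<dots> = L * (\<Sum>z\<in>Z. G z \<omega>)" using G0 by simp
      finally have "b\<^sup>2 * S\<^sup>2 \<le> b\<^sup>2 * (L * (\<Sum>z\<in>Z. G z \<omega>))" by (intro mult_left_mono) auto
      moreover have "(a + b * S)\<^sup>2 \<le> 2 * a\<^sup>2 + 2 * (b\<^sup>2 * S\<^sup>2)"
        using sum_squares_bound[of a "b * S"] unfolding power2_sum power_mult_distrib by linarith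
      ultimately show ?thesis by (simp add: S_def)
    qed
    let ?F = "\<lambda>\<omega>. MAX j\<in>{1..J}. indicator (Omega_E M \<epsilon> J (C\<^sub>E * \<epsilon> powr (- \<theta>)) X) \<omega> * (Linf_norm (X j \<omega>))\<^sup>2"
    \<comment> \<open>\<open>?F\<close> is not known to be measurable. Monotonicity of the
      nonnegative integral does not ask for it, and only the majorant, a sum of measurable moduli,
      is integrated term by term.\<close>
    have "(\<integral>\<^sup>+ \<omega>. ?F \<omega> \<partial>M) \<le> (\<integral>\<^sup>+ \<omega>. ennreal (2 * a\<^sup>2) + ennreal (2 * b\<^sup>2 * L) * (\<Sum>z\<in>Z. ennreal (G z \<omega>)) \<partial>M)"
    proof (rule nn_integral_mono_AE, use scheme in eventually_elim)
      fix \<omega> assume sch: "CH_scheme \<epsilon> \<gamma> \<tau> J (\<lambda>j. noise_incr_bar \<T> \<tau> \<beta> j \<omega>) u0 (\<lambda>j. X j \<omega>) (\<lambda>j. w j \<omega>)"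
      have eq: "ennreal (2 * a\<^sup>2 + 2 * b\<^sup>2 * L * (\<Sum>z\<in>Z. G z \<omega>)) = ennreal (2 * a\<^sup>2) + ennreal (2 * b\<^sup>2 * L) * (\<Sum>z\<in>Z. ennreal (G z \<omega>))"
        using L order_trans[OF zero_le_one G[of _ \<omega>]] by (simp add: ennreal_plus ennreal_mult sum_ennreal sum_nonneg)
      show "?F \<omega> \<le> ennreal (2 * a\<^sup>2) + ennreal (2 * b\<^sup>2 * L) * (\<Sum>z\<in>Z. ennreal (G z \<omega>))"
        unfolding eq[symmetric]
      proof (rule Max.boundedI)
        fix y assume "y \<in> (\<lambda>j. indicator (Omega_E M \<epsilon> J (C\<^sub>E * \<epsilon> powr (- \<theta>)) X) \<omega> * (Linf_norm (X j \<omega>))\<^sup>2) ` {1..J}"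
        then obtain j where j: "j \<in> {1..J}"
          and y: "y = indicator (Omega_E M \<epsilon> J (C\<^sub>E * \<epsilon> powr (- \<theta>)) X) \<omega> * (Linf_norm (X j \<omega>))\<^sup>2" by auto
        show "y \<le> ennreal (2 * a\<^sup>2 + 2 * b\<^sup>2 * L * (\<Sum>z\<in>Z. G z \<omega>))"
        proof (cases "\<omega> \<in> Omega_E M \<epsilon> J (C\<^sub>E * \<epsilon> powr (- \<theta>)) X")
          case True
          have "(Linf_norm (X j \<omega>))\<^sup>2 \<le> (ennreal (a + b * (\<Sum>z\<in>Z. sqrt (G z \<omega>))))\<^sup>2"
            by (intro power_mono Linf[OF sch True j]) auto
          also have "\<dots> = ennreal ((a + b * (\<Sum>z\<in>Z. sqrt (G z \<omega>)))\<^sup>2)"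
            using ab order_trans[OF zero_le_one G[of _ \<omega>]] by (intro ennreal_power add_nonneg_nonneg mult_nonneg_nonneg sum_nonneg) auto
          also have "\<dots> \<le> ennreal (2 * a\<^sup>2 + 2 * b\<^sup>2 * L * (\<Sum>z\<in>Z. G z \<omega>))" by (intro ennreal_leI sq)
          finally show ?thesis using True by (simp add: y)
        qed (simp add: y)
      qed (use J in auto)
    qed
    also have "\<dots> = ennreal (2 * a\<^sup>2) + ennreal (2 * b\<^sup>2 * L) * (\<Sum>z\<in>Z. \<integral>\<^sup>+\<omega>. ennreal (G z \<omega>) \<partial>M)"
    proof -
      have meas: "(\<lambda>\<omega>. ennreal (G z \<omega>)) \<in> borel_measurable M" if "z \<in> Z" for z
        unfolding G_def using grid_modulus_moment(2)[OF \<beta> M \<tau>(1) m(2) \<tau>(2)] that by (simp add: Z_def)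
      have "emeasure M (space M) = 1" by (rule prob_space.emeasure_space_1[OF M])
      then show ?thesis using meas by (simp add: nn_integral_add nn_integral_cmult nn_integral_sum)
    qed
    also have "\<dots> \<le> ennreal (2 * a\<^sup>2) + ennreal (2 * b\<^sup>2 * L) * (\<Sum>z\<in>Z. ennreal G0)"
      unfolding G_def G0_def using grid_modulus_moment(1)[OF \<beta> M \<tau>(1) m(2) \<tau>(2)]
      by (intro add_left_mono mult_left_mono sum_mono) (auto simp: Z_def)
    also have "\<dots> = ennreal (2 * a\<^sup>2 + 2 * b\<^sup>2 * L * (L * G0))"
      using L G0 by (simp add: ennreal_plus ennreal_mult ennreal_of_nat_eq_real_of_nat L_def)
    also have "\<dots> \<le> ennreal (C * \<epsilon> powr (- 2 * \<theta> - 7))"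
    proof (rule ennreal_leI)
      define P where "P = \<epsilon> powr (- 2 * \<theta> - 7)"
      have a2: "a\<^sup>2 = A\<^sup>2 * P"
      proof -
        have "(\<epsilon> powr (- (7 / 2) - \<theta>))\<^sup>2 = \<epsilon> powr (real 2 * (- (7 / 2) - \<theta>))" using \<epsilon> by (simp only: powr_power mult.commute)
        also have "real 2 * (- (7 / 2) - \<theta>) = - 2 * \<theta> - 7" by simp
        finally show ?thesis by (simp add: a_def P_def power_mult_distrib)
      qed
      have "L \<le> C3 * \<epsilon> powr (- (\<eta> * d))" unfolding L_def Z_def by (rule C3(2)[OF \<T>(1,2) \<epsilon>(1) \<T>(3)])
      then have "(b * L)\<^sup>2 \<le> (b * (C3 * \<epsilon> powr (- (\<eta> * d))))\<^sup>2"
        using ab L by (intro power_mono mult_left_mono) auto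
      also have "\<dots> = D\<^sup>2 * C3\<^sup>2 * (\<epsilon> powr (\<gamma> - 2 / 5) * \<epsilon> powr (- (\<eta> * d)))\<^sup>2"
        by (simp add: b_def power_mult_distrib)
      also have "(\<epsilon> powr (\<gamma> - 2 / 5) * \<epsilon> powr (- (\<eta> * d)))\<^sup>2 = \<epsilon> powr (2 * (\<gamma> - 2 / 5 - \<eta> * d))"
        using \<epsilon> by (simp add: powr_add[symmetric] powr_power algebra_simps)
      also have "\<dots> \<le> P" unfolding P_def
      proof (rule powr_mono')
        \<comment> \<open>The mesh condition turns the noise exponent \<gamma> - 2/5 - \<eta> d into
          at least \<gamma>/3 + 11/10 > 0, so the noise contribution stays bounded as \<epsilon>
          tends to 0.\<close>
        have "\<eta> * d \<le> (2 / (3 * d) * \<gamma> - 3 / (2 * d)) * d" using \<eta> d by (intro mult_right_mono) auto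
        also have "\<dots> = 2 / 3 * \<gamma> - 3 / 2" using d by (simp add: field_simps)
        finally show "- 2 * \<theta> - 7 \<le> 2 * (\<gamma> - 2 / 5 - \<eta> * d)" using assms(3,4) by (simp add: algebra_simps)
      qed (use \<epsilon> in auto)
      finally have bL: "(b * L)\<^sup>2 \<le> D\<^sup>2 * C3\<^sup>2 * P" by (simp add: mult_left_mono)
      have "2 * a\<^sup>2 + 2 * b\<^sup>2 * L * (L * G0) = 2 * a\<^sup>2 + 2 * G0 * (b * L)\<^sup>2" by (simp add: power2_eq_square)
      also have "\<dots> \<le> 2 * (A\<^sup>2 * P) + 2 * G0 * (D\<^sup>2 * C3\<^sup>2 * P)"
        using bL G0 by (intro add_mono mult_left_mono) (auto simp: a2)
      also have "\<dots> = C * P" by (simp add: C_def algebra_simps)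
      finally show "2 * a\<^sup>2 + 2 * b\<^sup>2 * L * (L * G0) \<le> C * \<epsilon> powr (- 2 * \<theta> - 7)" by (simp add: P_def)
    qed
    finally show "(\<integral>\<^sup>+ \<omega>. ?F \<omega> \<partial>M) \<le> ennreal (C * \<epsilon> powr (- 2 * \<theta> - 7))" .
  qed (use C in auto)
qed

end
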